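(* Let $\lambda\in(0,\frac13)$. Consider majority processes, and separately minority processes, under the proportional switching rule with parameter $\lambda$, where the initial coloring is uniform random (each node independently white or black with probability $\frac12$). For every $\varepsilon>0$ there exists a class of graphs (containing graphs with $n$ nodes for arbitrarily large $n$) such that, with high probability over the initial coloring, the stabilization time is $\Omega\!\left(n^{1+f\left(\frac{2\lambda}{1-\lambda}\right)-\varepsilon}\right)$.
   Context: Graphs are simple, unweighted and undirected with $n$ nodes; $N(v)$ is the neighborhood of $v$ and $d_v=|N(v)|$. A coloring assigns each node white or black. The conflicting neighbors $N_c(v)$ of $v$ are: in a majority process, the neighbors with color different from $v$; in a minority process, the neighbors with the same color as $v$. Under proportional switching with parameter $\lambda$, $v$ is switchable if $|N_c(v)|\ge\frac{1+\lambda}{2}d_v$. The process is sequential: in each step exactly one switchable node, chosen by an adversary maximizing the number of steps, changes to the opposite color. The stabilization time is the number of steps until no node is switchable, under the worst-case choice of switching order. The function $f:(0,1)\to(0,1)$ is defined by $f(\mu)=\max_{\varphi\in(0,\frac{1-\mu}{2}]}\frac{\log\left(\frac{1-\varphi}{\mu+\varphi}\right)}{\log\left(\frac{1-\varphi}{\varphi}\right)}$. An event holds with high probability if it holds with probability at least $1-O(n^{-c})$ for some constant $c>0$. *)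

theory Defs
  imports
    "HOL-Probability.Probability"
    "HOL-Real_Asymp.Real_Asymp"
    "Graph_Theory.Pair_Digraph"
begin

text \<open>Simple undirected graphs are the finite symmetric loop-free digraphs of the locale
  \<^locale>\<open>pair_graph\<close>; an undirected edge is a pair of opposite arcs. Colorings are boolean
  functions, \<^term>\<open>True\<close> meaning white.\<close>

type_synonym 'a coloring = "'a \<Rightarrow> bool"

datatype process = Majority | Minority

definition neighborhood :: "'a pair_pre_digraph \<Rightarrow> 'a \<Rightarrow> 'a set" where
  "neighborhood G v = {w \<in> pverts G. (v, w) \<in> parcs G}"

fun conflicting_neighbors ::
    "process \<Rightarrow> 'a pair_pre_digraph \<Rightarrow> 'a coloring \<Rightarrow> 'a \<Rightarrow> 'a set" where
  "conflicting_neighbors Majority G x v = {w \<in> neighborhood G v. x w \<noteq> x v}"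
| "conflicting_neighbors Minority G x v = {w \<in> neighborhood G v. x w = x v}"

definition switchable ::
    "process \<Rightarrow> real \<Rightarrow> 'a pair_pre_digraph \<Rightarrow> 'a coloring \<Rightarrow> 'a \<Rightarrow> bool" where
  "switchable P lam G x v \<longleftrightarrow> v \<in> pverts G \<and>
     real (card (conflicting_neighbors P G x v)) \<ge> (1 + lam) / 2 * real (card (neighborhood G v))"

definition switch_step ::
    "process \<Rightarrow> real \<Rightarrow> 'a pair_pre_digraph \<Rightarrow> 'a coloring rel" where
  "switch_step P lam G = {(x, x(v := \<not> x v)) | x v. switchable P lam G x v}"

definition stable ::
    "process \<Rightarrow> real \<Rightarrow> 'a pair_pre_digraph \<Rightarrow> 'a coloring \<Rightarrow> bool" where
  "stable P lam G x \<longleftrightarrow> (\<forall>v\<in>pverts G. \<not> switchable P lam G x v)"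

text \<open>The supremum ranges over the lengths of the runs that end in a stable coloring. An isolated
  node satisfies the switching inequality trivially and forever, so a graph with an isolated node has
  no such run and receives the value \<open>0\<close>. Hence this degenerate endless switching cannot
  witness a lower bound on the stabilization time.\<close>

definition stabilization_time ::
    "process \<Rightarrow> real \<Rightarrow> 'a pair_pre_digraph \<Rightarrow> 'a coloring \<Rightarrow> enat" where
  "stabilization_time P lam G x =
     Sup {enat k | k. \<exists>y. (x, y) \<in> switch_step P lam G ^^ k \<and> stable P lam G y}"

text \<open>Colors outside the node set are irrelevant and fixed to \<^term>\<open>False\<close>.\<close>

definition random_coloring :: "'a pair_pre_digraph \<Rightarrow> 'a coloring pmf" where
  "random_coloring G = Pi_pmf (pverts G) False (\<lambda>_. bernoulli_pmf (1 / 2))"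

text \<open>The constants \<open>c\<close>, \<open>K\<close> and the threshold on the number of nodes are uniform over the class.\<close>

definition with_high_probability ::
    "'a pair_pre_digraph set \<Rightarrow> ('a pair_pre_digraph \<Rightarrow> 'a coloring \<Rightarrow> bool) \<Rightarrow> bool" where
  "with_high_probability \<G> A \<longleftrightarrow>
     (\<exists>c>0. \<exists>K. \<forall>\<^sub>F n in sequentially. \<forall>G\<in>\<G>. card (pverts G) = n \<longrightarrow>
        measure_pmf.prob (random_coloring G) {x. A G x} \<ge> 1 - K * real n powr (- c))"

definition f_ratio :: "real \<Rightarrow> real \<Rightarrow> real" where
  "f_ratio \<mu> \<phi> = ln ((1 - \<phi>) / (\<mu> + \<phi>)) / ln ((1 - \<phi>) / \<phi>)"

definition f_exponent :: "real \<Rightarrow> real" where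
  "f_exponent \<mu> = (SUP \<phi>\<in>{0<..(1 - \<mu>) / 2}. f_ratio \<mu> \<phi>)"

text \<open>The supremum is a maximum, and it lies in the open unit interval.\<close>

lemma f_exponent_is_max:
  assumes "0 < \<mu>" "\<mu> < 1"
  shows "\<exists>\<phi>\<in>{0<..(1 - \<mu>) / 2}. f_exponent \<mu> = f_ratio \<mu> \<phi> \<and>
    (\<forall>\<psi>\<in>{0<..(1 - \<mu>) / 2}. f_ratio \<mu> \<psi> \<le> f_ratio \<mu> \<phi>)"
    and "0 < f_exponent \<mu>" and "f_exponent \<mu> < 1"
proof -
  define b where "b = (1 - \<mu>) / 2"
  have b: "0 < b" "b < 1 / 2" "\<mu> = 1 - 2 * b"
    using assms by (auto simp: b_def field_simps)
  have den: "ln ((1 - \<phi>) / \<phi>) > 0" if "0 < \<phi>" "\<phi> \<le> b" for \<phi>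
    using that b by (intro ln_gt_zero) (simp add: field_simps)
  have lt1: "f_ratio \<mu> \<phi> < 1" if "0 < \<phi>" "\<phi> \<le> b" for \<phi>
  proof -
    have "ln ((1 - \<phi>) / (\<mu> + \<phi>)) < ln ((1 - \<phi>) / \<phi>)"
      using that b assms by (subst ln_less_cancel_iff) (auto intro!: divide_strict_left_mono)
    then show ?thesis
      using den[OF that] by (simp add: f_ratio_def divide_less_eq)
  qed
  have at0: "f_ratio \<mu> 0 = 0"
    by (simp add: f_ratio_def)
  have lim0: "((\<lambda>\<phi>. f_ratio \<mu> \<phi>) \<longlongrightarrow> 0) (at_right 0)"
    unfolding f_ratio_def using assms by real_asymp
  have "continuous_on {0..b} (f_ratio \<mu>)"
    unfolding continuous_on_eq_continuous_within
  proof
    fix \<phi> assume \<phi>: "\<phi> \<in> {0..b}"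
    show "continuous (at \<phi> within {0..b}) (f_ratio \<mu>)"
    proof (cases "\<phi> = 0")
      case True
      have "((\<lambda>\<phi>. f_ratio \<mu> \<phi>) \<longlongrightarrow> 0) (at 0 within {0..b})"
        using lim0 b(1) by (simp add: at_within_Icc_at_right)
      then show ?thesis
        using True at0 by (simp add: continuous_within)
    next
      case False
      then have "0 < \<phi>" "\<phi> \<le> b"
        using \<phi> by auto
      then have "isCont (f_ratio \<mu>) \<phi>"
        unfolding f_ratio_def using den[of \<phi>] b assms by (intro continuous_intros) auto
      then show ?thesis
        by (rule continuous_at_imp_continuous_at_within)
    qed
  qed
  then obtain m where m: "m \<in> {0..b}" "\<And>\<psi>. \<psi> \<in> {0..b} \<Longrightarrow> f_ratio \<mu> \<psi> \<le> f_ratio \<mu> m"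
    using continuous_attains_sup[of "{0..b}" "f_ratio \<mu>"] b by auto
  have "f_ratio \<mu> (b / 2) > 0"
    using den[of "b / 2"] b
    by (auto simp: f_ratio_def intro!: divide_pos_pos ln_gt_zero simp: field_simps)
  then have pos: "f_ratio \<mu> m > 0"
    using m(2)[of "b / 2"] b by auto
  with at0 m(1) have m0: "m \<in> {0<..b}"
    by (cases "m = 0") auto
  have "f_exponent \<mu> = f_ratio \<mu> m"
    unfolding f_exponent_def b_def[symmetric] using m0 m(2) by (intro cSup_eq_maximum) auto
  then show "\<exists>\<phi>\<in>{0<..(1 - \<mu>) / 2}. f_exponent \<mu> = f_ratio \<mu> \<phi> \<and>
      (\<forall>\<psi>\<in>{0<..(1 - \<mu>) / 2}. f_ratio \<mu> \<psi> \<le> f_ratio \<mu> \<phi>)"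
    and "0 < f_exponent \<mu>" and "f_exponent \<mu> < 1"
    using m0 m(2) pos lt1[of m] unfolding b_def[symmetric] by auto
qed

end

theory Submission
  imports Defs
begin

text \<open>On a bipartite graph a minority process becomes a majority process when one side is recolored,
  and this does not change the distribution of the initial coloring; so let the process be a majority
  process. The nodes are arranged in layers, and a node is only ever switched because of conflicts
  with the preceding layer, so that the layers develop independently of what happens after them.

  The core of the graph consists of gadgets, each a tree of classes of nodes. A class of in-degree
  \<open>d\<close> has \<open>N\<close> child classes and out-degree \<open>g d\<close>, where \<open>g = \<phi> / (1 - \<phi>)\<close>. It can switch whenever
  \<open>(N + M) / 2\<close> of its children are in conflict with it, so one switch costs \<open>M\<close> switches of
  children. If the children take turns cyclically, and each can switch \<open>h\<close> times, then the parent can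
  switch about \<open>h N / M\<close> times (and at least \<open>h + 1\<close> times, which starts the growth). A tree with
  \<open>l + 1\<close> levels can be reset to its initial state by \<open>2 (l + 1)\<close> switches of the root of the preceding
  gadget, and then its own root can switch about \<open>(N / M) ^ l\<close> times. The loss of a factor linear in \<open>l\<close>
  per gadget is negligible for large \<open>l\<close>, so the number of switches grows by almost \<open>N / M\<close> per
  layer while the degrees shrink by \<open>g\<close> per layer.

  The first gadget is driven by a chain of layers with alternating colors. These colors are forced
  upon the random coloring by layers of helpers, whose degrees double from layer to layer. The first
  layer of helpers has polynomial degree and is controlled by private trees with seven nodes; with
  probability \<open>89 / 128 > 2 / 3\<close> the root of such a tree can be given a prescribed color. Here
  \<open>\<lambda> < 1 / 3\<close> is needed. Only a bounded number of layers has to be forced: the gadgets can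
  start from arbitrary colors, because they are reset before they are used.\<close>

section \<open>Cyclic schedules\<close>

text \<open>When a class has switched \<open>n + 1\<close> times, the children with the original color of
  the class are those in \<open>cyc N M n\<close>, a cyclic interval of length \<open>(N - M) / 2\<close> or \<open>(N + M) / 2\<close>.
  The summand \<open>N\<close> only avoids truncated subtraction.\<close>

definition cyc :: "nat \<Rightarrow> nat \<Rightarrow> nat \<Rightarrow> nat set" where
  "cyc N M n = (\<lambda>z. z mod N) ` {N + (n div 2) * M - (N - M) div 2 ..< N + ((n + 1) div 2) * M}"

text \<open>This is how often the child class \<open>e\<close> itself has to switch while the
  schedule of its parent advances \<open>n\<close> places.\<close>

definition toggles :: "nat \<Rightarrow> nat \<Rightarrow> nat \<Rightarrow> nat \<Rightarrow> nat" where
  "toggles N M e n = card {s. s < n \<and> (e \<in> cyc N M s) \<noteq> (e \<in> cyc N M (Suc s))}"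

text \<open>The number of times a class at height \<open>h\<close> can switch if the classes at height \<open>0\<close> are static.\<close>

primrec cap :: "nat \<Rightarrow> nat \<Rightarrow> nat \<Rightarrow> nat" where
  "cap N M 0 = 0"
| "cap N M (Suc h) = max (Suc (cap N M h)) (nat \<lfloor>(real (cap N M h) - 2) * real N / real M\<rfloor>)"

lemma inj_on_mod_interval:
  assumes "b \<le> a + N"
  shows "inj_on (\<lambda>z. z mod N) {a..<b::nat}"
proof (rule inj_onI)
  fix y z assume yz: "y \<in> {a..<b}" "z \<in> {a..<b}" "y mod N = z mod N"
  have "u = v" if "u \<le> v" "a \<le> u" "v < b" "u mod N = v mod N" for u v
  proof (rule ccontr)
    assume "u \<noteq> v"
    with that have "N dvd v - u" "0 < v - u" "v - u < N"
      using assms mod_eq_dvd_iff_nat[of u v N] by auto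
    then show False by (auto dest: dvd_imp_le)
  qed
  from this[of y z] this[of z y] yz show "y = z"
    by (metis atLeastLessThan_iff linear)
qed

lemma cyc_subset: "0 < N \<Longrightarrow> cyc N M n \<subseteq> {..<N}"
  by (auto simp: cyc_def)

lemma card_cyc:
  assumes "M \<le> N" "even (N - M)"
  shows "card (cyc N M n) = (N - M) div 2 + (if odd n then M else 0)"
proof -
  let ?h = "(N - M) div 2"
  have h: "2 * ?h = N - M" using assms by simp
  have d: "(n + 1) div 2 = n div 2 + (if odd n then 1 else 0)" by (cases "even n") auto
  have "inj_on (\<lambda>z. z mod N) {N + (n div 2) * M - ?h ..< N + ((n + 1) div 2) * M}"
    by (rule inj_on_mod_interval) (use h assms(1) in \<open>unfold d, cases "odd n"; simp add: algebra_simps\<close>)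
  then show ?thesis
    unfolding cyc_def using h assms(1) by (subst card_image) (auto simp: d)
qed

lemma toggles_le: "toggles N M e n \<le> n"
  unfolding toggles_def by (rule order_trans[OF card_mono[of "{..<n}"]]) auto

lemma toggles_0 [simp]: "toggles N M e 0 = 0"
  by (simp add: toggles_def)

lemma toggles_Suc:
  "toggles N M e (Suc n) =
     toggles N M e n + (if (e \<in> cyc N M n) \<noteq> (e \<in> cyc N M (Suc n)) then 1 else 0)"
proof -
  have "{s. s < Suc n \<and> (e \<in> cyc N M s) \<noteq> (e \<in> cyc N M (Suc s))} =
    {s. s < n \<and> (e \<in> cyc N M s) \<noteq> (e \<in> cyc N M (Suc s))} \<union>
    (if (e \<in> cyc N M n) \<noteq> (e \<in> cyc N M (Suc n)) then {n} else {})"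
    by (auto simp: less_Suc_eq)
  then show ?thesis
    unfolding toggles_def by (auto simp: card_insert_if)
qed

lemma odd_toggles: "odd (toggles N M e n) \<longleftrightarrow> (e \<in> cyc N M n) \<noteq> (e \<in> cyc N M 0)"
  by (induction n) (auto simp: toggles_Suc)

text \<open>Cut the interval into blocks of length \<open>N\<close>; each block contains at most one
  number with residue \<open>e\<close>.\<close>

lemma card_residue_interval_le:
  assumes "0 < N"
  shows "card {z \<in> {a..<a + len}. z mod N = e} \<le> len div N + 1"
proof -
  have "inj_on (\<lambda>z. (z - a) div N) {z \<in> {a..<a + len}. z mod N = e}"
  proof (rule inj_onI)
    fix y z assume yz: "y \<in> {z \<in> {a..<a + len}. z mod N = e}" "z \<in> {z \<in> {a..<a + len}. z mod N = e}"
      "(y - a) div N = (z - a) div N"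
    define q where "q = (y - a) div N"
    have "q * N \<le> y - a" "q * N \<le> z - a"
      using yz(3) div_times_less_eq_dividend[of "y - a" N] div_times_less_eq_dividend[of "z - a" N]
      unfolding q_def by simp_all
    moreover have "y - a < q * N + N" "z - a < q * N + N"
      using yz(3) dividend_less_div_times[OF assms, of "y - a"]
        dividend_less_div_times[OF assms, of "z - a"] by (simp_all add: q_def add.commute)
    ultimately have "q * N \<le> y - a" "y - a < q * N + N" "q * N \<le> z - a" "z - a < q * N + N"
      by blast+
    then have "y \<in> {a + q * N..<a + q * N + N}" "z \<in> {a + q * N..<a + q * N + N}"
      using yz by auto
    moreover have "y mod N = z mod N" using yz by simp
    ultimately show "y = z"
      using inj_onD[OF inj_on_mod_interval[of "a + q * N + N" "a + q * N" N], of y z] by blast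
  qed
  moreover have "(\<lambda>z. (z - a) div N) ` {z \<in> {a..<a + len}. z mod N = e} \<subseteq> {..len div N}"
    by (auto intro!: div_le_mono)
  ultimately show ?thesis
    using card_inj_on_le[of _ _ "{..len div N}"] by fastforce
qed

text \<open>An even step appends \<open>M\<close> numbers at the upper end of the cyclic interval,
  an odd step removes \<open>M\<close> at the lower end. The appended blocks are consecutive, and so
  are the removed ones; each kind fits into an interval of length \<open>(n + 1) div 2 * M\<close>,
  which meets the residue \<open>e\<close> about once per \<open>N\<close> numbers.\<close>

lemma toggles_bound:
  assumes "0 < M" "M \<le> N" "even (N - M)"
  shows "toggles N M e n \<le> 2 * (((n + 1) div 2 * M) div N + 1)"
proof -
  define h where "h = (N - M) div 2"
  have h: "2 * h = N - M" "h \<le> N" using assms by (auto simp: h_def)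
  define A where "A = {z \<in> {N..<N + (n + 1) div 2 * M}. z mod N = e}"
  define B where "B = {z \<in> {N - h..<N - h + (n + 1) div 2 * M}. z mod N = e}"
  \<comment> \<open>\<open>A\<close> holds the occurrences of \<open>e\<close> that enter at the
    upper end, \<open>B\<close> those that leave at the lower end. Division by \<open>M\<close>
    recovers the block, hence the step.\<close>
  have "{s. s < n \<and> (e \<in> cyc N M s) \<noteq> (e \<in> cyc N M (Suc s))} \<subseteq>
    (\<lambda>z. 2 * ((z - N) div M)) ` A \<union> (\<lambda>z. 2 * ((z + h - N) div M) + 1) ` B"
  proof
    fix s assume "s \<in> {s. s < n \<and> (e \<in> cyc N M s) \<noteq> (e \<in> cyc N M (Suc s))}"
    then have s: "s < n" "(e \<in> cyc N M s) \<noteq> (e \<in> cyc N M (Suc s))" by auto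
    show "s \<in> (\<lambda>z. 2 * ((z - N) div M)) ` A \<union> (\<lambda>z. 2 * ((z + h - N) div M) + 1) ` B"
    proof (cases "even s")
      case True
      then obtain j where j: "s = 2 * j" by auto
      have "{N + j * M - h ..< N + Suc j * M} =
          {N + j * M - h ..< N + j * M} \<union> {N + j * M ..< N + Suc j * M}" by auto
      then have "cyc N M (Suc s) = cyc N M s \<union> (\<lambda>z. z mod N) ` {N + j * M ..< N + Suc j * M}"
        by (simp add: cyc_def j h_def[symmetric] image_Un[symmetric])
      with s(2) have "e \<in> (\<lambda>z. z mod N) ` {N + j * M ..< N + Suc j * M}" by blast
      then obtain z where z: "z \<in> {N + j * M ..< N + Suc j * M}" "e = z mod N" by blast
      have "(z - N) div M = j"
        using z assms(1) by (intro div_nat_eqI) (auto simp: algebra_simps)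
      moreover have "Suc j \<le> (n + 1) div 2" using s j by auto
      then have "Suc j * M \<le> (n + 1) div 2 * M" by (rule mult_le_mono1)
      then have "z \<in> A" using z by (auto simp: A_def)
      ultimately show ?thesis using j by auto
    next
      case False
      then obtain j where j: "s = 2 * j + 1" by (auto elim: oddE)
      have "{N + j * M - h ..< N + Suc j * M} =
          {N + j * M - h ..< N + Suc j * M - h} \<union> {N + Suc j * M - h ..< N + Suc j * M}"
        using h by auto
      then have "cyc N M s = (\<lambda>z. z mod N) ` {N + j * M - h ..< N + Suc j * M - h} \<union> cyc N M (Suc s)"
        by (simp add: cyc_def j h_def[symmetric] image_Un[symmetric])
      with s(2) have "e \<in> (\<lambda>z. z mod N) ` {N + j * M - h ..< N + Suc j * M - h}" by blast
      then obtain z where z: "z \<in> {N + j * M - h ..< N + Suc j * M - h}" "e = z mod N" by blast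
      have "(z + h - N) div M = j"
        using z assms(1) h by (intro div_nat_eqI) (auto simp: algebra_simps)
      moreover have "Suc j \<le> (n + 1) div 2" using s j by auto
      then have "Suc j * M \<le> (n + 1) div 2 * M" by (rule mult_le_mono1)
      then have "z \<in> B" using z h by (auto simp: B_def)
      ultimately show ?thesis using j by auto
    qed
  qed
  then have "toggles N M e n \<le>
     card ((\<lambda>z. 2 * ((z - N) div M)) ` A \<union> (\<lambda>z. 2 * ((z + h - N) div M) + 1) ` B)"
    unfolding toggles_def by (intro card_mono) (auto simp: A_def B_def)
  also have "\<dots> \<le> card A + card B"
    by (rule order_trans[OF card_Un_le]) (auto intro!: add_mono card_image_le simp: A_def B_def)
  also have "\<dots> \<le> 2 * (((n + 1) div 2 * M) div N + 1)"
    using card_residue_interval_le[of N N "(n + 1) div 2 * M" e]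
      card_residue_interval_le[of N "N - h" "(n + 1) div 2 * M" e] assms
    unfolding A_def B_def by simp
  finally show ?thesis .
qed

text \<open>The two cases match the two arguments of \<open>max\<close> in \<open>cap\<close>:
  either \<open>n - 1\<close> changes are affordable outright, or \<open>toggles_bound\<close> gives
  at most \<open>n * M / N + 2\<close> of them. The index is \<open>n - 1\<close> because the first
  switch of a parent is free.\<close>

lemma toggles_le_cap:
  assumes MN: "0 < M" "M \<le> N" "even (N - M)" and n: "n \<le> cap N M (Suc h)"
  shows "toggles N M e (n - 1) \<le> cap N M h"
proof (cases "n - 1 \<le> cap N M h")
  case True
  then show ?thesis using toggles_le order_trans by blast
next
  case False
  define K where "K = cap N M h"
  have pos: "0 < n" using False by simp
  have "n \<le> nat \<lfloor>(real K - 2) * real N / real M\<rfloor>" using n False by (auto simp: K_def)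
  then have "real n \<le> (real K - 2) * real N / real M" using pos by linarith
  then have nK: "real n * real M / real N + 2 \<le> real K"
    using MN by (simp add: field_simps)
  have "real (toggles N M e (n - 1)) \<le> real (2 * ((n div 2 * M) div N + 1))"
    using toggles_bound[OF MN, of e "n - 1"] pos by (simp del: of_nat_mult of_nat_add of_nat_Suc)
  also have "\<dots> = 2 * real ((n div 2 * M) div N) + 2" by simp
  also have "real ((n div 2 * M) div N) \<le> real (n div 2 * M) / real N"
    by (rule of_nat_div_le_of_nat)
  also have "\<dots> \<le> (real n / 2) * real M / real N"
    using mult_right_mono[OF of_nat_div_le_of_nat[of n 2, where 'a = real], of "real M"]
    by (intro divide_right_mono) auto
  finally show ?thesis using nK by (simp add: K_def)
qed

lemma cap_ge: "h \<le> cap N M h"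
  by (induction h) auto

text \<open>With \<open>r = N / M\<close>, the lower bound \<open>(K - 2) * r - 1\<close> for the
  capacity following \<open>K\<close> has the fixed point \<open>\<kappa>\<close>, and the distance
  from it grows by the factor \<open>r\<close> per level. The linear bound \<open>cap_ge\<close>
  lifts the capacity to at least \<open>\<kappa> + 1\<close> at height \<open>h0\<close>.\<close>

lemma cap_growth:
  assumes "0 < M" "M < N"
  shows "\<exists>c>0. \<exists>h0. \<forall>h\<ge>h0. c * (real N / real M) ^ h \<le> real (cap N M h)"
proof -
  define r where "r = real N / real M"
  have r: "1 < r" using assms by (simp add: r_def)
  define \<kappa> where "\<kappa> = (2 * r + 1) / (r - 1)"
  have \<kappa>: "\<kappa> * (r - 1) = 2 * r + 1" "0 \<le> \<kappa>" using r by (auto simp: \<kappa>_def)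
  define h0 where "h0 = nat \<lceil>\<kappa> + 1\<rceil>"
  have step: "r * (real (cap N M h) - \<kappa>) \<le> real (cap N M (Suc h)) - \<kappa>" for h
  proof -
    define K where "K = cap N M h"
    have "(real K - 2) * r - 1 \<le> real (nat \<lfloor>(real K - 2) * real N / real M\<rfloor>)"
      unfolding r_def by (simp, linarith)
    also have "\<dots> \<le> real (cap N M (Suc h))" by (simp add: K_def)
    finally show ?thesis using \<kappa>(1) by (simp add: K_def algebra_simps)
  qed
  have "r ^ j \<le> real (cap N M (h0 + j)) - \<kappa>" for j
  proof (induction j)
    case 0
    have "\<kappa> + 1 \<le> real h0" by (simp add: h0_def) linarith
    also have "\<dots> \<le> real (cap N M h0)" using cap_ge by simp
    finally show ?case by simp
  next
    case (Suc j)
    have "r ^ Suc j \<le> r * (real (cap N M (h0 + j)) - \<kappa>)" using Suc r by simp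
    also have "\<dots> \<le> real (cap N M (h0 + Suc j)) - \<kappa>" using step by simp
    finally show ?case .
  qed
  then have "(1 / r ^ h0) * r ^ h \<le> real (cap N M h)" if "h0 \<le> h" for h
    using \<kappa>(2) r that spec[of "\<lambda>j. r ^ j \<le> real (cap N M (h0 + j)) - \<kappa>" "h - h0"]
    by (simp add: power_diff)
  then show ?thesis unfolding r_def[symmetric]
    using r by (intro exI[of _ "1 / r ^ h0"]) auto
qed

section \<open>Layered processes\<close>

text \<open>\<open>inn t p\<close> is the set of positions in layer \<open>t - 1\<close> adjacent to position \<open>p\<close> of layer \<open>t\<close>.\<close>

type_synonym state = "nat \<times> nat \<Rightarrow> bool"

text \<open>Only conflicts with layer \<open>t - 1\<close> are counted against \<open>th t\<close>.
  By \<open>th_le\<close>, conflict with all neighbors there always suffices.\<close>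

locale cascade =
  fixes m T :: nat and inn :: "nat \<Rightarrow> nat \<Rightarrow> nat set" and th :: "nat \<Rightarrow> real"
  assumes inn_subset: "0 < t \<Longrightarrow> t \<le> T \<Longrightarrow> p < m \<Longrightarrow> inn t p \<subseteq> {..<m}"
    and th_le: "0 < t \<Longrightarrow> t \<le> T \<Longrightarrow> p < m \<Longrightarrow> th t \<le> real (card (inn t p))"
begin

definition cstep :: "nat \<Rightarrow> nat \<Rightarrow> state rel" where
  "cstep a b = {(x, x((t, p) := \<not> x (t, p))) | x t p. a < t \<and> t \<le> b \<and> p < m \<and>
     th t \<le> real (card {q \<in> inn t p. x (t - 1, q) \<noteq> x (t, p)})}"

text \<open>\<open>reserve a b n c x\<close>: layer \<open>b\<close> has the color \<open>c\<close> throughout, and \<open>n\<close> more times all of it can be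
  switched with steps in the layers between \<open>a\<close> and \<open>b\<close>. What happens in later layers does not
  matter (lemma \<open>reserve_cong\<close>).\<close>

primrec reserve :: "nat \<Rightarrow> nat \<Rightarrow> nat \<Rightarrow> bool \<Rightarrow> state \<Rightarrow> bool" where
  "reserve a b 0 c x \<longleftrightarrow> (\<forall>p<m. x (b, p) = c)"
| "reserve a b (Suc n) c x \<longleftrightarrow> (\<forall>p<m. x (b, p) = c) \<and>
     (\<exists>y. (x, y) \<in> (cstep a b)\<^sup>* \<and> reserve a b n (\<not> c) y)"

lemma cstep_mono: "a' \<le> a \<Longrightarrow> b \<le> b' \<Longrightarrow> cstep a b \<subseteq> cstep a' b'"
  unfolding cstep_def by fastforce

lemma cstep_rtrancl_mono: "a' \<le> a \<Longrightarrow> b \<le> b' \<Longrightarrow> (x, y) \<in> (cstep a b)\<^sup>* \<Longrightarrow> (x, y) \<in> (cstep a' b')\<^sup>*"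
  using rtrancl_mono[OF cstep_mono] by blast

lemma cstep_relpow_mono:
  "a' \<le> a \<Longrightarrow> b \<le> b' \<Longrightarrow> (x, y) \<in> cstep a b ^^ k \<Longrightarrow> (x, y) \<in> cstep a' b' ^^ k"
  using relpowp_mono[of "\<lambda>x y. (x, y) \<in> cstep a b" "\<lambda>x y. (x, y) \<in> cstep a' b'" k x y]
    cstep_mono[of a' a b b'] by (simp add: relpowp_relpow_eq) blast

lemma cstep_relpow_unchanged:
  "(x, y) \<in> cstep a b ^^ k \<Longrightarrow> t \<le> a \<or> b < t \<Longrightarrow> y (t, p) = x (t, p)"
  by (induction k arbitrary: y) (auto simp: cstep_def)

lemma cstep_rtrancl_unchanged:
  "(x, y) \<in> (cstep a b)\<^sup>* \<Longrightarrow> t \<le> a \<or> b < t \<Longrightarrow> y (t, p) = x (t, p)"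
  using cstep_relpow_unchanged rtrancl_imp_relpow by metis

text \<open>Steps of \<open>cstep a b\<close> read and write only the layers \<open>a\<close> to
  \<open>b\<close>, so a run can be replayed in any state that agrees on these layers.\<close>

lemma cstep_relpow_local:
  assumes "(x, y) \<in> cstep a b ^^ k" "\<And>t p. a \<le> t \<Longrightarrow> t \<le> b \<Longrightarrow> x' (t, p) = x (t, p)"
  shows "(x', \<lambda>(t, p). if a \<le> t \<and> t \<le> b then y (t, p) else x' (t, p)) \<in> cstep a b ^^ k"
  using assms(1)
proof (induction k arbitrary: y)
  case 0
  then have "y = x" by simp
  then have "(\<lambda>(t, p). if a \<le> t \<and> t \<le> b then y (t, p) else x' (t, p)) = x'"
    using assms(2) by (auto simp: fun_eq_iff)
  then show ?case by simp
next
  case (Suc k)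
  then obtain z where z: "(x, z) \<in> cstep a b ^^ k" "(z, y) \<in> cstep a b" by auto
  let ?ext = "\<lambda>y. \<lambda>(t, p). if a \<le> t \<and> t \<le> b then y (t, p) else x' (t, p)"
  from z(2) obtain t p where tp: "a < t" "t \<le> b" "p < m"
    "th t \<le> real (card {q \<in> inn t p. z (t - 1, q) \<noteq> z (t, p)})" "y = z((t, p) := \<not> z (t, p))"
    by (auto simp: cstep_def)
  have "?ext y = (?ext z)((t, p) := \<not> ?ext z (t, p))"
    using tp(1,2,5) by (auto simp: fun_eq_iff)
  moreover have "{q \<in> inn t p. z (t - 1, q) \<noteq> z (t, p)} =
      {q \<in> inn t p. ?ext z (t - 1, q) \<noteq> ?ext z (t, p)}"
    using tp(1,2) by auto
  ultimately have "(?ext z, ?ext y) \<in> cstep a b"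
    unfolding cstep_def using tp(1-4) by (intro CollectI exI[of _ "?ext z"] exI[of _ t] exI[of _ p]) simp
  with Suc.IH[OF z(1)] show ?case by (rule relpow_Suc_I)
qed

lemma reserve_cong:
  assumes "reserve a b n c x" "a \<le> b" "\<And>t p. a \<le> t \<Longrightarrow> t \<le> b \<Longrightarrow> x' (t, p) = x (t, p)"
  shows "reserve a b n c x'"
  using assms(1,3)
proof (induction n arbitrary: c x x')
  case 0
  then show ?case using assms(2) by simp
next
  case (Suc n)
  then obtain y where y: "(x, y) \<in> (cstep a b)\<^sup>*" "reserve a b n (\<not> c) y" by auto
  then obtain k where "(x, y) \<in> cstep a b ^^ k" using rtrancl_imp_relpow by metis
  from cstep_relpow_local[OF this Suc.prems(2)]
  have "(x', \<lambda>(t, p). if a \<le> t \<and> t \<le> b then y (t, p) else x' (t, p)) \<in> (cstep a b)\<^sup>*"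
    using relpow_imp_rtrancl by blast
  moreover have "reserve a b n (\<not> c) (\<lambda>(t, p). if a \<le> t \<and> t \<le> b then y (t, p) else x' (t, p))"
    using y(2) by (rule Suc.IH) auto
  ultimately show ?case using Suc.prems assms(2) by auto
qed

lemma reserve_mono_color: "reserve a b n c x \<Longrightarrow> \<forall>p<m. x (b, p) = c"
  by (cases n) auto

lemma cstep_relpow_card:
  "(x, y) \<in> cstep a b ^^ k \<Longrightarrow> finite {v. x v \<noteq> y v} \<and> card {v. x v \<noteq> y v} \<le> k"
proof (induction k arbitrary: y)
  case 0
  then show ?case by simp
next
  case (Suc k)
  then obtain z where z: "(x, z) \<in> cstep a b ^^ k" "(z, y) \<in> cstep a b" by auto
  then obtain v where "y = z(v := \<not> z v)" by (auto simp: cstep_def)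
  then have "{v. x v \<noteq> y v} \<subseteq> insert v {v. x v \<noteq> z v}" by auto
  with Suc.IH[OF z(1)] show ?case
    using finite_subset card_mono[of "insert v {v. x v \<noteq> z v}" "{v. x v \<noteq> y v}"]
    by (auto simp: card_insert_if split: if_splits)
qed

text \<open>All \<open>m\<close> nodes of layer \<open>b\<close> change color, and each step changes
  one node; this is where the factor \<open>m\<close> in the number of steps comes from.\<close>

lemma reserve_Suc_run:
  assumes "reserve a b (Suc n) c x"
  obtains k y where "m \<le> k" "(x, y) \<in> cstep a b ^^ k" "reserve a b n (\<not> c) y"
proof -
  from assms obtain y where y: "(x, y) \<in> (cstep a b)\<^sup>*" "reserve a b n (\<not> c) y" by auto
  then obtain k where k: "(x, y) \<in> cstep a b ^^ k" using rtrancl_imp_relpow by metis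
  have "(\<lambda>p. (b, p)) ` {..<m} \<subseteq> {v. x v \<noteq> y v}"
    using reserve_mono_color[OF assms] reserve_mono_color[OF y(2)] by auto
  then have "card ((\<lambda>p. (b, p)) ` {..<m}) \<le> k"
    using cstep_relpow_card[OF k] card_mono order_trans by blast
  then have "m \<le> k" by (simp add: card_image inj_on_def)
  with k y(2) that show ?thesis by blast
qed

lemma reserve_run:
  assumes "reserve a b (n + 2 * j) c x"
  shows "\<exists>k y. 2 * j * m \<le> k \<and> (x, y) \<in> cstep a b ^^ k \<and> reserve a b n c y"
  using assms
proof (induction j arbitrary: x)
  case 0
  then show ?case by (intro exI[of _ 0] exI[of _ x]) simp
next
  case (Suc j)
  then have "reserve a b (Suc (Suc (n + 2 * j))) c x" by simp
  then obtain k y where y: "m \<le> k" "(x, y) \<in> cstep a b ^^ k" "reserve a b (Suc (n + 2 * j)) (\<not> c) y"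
    by (rule reserve_Suc_run)
  from y(3) obtain k' y' where y': "m \<le> k'" "(y, y') \<in> cstep a b ^^ k'" "reserve a b (n + 2 * j) (\<not> \<not> c) y'"
    by (rule reserve_Suc_run)
  with Suc.IH[of y'] obtain k'' y'' where y'': "2 * j * m \<le> k''" "(y', y'') \<in> cstep a b ^^ k''" "reserve a b n c y''"
    by auto
  have "(x, y'') \<in> cstep a b ^^ (k + k' + k'')"
    using y(2) y'(2) y''(2) by (auto simp: relpow_add)
  moreover have "2 * Suc j * m \<le> k + k' + k''" using y(1) y'(1) y''(1) by simp
  ultimately show ?case using y''(3) by blast
qed

lemma flip_layer:
  assumes "a < t" "t \<le> b" "S \<subseteq> {..<m}"
    "\<And>p. p \<in> S \<Longrightarrow> th t \<le> real (card {q \<in> inn t p. x (t - 1, q) \<noteq> x (t, p)})"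
  shows "(x, \<lambda>(t', p). if t' = t \<and> p \<in> S then \<not> x (t', p) else x (t', p)) \<in> (cstep a b)\<^sup>*"
proof -
  have "finite S" using assms(3) finite_subset by blast
  then show ?thesis using assms(3,4)
  proof (induction S rule: finite_induct)
    case empty
    then show ?case by simp
  next
    case (insert p S)
    let ?y = "\<lambda>(t', p). if t' = t \<and> p \<in> S then \<not> x (t', p) else x (t', p)"
    have eq: "(\<lambda>(t', q). if t' = t \<and> q \<in> insert p S then \<not> x (t', q) else x (t', q)) =
        ?y((t, p) := \<not> ?y (t, p))"
      using insert.hyps by (auto simp: fun_eq_iff)
    have "t \<noteq> t - 1" using assms(1) by simp
    then have "{q \<in> inn t p. ?y (t - 1, q) \<noteq> ?y (t, p)} = {q \<in> inn t p. x (t - 1, q) \<noteq> x (t, p)}"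
      using insert.hyps by auto
    then have "th t \<le> real (card {q \<in> inn t p. ?y (t - 1, q) \<noteq> ?y (t, p)})"
      using insert.prems(2)[of p] by simp
    then have "(?y, ?y((t, p) := \<not> ?y (t, p))) \<in> cstep a b"
      unfolding cstep_def using assms(1,2) insert.prems by blast
    moreover have "(x, ?y) \<in> (cstep a b)\<^sup>*" using insert by simp
    ultimately show ?case unfolding eq by (meson rtrancl.rtrancl_into_rtrancl)
  qed
qed

lemma flip_layer_full:
  assumes "a < t" "t \<le> b" "b \<le> T" "S \<subseteq> {..<m}"
    "\<And>p q. p \<in> S \<Longrightarrow> q < m \<Longrightarrow> x (t - 1, q) \<noteq> x (t, p)"
  shows "(x, \<lambda>(t', p). if t' = t \<and> p \<in> S then \<not> x (t', p) else x (t', p)) \<in> (cstep a b)\<^sup>*"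
proof (rule flip_layer[OF assms(1,2,4)])
  fix p assume p: "p \<in> S"
  then have pm: "p < m" using assms(4) by auto
  have "{q \<in> inn t p. x (t - 1, q) \<noteq> x (t, p)} = inn t p"
    using assms(5)[OF p] inn_subset[of t p] pm assms(1-3) by auto
  then show "th t \<le> real (card {q \<in> inn t p. x (t - 1, q) \<noteq> x (t, p)})"
    using th_le[of t p] pm assms(1-3) by simp
qed

text \<open>The layers behind \<open>b\<close> adopt \<open>c\<close> in ascending order: a node of
  the other color is in conflict with its entire, already uniform, preceding layer.\<close>

lemma drive:
  assumes "\<forall>p<m. x (b, p) = c" "b \<le> t" "t \<le> T"
  shows "\<exists>y. (x, y) \<in> (cstep b T)\<^sup>* \<and> (\<forall>p<m. y (t, p) = c) \<and> (\<forall>t' p. t < t' \<longrightarrow> y (t', p) = x (t', p))"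
  using assms(2,3)
proof (induction t rule: dec_induct)
  case base
  then show ?case using assms(1) by auto
next
  case (step t)
  then obtain y where y: "(x, y) \<in> (cstep b T)\<^sup>*" "\<forall>p<m. y (t, p) = c"
    "\<forall>t' p. t < t' \<longrightarrow> y (t', p) = x (t', p)" by auto
  let ?S = "{p. p < m \<and> y (Suc t, p) \<noteq> c}"
  have "(y, \<lambda>(t', p). if t' = Suc t \<and> p \<in> ?S then \<not> y (t', p) else y (t', p)) \<in> (cstep b T)\<^sup>*"
    by (rule flip_layer_full) (use step y(2) in auto)
  with y(1) have "(x, \<lambda>(t', p). if t' = Suc t \<and> p \<in> ?S then \<not> y (t', p) else y (t', p)) \<in> (cstep b T)\<^sup>*"
    by (rule rtrancl_trans)
  moreover have "\<forall>p<m. (\<lambda>(t', p). if t' = Suc t \<and> p \<in> ?S then \<not> y (t', p) else y (t', p)) (Suc t, p) = c"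
    by auto
  moreover have "\<forall>t' p. Suc t < t' \<longrightarrow>
      (\<lambda>(t', p). if t' = Suc t \<and> p \<in> ?S then \<not> y (t', p) else y (t', p)) (t', p) = x (t', p)"
    using y(3) by auto
  ultimately show ?case by blast
qed

text \<open>Once layer \<open>t - 1\<close> is uniformly \<open>c\<close>, any chosen nodes of layer
  \<open>t\<close> can be turned to \<open>c\<close>. Nodes with the other target keep their color
  until layer \<open>b\<close> has flipped.\<close>

lemma set_layer:
  assumes "\<forall>p<m. x (b, p) = c" "b < t" "t \<le> T"
  shows "\<exists>y. (x, y) \<in> (cstep b T)\<^sup>* \<and> (\<forall>p<m. y (t, p) = (if g p = c then c else x (t, p))) \<and>
    (\<forall>t' p. t < t' \<longrightarrow> y (t', p) = x (t', p))"
proof -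
  have "b \<le> t - 1" "t - 1 \<le> T" using assms by auto
  from drive[OF assms(1) this]
  obtain y where y: "(x, y) \<in> (cstep b T)\<^sup>*" "\<forall>p<m. y (t - 1, p) = c"
    "\<forall>t' p. t - 1 < t' \<longrightarrow> y (t', p) = x (t', p)"
    by blast
  let ?S = "{p. p < m \<and> y (t, p) \<noteq> c \<and> g p = c}"
  have "(y, \<lambda>(t', p). if t' = t \<and> p \<in> ?S then \<not> y (t', p) else y (t', p)) \<in> (cstep b T)\<^sup>*"
    by (rule flip_layer_full) (use assms y(2) in auto)
  with y(1) have "(x, \<lambda>(t', p). if t' = t \<and> p \<in> ?S then \<not> y (t', p) else y (t', p)) \<in> (cstep b T)\<^sup>*"
    by (rule rtrancl_trans)
  moreover have "y (t, p) = x (t, p)" for p using y(3) assms(2) by simp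
  then have "\<forall>p<m. (\<lambda>(t', p). if t' = t \<and> p \<in> ?S then \<not> y (t', p) else y (t', p)) (t, p) =
      (if g p = c then c else x (t, p))" by auto
  moreover have "\<forall>t' p. t < t' \<longrightarrow>
      (\<lambda>(t', p). if t' = t \<and> p \<in> ?S then \<not> y (t', p) else y (t', p)) (t', p) = x (t', p)"
    using y(3) by auto
  ultimately show ?thesis by blast
qed

text \<open>The layers above \<^term>\<open>b\<close> can be brought into any pattern, one layer per two flips of
  layer \<^term>\<open>b\<close>: between flips, all layers below the one being treated copy layer \<^term>\<open>b\<close>.\<close>

lemma recharge:
  assumes "reserve a b (n + 2 * j) c x" "a \<le> b" "b \<le> L - j" "L \<le> T" "j \<le> L"
  shows "\<exists>y. (x, y) \<in> (cstep a T)\<^sup>* \<and> reserve a b n c y \<and>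
    (\<forall>t p. L - j < t \<and> t \<le> L \<and> p < m \<longrightarrow> y (t, p) = g t p)"
  using assms(1,3,5)
proof (induction j arbitrary: n)
  case 0
  then show ?case by auto
next
  case (Suc j)
  have "reserve a b (Suc (Suc n) + 2 * j) c x" using Suc.prems by simp
  moreover have "b \<le> L - j" "j \<le> L" using Suc.prems by auto
  ultimately obtain y where y: "(x, y) \<in> (cstep a T)\<^sup>*" "reserve a b (Suc (Suc n)) c y"
    "\<And>t p. L - j < t \<Longrightarrow> t \<le> L \<Longrightarrow> p < m \<Longrightarrow> y (t, p) = g t p"
    using Suc.IH by blast
  \<comment> \<open>Layer \<open>t\<close> is the next one below the finished layers. Nodes with
    target \<open>c\<close> are set first, then layer \<open>b\<close> flips, nodes with target
    \<open>\<not> c\<close> are set, and a second flip restores \<open>c\<close>.\<close>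
  define t where "t = L - j"
  have t: "b < t" "t \<le> T" "t - 1 = L - Suc j" using Suc.prems assms(4) by (auto simp: t_def)
  have bT: "b \<le> T" using t by simp
  obtain y1 where y1: "(y, y1) \<in> (cstep b T)\<^sup>*"
    "\<And>p. p < m \<Longrightarrow> y1 (t, p) = (if g t p = c then c else y (t, p))"
    "\<And>t' p. t < t' \<Longrightarrow> y1 (t', p) = y (t', p)"
    using set_layer[OF reserve_mono_color[OF y(2)] t(1,2), of "g t"] by metis
  have "reserve a b (Suc (Suc n)) c y1"
    using y(2) assms(2) by (rule reserve_cong) (use cstep_rtrancl_unchanged[OF y1(1)] in auto)
  then obtain y2 where y2: "(y1, y2) \<in> (cstep a b)\<^sup>*" "reserve a b (Suc n) (\<not> c) y2"
    using reserve.simps(2)[of a b "Suc n"] by blast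
  obtain y3 where y3: "(y2, y3) \<in> (cstep b T)\<^sup>*"
    "\<And>p. p < m \<Longrightarrow> y3 (t, p) = (if g t p = (\<not> c) then \<not> c else y2 (t, p))"
    "\<And>t' p. t < t' \<Longrightarrow> y3 (t', p) = y2 (t', p)"
    using set_layer[OF reserve_mono_color[OF y2(2)] t(1,2), of "g t"] by metis
  have "reserve a b (Suc n) (\<not> c) y3"
    using y2(2) assms(2) by (rule reserve_cong) (use cstep_rtrancl_unchanged[OF y3(1)] in auto)
  then obtain y4 where y4: "(y3, y4) \<in> (cstep a b)\<^sup>*" "reserve a b n c y4" by auto
  have "(x, y4) \<in> (cstep a T)\<^sup>*"
    using y(1) cstep_rtrancl_mono[OF assms(2) order_refl y1(1)] cstep_rtrancl_mono[OF order_refl bT y2(1)]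
      cstep_rtrancl_mono[OF assms(2) order_refl y3(1)] cstep_rtrancl_mono[OF order_refl bT y4(1)]
    by (meson rtrancl_trans)
  moreover have "y4 (t', p) = g t' p" if "L - Suc j < t'" "t' \<le> L" "p < m" for t' p
  proof -
    have bt: "b < t'" using that t by simp
    then have "y4 (t', p) = y3 (t', p)" "y2 (t', p) = y1 (t', p)"
      using cstep_rtrancl_unchanged[OF y4(1)] cstep_rtrancl_unchanged[OF y2(1)] by auto
    moreover have "t' = t \<or> t < t'" using that t by auto
    moreover have "y (t', p) = g t' p" if "t < t'"
      using y(3)[of t' p] that \<open>t' \<le> L\<close> \<open>p < m\<close> by (simp add: t_def)
    ultimately show ?thesis
      using y1(2,3) y3(2,3) that by (auto split: if_splits)
  qed
  ultimately show ?case using y4(2) by blast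
qed

text \<open>Alternating layers: letting every layer copy its predecessor, last layer first, shifts the
  pattern by one.\<close>

lemma alternating_reserve:
  assumes "b \<le> T" "n \<le> b" "\<And>t p. b - n \<le> t \<Longrightarrow> t \<le> b \<Longrightarrow> p < m \<Longrightarrow> x (t, p) = (c \<noteq> odd (b - t))"
  shows "reserve 0 b n c x"
  using assms(2,3)
proof (induction n arbitrary: c x)
  case 0
  then show ?case by simp
next
  case (Suc n)
  note alt = Suc.prems
  \<comment> \<open>After \<open>j\<close> rounds the last \<open>j\<close> layers have flipped. The
    next layer to flip still has an unflipped predecessor, which has the opposite color.\<close>
  have "\<exists>y. (x, y) \<in> (cstep 0 b)\<^sup>* \<and> (\<forall>t p. p < m \<longrightarrow> b - Suc n \<le> t \<longrightarrow> t \<le> b \<longrightarrow>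
      y (t, p) = (if b - j < t then \<not> x (t, p) else x (t, p)))" if "j \<le> Suc n" for j
    using that
  proof (induction j)
    case 0
    then show ?case by (intro exI[of _ x]) auto
  next
    case (Suc j)
    then obtain y where y: "(x, y) \<in> (cstep 0 b)\<^sup>*" "\<And>t p. p < m \<Longrightarrow> b - Suc n \<le> t \<Longrightarrow> t \<le> b \<Longrightarrow>
      y (t, p) = (if b - j < t then \<not> x (t, p) else x (t, p))" by auto
    define t where "t = b - j"
    have t: "0 < t" "t \<le> b" "b - Suc n \<le> t - 1" "b - t = j" "b - (t - 1) = Suc j"
      using Suc.prems alt(1) by (auto simp: t_def)
    let ?z = "\<lambda>(t', p). if t' = t \<and> p \<in> {..<m} then \<not> y (t', p) else y (t', p)"
    have "(y, ?z) \<in> (cstep 0 b)\<^sup>*"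
    proof (rule flip_layer_full)
      fix p q assume pq: "p \<in> {..<m}" "q < m"
      have "y (t - 1, q) = x (t - 1, q)" "y (t, p) = x (t, p)"
        using y(2)[of q "t - 1"] y(2)[of p t] t pq by (auto simp: t_def)
      then show "y (t - 1, q) \<noteq> y (t, p)"
        using t pq alt(2)[of "t - 1" q] alt(2)[of t p] by auto
    qed (use t assms(1) in auto)
    with y(1) have "(x, ?z) \<in> (cstep 0 b)\<^sup>*" by (rule rtrancl_trans)
    moreover have "?z (t', p) = (if b - Suc j < t' then \<not> x (t', p) else x (t', p))"
      if "p < m" "b - Suc n \<le> t'" "t' \<le> b" for t' p
      using y(2)[OF that] that t by (auto simp: t_def)
    ultimately show ?case by blast
  qed
  from this[of "Suc n"] obtain y where y: "(x, y) \<in> (cstep 0 b)\<^sup>*"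
    "\<And>t p. p < m \<Longrightarrow> b - Suc n < t \<Longrightarrow> t \<le> b \<Longrightarrow> y (t, p) = (\<not> x (t, p))" by auto
  have "reserve 0 b n (\<not> c) y"
  proof (rule Suc.IH)
    fix t p assume "b - n \<le> t" "t \<le> b" "p < m"
    moreover have "b - Suc n < t" using calculation Suc.prems(1) by simp
    ultimately show "y (t, p) = ((\<not> c) \<noteq> odd (b - t))"
      using y(2)[of p t] Suc.prems(2)[of t p] by auto
  qed (use Suc.prems in simp)
  moreover have "\<forall>p<m. x (b, p) = c" using Suc.prems(2)[of b] by simp
  ultimately show ?case using y(1) by auto
qed

end

section \<open>Towers of gadgets\<close>

text \<open>Beyond layer \<open>Q\<close>, each block of \<open>l + 1\<close> layers is a gadget, with its root as the last layer. The
  class of position \<open>p\<close> at distance \<open>d\<close> from the root is \<open>p mod N ^ d\<close>; the digits of this number in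
  base \<open>N\<close> describe the path from the root to the class.\<close>

locale tower = cascade m T inn th
  for m T :: nat and inn :: "nat \<Rightarrow> nat \<Rightarrow> nat set" and th :: "nat \<Rightarrow> real" +
  fixes l N M Q :: nat
  assumes MN: "0 < M" "M < N" "even (N - M)"
    and digits: "Q < t \<Longrightarrow> t \<le> T \<Longrightarrow> p < m \<Longrightarrow> q \<in> inn t p \<Longrightarrow> (T - t) mod Suc l = d \<Longrightarrow> d < l \<Longrightarrow>
      q mod N ^ d = p mod N ^ d"
    and branches: "Q < t \<Longrightarrow> t \<le> T \<Longrightarrow> p < m \<Longrightarrow> (T - t) mod Suc l = d \<Longrightarrow> d < l \<Longrightarrow>
      S \<subseteq> {..<N} \<Longrightarrow> N + M \<le> 2 * card S \<Longrightarrow>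
      th t \<le> real (card {q \<in> inn t p. (q div N ^ d) mod N \<in> S})"
begin

declare reserve.simps(2) [simp del]

text \<open>\<open>cnt \<tau> d p\<close> is the number of switches of the class of \<open>p\<close> when the root has switched \<open>\<tau>\<close> times.
  The truncated subtraction is intended: the first switch of a class needs no switch of its children.\<close>

primrec cnt :: "nat \<Rightarrow> nat \<Rightarrow> nat \<Rightarrow> nat" where
  "cnt \<tau> 0 p = \<tau>"
| "cnt \<tau> (Suc d) p = toggles N M ((p div N ^ d) mod N) (cnt \<tau> d p - 1)"

text \<open>The colors of a freshly reset gadget. They are chosen so that \<open>col_Suc\<close>
  holds: a child has the base color of its parent exactly while its index lies in the current cyclic
  interval.\<close>

primrec base :: "nat \<Rightarrow> nat \<Rightarrow> bool" where
  "base 0 p = True"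
| "base (Suc d) p = (base d p = ((p div N ^ d) mod N \<in> cyc N M 0))"

definition col :: "nat \<Rightarrow> nat \<Rightarrow> nat \<Rightarrow> bool" where
  "col \<tau> d p = (base d p \<noteq> odd (cnt \<tau> d p))"

lemma col_Suc:
  "col \<tau> (Suc d) p = (base d p = ((p div N ^ d) mod N \<in> cyc N M (cnt \<tau> d p - 1)))"
  by (auto simp: col_def odd_toggles)

lemma digit_eq: "(p mod N ^ Suc j) div N ^ j = (p div N ^ j) mod N"
proof -
  have "0 < N ^ j" using MN by simp
  then show ?thesis by (simp only: power_Suc2 mod_mult2_eq) simp
qed

lemma digit_cong:
  assumes "p mod N ^ d = q mod N ^ d" "j < d"
  shows "(p div N ^ j) mod N = (q div N ^ j) mod N"
proof -
  have "N ^ Suc j dvd N ^ d" using assms(2) by (intro le_imp_power_dvd) simp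
  then have "p mod N ^ Suc j = q mod N ^ Suc j"
    using assms(1) by (metis mod_mod_cancel)
  then show ?thesis using digit_eq by metis
qed

text \<open>Only the lowest \<open>d\<close> digits of the position enter, so both functions are
  well defined on classes.\<close>

lemma base_cnt_cong:
  assumes "p mod N ^ d = q mod N ^ d"
  shows "base d p = base d q" "cnt \<tau> d p = cnt \<tau> d q"
proof -
  have "base j p = base j q \<and> cnt \<tau> j p = cnt \<tau> j q" if "j \<le> d" for j
    using that by (induction j) (auto simp: digit_cong[OF assms])
  then show "base d p = base d q" "cnt \<tau> d p = cnt \<tau> d q" by auto
qed

lemma cnt_le_cap: "\<tau> \<le> cap N M l \<Longrightarrow> d \<le> l \<Longrightarrow> cnt \<tau> d p \<le> cap N M (l - d)"
proof (induction d)
  case 0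
  then show ?case by simp
next
  case (Suc d)
  then have "cnt \<tau> d p \<le> cap N M (Suc (l - Suc d))"
    by (simp add: Suc_diff_Suc del: cap.simps)
  with MN have "toggles N M ((p div N ^ d) mod N) (cnt \<tau> d p - 1) \<le> cap N M (l - Suc d)"
    by (intro toggles_le_cap) simp_all
  then show ?case by simp
qed

text \<open>Between consecutive switches of the root every class moves at most once, so a single
  pass over the gadget realizes the change.\<close>

lemma cnt_Suc_cases: "cnt (Suc \<tau>) d p = cnt \<tau> d p \<or> cnt (Suc \<tau>) d p = Suc (cnt \<tau> d p)"
proof (induction d)
  case 0
  then show ?case by simp
next
  case (Suc d)
  show ?case
  proof (cases "cnt (Suc \<tau>) d p = cnt \<tau> d p \<or> cnt \<tau> d p = 0")
    case True
    then show ?thesis using Suc by auto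
  next
    case False
    then have "cnt (Suc \<tau>) d p - 1 = Suc (cnt \<tau> d p - 1)" using Suc by auto
    then show ?thesis by (auto simp: toggles_Suc)
  qed
qed

text \<open>The pass treats children before parents: when a class switches, its children already
  have their colors for time \<open>Suc \<tau>\<close>.\<close>

lemma cap_step:
  assumes L: "Q + l < L" "L \<le> T" "(T - L) mod Suc l = 0"
    and x: "\<And>d p. d \<le> l \<Longrightarrow> p < m \<Longrightarrow> x (L - d, p) = col \<tau> d p"
    and \<tau>: "\<tau> < cap N M l"
  shows "\<exists>y. (x, y) \<in> (cstep (L - l) L)\<^sup>* \<and> (\<forall>d\<le>l. \<forall>p<m. y (L - d, p) = col (Suc \<tau>) d p)"
proof -
  have "\<exists>y. (x, y) \<in> (cstep (L - l) L)\<^sup>* \<and> (\<forall>d\<le>l. \<forall>p<m. y (L - d, p) =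
      (if l - j \<le> d then col (Suc \<tau>) d p else col \<tau> d p))" if "j \<le> l" for j
    using that
  proof (induction j)
    case 0
    \<comment> \<open>Classes at distance \<open>l\<close> have capacity \<open>0\<close> and stay
      as they are, so the pass starts with nothing to do.\<close>
    have "cnt (Suc \<tau>) l p = 0" "cnt \<tau> l p = 0" for p
      using cnt_le_cap[of "Suc \<tau>" l p] cnt_le_cap[of \<tau> l p] \<tau> by auto
    then show ?case using x by (intro exI[of _ x]) (auto simp: col_def)
  next
    case (Suc j)
    then obtain y where y: "(x, y) \<in> (cstep (L - l) L)\<^sup>*"
      "\<And>d p. d \<le> l \<Longrightarrow> p < m \<Longrightarrow> y (L - d, p) = (if l - j \<le> d then col (Suc \<tau>) d p else col \<tau> d p)"
      by auto
    define d where "d = l - Suc j"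
    have d: "d < l" "Suc d = l - j" "\<not> l - j \<le> d" using Suc.prems by (auto simp: d_def)
    define S where "S = {p. p < m \<and> cnt (Suc \<tau>) d p \<noteq> cnt \<tau> d p}"
    define t where "t = L - d"
    have t: "Q < t" "t \<le> T" "0 < t" "t - 1 = L - Suc d" "L - l < t" "t \<le> L"
      using d L by (auto simp: t_def)
    have Td: "(T - t) mod Suc l = d"
    proof -
      have "T - t = (T - L) + d" using L d by (simp add: t_def)
      moreover have "((T - L) + d) mod Suc l = ((T - L) mod Suc l + d) mod Suc l"
        by (rule mod_add_left_eq[symmetric])
      ultimately show ?thesis using L(3) d(1) by simp
    qed
    let ?z = "\<lambda>(t', p). if t' = t \<and> p \<in> S then \<not> y (t', p) else y (t', p)"
    have "(y, ?z) \<in> (cstep (L - l) L)\<^sup>*"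
    proof (rule flip_layer)
      fix p assume p: "p \<in> S"
      then have pm: "p < m" by (simp add: S_def)
      define n where "n = cnt \<tau> d p"
      have n: "cnt (Suc \<tau>) d p = Suc n" using p cnt_Suc_cases by (auto simp: S_def n_def)
      \<comment> \<open>The indices of the children in conflict with a class that has switched
        \<open>n\<close> times. For either parity there are \<open>(N + M) / 2\<close> of them,
        which is what \<open>branches\<close> asks for.\<close>
      define I where "I = (if even n then {..<N} - cyc N M n else cyc N M n)"
      have I: "I \<subseteq> {..<N}" "N + M \<le> 2 * card I"
        using cyc_subset[of N M n] card_cyc[of M N n] MN
        by (auto simp: I_def card_Diff_subset finite_subset)
      have yp: "y (t, p) = (base d p \<noteq> odd n)"
        using y(2)[of d p] d pm by (simp add: t_def col_def n_def)
      have "{q \<in> inn t p. (q div N ^ d) mod N \<in> I} \<subseteq> {q \<in> inn t p. y (t - 1, q) \<noteq> y (t, p)}"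
      proof
        fix q assume "q \<in> {q \<in> inn t p. (q div N ^ d) mod N \<in> I}"
        then have q: "q \<in> inn t p" "(q div N ^ d) mod N \<in> I" by auto
        have qm: "q < m" using inn_subset[of t p] q(1) t pm by auto
        have "q mod N ^ d = p mod N ^ d" using digits[OF t(1,2) pm q(1) Td d(1)] .
        then have "base d q = base d p" "cnt (Suc \<tau>) d q = Suc n"
          using base_cnt_cong n by metis+
        moreover have "y (L - Suc d, q) = col (Suc \<tau>) (Suc d) q"
          using y(2)[of "Suc d" q] d(1,2) qm by simp
        ultimately have "y (t - 1, q) = (base d p = ((q div N ^ d) mod N \<in> cyc N M n))"
          unfolding t(4) by (simp add: col_Suc)
        then show "q \<in> {q \<in> inn t p. y (t - 1, q) \<noteq> y (t, p)}"
          using q yp by (auto simp: I_def split: if_splits)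
      qed
      moreover have "finite (inn t p)" using inn_subset[of t p] t pm finite_subset by blast
      ultimately have "card {q \<in> inn t p. (q div N ^ d) mod N \<in> I} \<le>
          card {q \<in> inn t p. y (t - 1, q) \<noteq> y (t, p)}"
        by (intro card_mono) auto
      with branches[OF t(1,2) pm Td d(1) I]
      show "th t \<le> real (card {q \<in> inn t p. y (t - 1, q) \<noteq> y (t, p)})" by linarith
    qed (use t in \<open>auto simp: S_def\<close>)
    with y(1) have "(x, ?z) \<in> (cstep (L - l) L)\<^sup>*" by (rule rtrancl_trans)
    moreover have "?z (L - d', p) = (if l - Suc j \<le> d' then col (Suc \<tau>) d' p else col \<tau> d' p)"
      if "d' \<le> l" "p < m" for d' p
    proof (cases "d' = d")
      case True
      have "y (t, p) = col \<tau> d p" using y(2)[of d p] d that by (simp add: t_def)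
      then show ?thesis
        using True cnt_Suc_cases[of \<tau> d p] that by (auto simp: t_def d_def[symmetric] S_def col_def)
    next
      case False
      then have "L - d' \<noteq> t" "(l - Suc j \<le> d') = (l - j \<le> d')"
        using that d L by (auto simp: t_def)
      then show ?thesis using y(2)[OF that] by simp
    qed
    ultimately show ?case by blast
  qed
  from this[of l] show ?thesis by simp
qed

lemma gadget_reserve:
  assumes L: "Q + l < L" "L \<le> T" "(T - L) mod Suc l = 0"
    and x: "\<And>d p. d \<le> l \<Longrightarrow> p < m \<Longrightarrow> x (L - d, p) = col \<tau> d p"
    and \<tau>: "\<tau> + n \<le> cap N M l"
  shows "reserve (L - l) L n (even \<tau>) x"
  using x \<tau>
proof (induction n arbitrary: x \<tau>)
  case 0
  then show ?case using 0(1)[of 0] by (auto simp: col_def)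
next
  case (Suc n)
  obtain y where y: "(x, y) \<in> (cstep (L - l) L)\<^sup>*" "\<forall>d\<le>l. \<forall>p<m. y (L - d, p) = col (Suc \<tau>) d p"
    using cap_step[OF L, of x \<tau>] Suc.prems by auto
  have "reserve (L - l) L n (even (Suc \<tau>)) y"
    by (rule Suc.IH) (use y(2) Suc.prems in auto)
  moreover have "\<forall>p<m. x (L, p) = even \<tau>"
    using Suc.prems(1)[of 0] by (auto simp: col_def)
  ultimately show ?case using y(1) by (auto simp: reserve.simps(2))
qed

text \<open>The number of resets of the next gadget, at \<open>2 * Suc l\<close> flips each, that
  one charged gadget can pay for.\<close>

definition gain :: nat where
  "gain = cap N M l div (2 * Suc l)"

text \<open>Induction on the number \<open>r\<close> of gadgets behind layer \<open>b\<close>. The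
  \<open>2 * Suc l\<close> flips of layer \<open>b\<close> reset the nearest gadget, whose root then
  flips often enough for \<open>gain\<close> applications of the induction hypothesis to the
  remaining gadgets.\<close>

lemma tower_run:
  assumes "reserve a b (n + 2 * Suc l) c x" "b + r * Suc l = T" "Q \<le> b" "a \<le> b"
  shows "\<exists>k y. m * gain ^ r \<le> k \<and> (x, y) \<in> cstep a T ^^ k \<and> reserve a b n c y"
  using assms
proof (induction r arbitrary: a b n c x)
  case 0
  then obtain k y where "2 * Suc l * m \<le> k" "(x, y) \<in> cstep a b ^^ k" "reserve a b n c y"
    using reserve_run[of a b n "Suc l" c x] by blast
  moreover have "m * gain ^ 0 \<le> 2 * Suc l * m" by simp
  ultimately show ?case using 0 by (metis add_0_right mult_0 order_trans)
next
  case (Suc r)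
  define L where "L = b + Suc l"
  have TL: "L + r * Suc l = T" using Suc.prems by (simp add: L_def)
  then have "T - L = r * Suc l" by simp
  then have "(T - L) mod Suc l = 0" by (simp only: mod_mult_self2_is_0)
  then have L: "Q + l < L" "L \<le> T" "(T - L) mod Suc l = 0" "L - l = Suc b" "b = L - Suc l"
    using Suc.prems TL by (auto simp: L_def)
  obtain y where y: "(x, y) \<in> (cstep a T)\<^sup>*" "reserve a b n c y"
    "\<forall>t p. L - Suc l < t \<and> t \<le> L \<and> p < m \<longrightarrow> y (t, p) = base (L - t) p"
    using recharge[of a b n "Suc l" c x L "\<lambda>t. base (L - t)"] Suc.prems(1,4) L by auto
  have ycol: "y (L - d, p) = col 0 d p" if "d \<le> l" "p < m" for d p
  proof -
    have "cnt 0 d p = 0" by (induction d) auto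
    moreover have "L - Suc l < L - d" "L - (L - d) = d" using that L by auto
    ultimately show ?thesis using y(3) that by (auto simp: col_def)
  qed
  have "reserve (L - l) L (cap N M l) (even (0::nat)) y"
    by (rule gadget_reserve[OF L(1-3)]) (use ycol in auto)
  moreover define n' where "n' = cap N M l mod (2 * Suc l)"
  have "cap N M l = n' + gain * (2 * Suc l)"
    unfolding n'_def gain_def by (rule mod_div_mult_eq[symmetric])
  ultimately have res: "reserve (Suc b) L (n' + gain * (2 * Suc l)) True y" using L by simp
  have bL: "Q \<le> L" "Suc b \<le> L" using L(1) by (auto simp: L_def)
  note IH = Suc.IH
  have "\<exists>k z. i * (m * gain ^ r) \<le> k \<and> (y, z) \<in> cstep (Suc b) T ^^ k \<and> reserve (Suc b) L n' True z"
    if "reserve (Suc b) L (n' + i * (2 * Suc l)) True y" for i y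
    using that
  proof (induction i arbitrary: y)
    case 0
    then show ?case by (intro exI[of _ 0] exI[of _ y]) simp
  next
    case (Suc i)
    have "reserve (Suc b) L ((n' + i * (2 * Suc l)) + 2 * Suc l) True y"
      using Suc.prems by (simp add: algebra_simps del: reserve.simps)
    from IH[OF this TL] obtain k z where kz: "m * gain ^ r \<le> k" "(y, z) \<in> cstep (Suc b) T ^^ k"
      "reserve (Suc b) L (n' + i * (2 * Suc l)) True z"
      using bL by blast
    from Suc.IH[OF kz(3)] obtain k' z' where "i * (m * gain ^ r) \<le> k'" "(z, z') \<in> cstep (Suc b) T ^^ k'"
      "reserve (Suc b) L n' True z'" by blast
    then show ?case using kz by (intro exI[of _ "k + k'"] exI[of _ z']) (auto simp: relpow_add)
  qed
  from this[OF res] obtain k z where z: "gain * (m * gain ^ r) \<le> k" "(y, z) \<in> cstep (Suc b) T ^^ k"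
    by blast
  from y(1) obtain k0 where k0: "(x, y) \<in> cstep a T ^^ k0" using rtrancl_imp_relpow by metis
  have "(x, z) \<in> cstep a T ^^ (k0 + k)"
    using k0 cstep_relpow_mono[of a "Suc b" T T y z k] z(2) Suc.prems by (auto simp: relpow_add)
  moreover have "reserve a b n c z"
    using y(2) Suc.prems(4) by (rule reserve_cong) (use cstep_relpow_unchanged[OF z(2)] in auto)
  moreover have "m * gain ^ Suc r \<le> k0 + k" using z(1) by (simp add: ac_simps)
  ultimately show ?case by blast
qed

text \<open>The alternating layers supply \<open>Q\<close> flips of layer \<open>Q\<close>, enough
  for one reset of the first gadget.\<close>

lemma alternating_run:
  assumes "2 * Suc l \<le> Q" "Q + r * Suc l = T" "\<And>t p. t \<le> Q \<Longrightarrow> p < m \<Longrightarrow> x (t, p) = odd t"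
  shows "\<exists>k y. m * gain ^ r \<le> k \<and> (x, y) \<in> cstep 0 T ^^ k"
proof -
  have "reserve 0 Q Q (odd Q) x"
    using assms by (intro alternating_reserve) (auto simp: le_diff_conv)
  then have "reserve 0 Q ((Q - 2 * Suc l) + 2 * Suc l) (odd Q) x"
    using assms(1) by (simp only: le_add_diff_inverse2)
  from tower_run[OF this assms(2)] show ?thesis by blast
qed

end

section \<open>Runs and stabilization time\<close>

fun conflicts :: "process \<Rightarrow> 'a coloring \<Rightarrow> 'a \<Rightarrow> 'a \<Rightarrow> bool" where
  "conflicts Majority x v w \<longleftrightarrow> x w \<noteq> x v"
| "conflicts Minority x v w \<longleftrightarrow> x w = x v"

lemma conflicting_neighbors_altdef:
  "conflicting_neighbors P G x v = {w \<in> neighborhood G v. conflicts P x v w}"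
  by (cases P) auto

lemma conflicts_sym: "conflicts P x v w = conflicts P x w v"
  by (cases P) auto

lemma conflicts_flip: "w \<noteq> v \<Longrightarrow> conflicts P (x(v := \<not> x v)) v w \<longleftrightarrow> \<not> conflicts P x v w"
  by (cases P) auto

lemma conflicts_other: "u \<noteq> v \<Longrightarrow> w \<noteq> v \<Longrightarrow> conflicts P (x(v := b)) u w = conflicts P x u w"
  by (cases P) auto

context
  fixes G :: "'a pair_pre_digraph" and P :: process and lam :: real
  assumes G: "pair_graph G" and lam: "0 < lam"
    and no_isolated: "\<And>v. v \<in> pverts G \<Longrightarrow> neighborhood G v \<noteq> {}"
begin

interpretation pair_graph G by (rule G)

text \<open>A switch exchanges the conflicting and the other edges at \<open>v\<close>. Since
  \<open>lam > 0\<close> and the neighborhood is nonempty, the conflicting ones were a strict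
  majority.\<close>

lemma conflict_arcs_decrease:
  assumes "(x, y) \<in> switch_step P lam G"
  shows "card {(u, w) \<in> parcs G. conflicts P y u w} < card {(u, w) \<in> parcs G. conflicts P x u w}"
proof -
  from assms obtain v where v: "switchable P lam G x v" and y: "y = x(v := \<not> x v)"
    by (auto simp: switch_step_def)
  define A where "A = {(u, w) \<in> parcs G. u \<noteq> v \<and> w \<noteq> v \<and> conflicts P x u w}"
  define B where "B z = {w \<in> neighborhood G v. conflicts P z v w}" for z
  have vG: "v \<in> pverts G" using v by (simp add: switchable_def)
  have sym: "(u, w) \<in> parcs G \<longleftrightarrow> (w, u) \<in> parcs G" for u w
    using pair_sym_arcs by (auto simp: symmetric_def sym_def arcs_ends_def arc_to_ends_def)
  have noloop: "(u, u) \<notin> parcs G" for u using pair_no_loops by fastforce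
  have nb: "neighborhood G v = {w. (v, w) \<in> parcs G}"
    by (auto simp: neighborhood_def dest: in_arcsD2)
  have finnb: "finite (neighborhood G v)"
    using pair_finite_verts by (auto simp: neighborhood_def)
  have fin: "finite (B z)" for z
    using finnb by (simp add: B_def)
  have "A \<subseteq> parcs G" by (auto simp: A_def)
  then have finA: "finite A" using pair_finite_arcs by (rule finite_subset)
  have split: "card {(u, w) \<in> parcs G. conflicts P z u w} = card A + 2 * card (B z)"
    if z: "\<And>u w. u \<noteq> v \<Longrightarrow> w \<noteq> v \<Longrightarrow> conflicts P z u w = conflicts P x u w" for z
  proof -
    have "(u, w) \<in> parcs G \<and> conflicts P z u w \<longleftrightarrow>
        (u, w) \<in> A \<union> (Pair v ` B z \<union> (\<lambda>w. (w, v)) ` B z)" for u w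
    proof
      assume "(u, w) \<in> parcs G \<and> conflicts P z u w"
      then have uw: "(u, w) \<in> parcs G" "conflicts P z u w" by auto
      show "(u, w) \<in> A \<union> (Pair v ` B z \<union> (\<lambda>w. (w, v)) ` B z)"
      proof (cases "u = v")
        case True
        then have "w \<in> B z" using uw by (simp add: B_def nb)
        then show ?thesis using True by blast
      next
        case u: False
        show ?thesis
        proof (cases "w = v")
          case True
          then have "u \<in> B z" using uw sym[of u v] conflicts_sym[of P z u v] by (simp add: B_def nb)
          then show ?thesis using True by blast
        next
          case False
          then have "(u, w) \<in> A" using uw u z by (simp add: A_def)
          then show ?thesis by blast
        qed
      qed
    next
      assume "(u, w) \<in> A \<union> (Pair v ` B z \<union> (\<lambda>w. (w, v)) ` B z)"
      then consider "(u, w) \<in> A" | "u = v" "w \<in> B z" | "w = v" "u \<in> B z" by blast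
      then show "(u, w) \<in> parcs G \<and> conflicts P z u w"
        using z sym[of u v] conflicts_sym[of P z u v] by cases (simp_all add: A_def B_def nb)
    qed
    then have "{(u, w) \<in> parcs G. conflicts P z u w} = A \<union> (Pair v ` B z \<union> (\<lambda>w. (w, v)) ` B z)"
      by blast
    moreover have "A \<inter> (Pair v ` B z \<union> (\<lambda>w. (w, v)) ` B z) = {}"
      by (auto simp: A_def)
    moreover have "Pair v ` B z \<inter> (\<lambda>w. (w, v)) ` B z = {}"
      using noloop by (auto simp: B_def nb)
    moreover have "card (Pair v ` B z) = card (B z)" "card ((\<lambda>w. (w, v)) ` B z) = card (B z)"
      by (auto intro!: card_image inj_onI)
    ultimately show ?thesis
      using fin finA by (simp add: card_Un_disjoint)
  qed
  have "conflicts P y v w \<longleftrightarrow> \<not> conflicts P x v w" if "(v, w) \<in> parcs G" for w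
    unfolding y using that noloop by (intro conflicts_flip) auto
  then have "B y = neighborhood G v - B x" by (auto simp: B_def nb)
  moreover have "B x \<subseteq> neighborhood G v" by (auto simp: B_def)
  ultimately have By: "card (B y) + card (B x) = card (neighborhood G v)"
    using finnb fin by (metis card_Diff_subset card_mono le_add_diff_inverse2)
  have "0 < card (neighborhood G v)" using no_isolated[OF vG] finnb by (simp add: card_gt_0_iff)
  then have "1 / 2 * real (card (neighborhood G v)) < (1 + lam) / 2 * real (card (neighborhood G v))"
    using lam by (intro mult_strict_right_mono) auto
  also have "\<dots> \<le> real (card (B x))"
    using v by (simp add: switchable_def B_def conflicting_neighbors_altdef)
  finally have "card (B y) < card (B x)" using By by simp
  then show ?thesis
    using split[of x] split[of y] by (simp add: y conflicts_other)
qed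

lemma reaches_stable: "\<exists>y j. (x, y) \<in> switch_step P lam G ^^ j \<and> stable P lam G y"
proof (induction "card {(u, w) \<in> parcs G. conflicts P x u w}" arbitrary: x rule: less_induct)
  case less
  show ?case
  proof (cases "stable P lam G x")
    case True
    then show ?thesis by (intro exI[of _ x] exI[of _ 0]) simp
  next
    case False
    then obtain v where "switchable P lam G x v" by (auto simp: stable_def)
    then have step: "(x, x(v := \<not> x v)) \<in> switch_step P lam G" by (auto simp: switch_step_def)
    from less[OF conflict_arcs_decrease[OF step]] obtain y j where
      "(x(v := \<not> x v), y) \<in> switch_step P lam G ^^ j" "stable P lam G y" by blast
    then show ?thesis using relpow_Suc_I2[OF step] by blast
  qed
qed

text \<open>The supremum in \<open>stabilization_time\<close> ranges over runs that end in a stable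
  coloring; every run can be prolonged to such a run.\<close>

lemma le_stabilization_time:
  assumes "(x, y) \<in> switch_step P lam G ^^ k"
  shows "enat k \<le> stabilization_time P lam G x"
proof -
  obtain z j where z: "(y, z) \<in> switch_step P lam G ^^ j" "stable P lam G z"
    using reaches_stable by blast
  have "(x, z) \<in> switch_step P lam G ^^ (k + j)"
    using assms z(1) by (auto simp: relpow_add)
  then have "enat (k + j) \<le> stabilization_time P lam G x"
    unfolding stabilization_time_def using z(2) by (intro Sup_upper) blast
  then show ?thesis by (rule order_trans[rotated]) simp
qed

end

section \<open>Bipartite graphs: treating both processes at once\<close>

locale bipartite =
  fixes V :: "'a::countable set" and Nb :: "'a \<Rightarrow> 'a set" and side :: "'a \<Rightarrow> bool"
  assumes finV: "finite V"
    and Nb_sub: "v \<in> V \<Longrightarrow> Nb v \<subseteq> V"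
    and Nb_sym: "v \<in> V \<Longrightarrow> w \<in> Nb v \<Longrightarrow> v \<in> Nb w"
    and Nb_side: "v \<in> V \<Longrightarrow> w \<in> Nb v \<Longrightarrow> side w \<noteq> side v"
    and Nb_nonempty: "v \<in> V \<Longrightarrow> Nb v \<noteq> {}"
begin

definition gr :: "nat pair_pre_digraph" where
  "gr = \<lparr>pverts = to_nat ` V, parcs = {(to_nat v, to_nat w) | v w. v \<in> V \<and> w \<in> Nb v}\<rparr>"

definition astep :: "real \<Rightarrow> 'a coloring rel" where
  "astep lam = {(z, z(v := \<not> z v)) | z v. v \<in> V \<and>
     (1 + lam) / 2 * real (card (Nb v)) \<le> real (card {w \<in> Nb v. z w \<noteq> z v})}"

text \<open>Minority processes on a bipartite graph are majority processes after recoloring one side.\<close>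

definition view :: "process \<Rightarrow> nat coloring \<Rightarrow> 'a coloring" where
  "view P x v \<longleftrightarrow> v \<in> V \<and> (if P = Minority \<and> side v then \<not> x (to_nat v) else x (to_nat v))"

lemma pair_graph_gr: "pair_graph gr"
proof
  fix e assume e: "e \<in> parcs gr"
  then obtain v w where vw: "e = (to_nat v, to_nat w)" "v \<in> V" "w \<in> Nb v" by (auto simp: gr_def)
  then show "fst e \<in> pverts gr" "snd e \<in> pverts gr" using Nb_sub by (auto simp: gr_def)
  have "v \<noteq> w" using vw Nb_side by blast
  then show "fst e \<noteq> snd e" using vw by simp
next
  show "finite (pverts gr)" using finV by (simp add: gr_def)
  have "parcs gr \<subseteq> pverts gr \<times> pverts gr" using Nb_sub by (auto simp: gr_def)
  then show "finite (parcs gr)" by (rule finite_subset) (simp add: gr_def finV)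
  show "symmetric (with_proj gr)"
  proof -
    have "(w, v) \<in> parcs gr" if "(v, w) \<in> parcs gr" for v w
      using that Nb_sym Nb_sub by (simp add: gr_def) blast
    then show ?thesis
      by (auto simp: symmetric_def sym_def arcs_ends_def arc_to_ends_def)
  qed
qed

lemma card_pverts_gr: "card (pverts gr) = card V"
  by (simp add: gr_def card_image)

lemma neighborhood_gr: "v \<in> V \<Longrightarrow> neighborhood gr (to_nat v) = to_nat ` Nb v"
  using Nb_sub by (auto simp: gr_def neighborhood_def)

text \<open>Every edge joins the two sides, so in the minority case exactly one of its ends is
  recolored, and equal colors become different ones.\<close>

lemma switchable_gr:
  assumes "v \<in> V"
  shows "switchable P lam gr x (to_nat v) \<longleftrightarrow>
    (1 + lam) / 2 * real (card (Nb v)) \<le> real (card {w \<in> Nb v. view P x w \<noteq> view P x v})"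
proof -
  have "conflicting_neighbors P gr x (to_nat v) = to_nat ` {w \<in> Nb v. view P x w \<noteq> view P x v}"
    using Nb_sub[OF assms] Nb_side[OF assms] assms
    by (cases P) (auto simp: neighborhood_gr[OF assms] view_def)
  then show ?thesis
    using assms by (simp add: switchable_def neighborhood_gr card_image) (simp add: gr_def)
qed

lemma view_run:
  assumes "(view P x, z) \<in> astep lam ^^ k"
  shows "\<exists>y. (x, y) \<in> switch_step P lam gr ^^ k \<and> view P y = z"
  using assms
proof (induction k arbitrary: z)
  case 0
  then show ?case by (intro exI[of _ x]) simp
next
  case (Suc k)
  then obtain z' where z': "(view P x, z') \<in> astep lam ^^ k" "(z', z) \<in> astep lam" by auto
  with Suc.IH obtain y where y: "(x, y) \<in> switch_step P lam gr ^^ k" "view P y = z'" by blast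
  from z'(2) obtain v where v: "v \<in> V" "z = z'(v := \<not> z' v)"
    "(1 + lam) / 2 * real (card (Nb v)) \<le> real (card {w \<in> Nb v. z' w \<noteq> z' v})"
    unfolding astep_def by blast
  then have "switchable P lam gr y (to_nat v)" unfolding switchable_gr[OF v(1)] y(2) by blast
  then have "(y, y(to_nat v := \<not> y (to_nat v))) \<in> switch_step P lam gr"
    unfolding switch_step_def by blast
  moreover have "view P (y(to_nat v := \<not> y (to_nat v))) = z"
  proof
    fix w show "view P (y(to_nat v := \<not> y (to_nat v))) w = z w"
      unfolding v(2) y(2)[symmetric] using v(1) by (cases "w = v") (simp_all add: view_def)
  qed
  ultimately show ?case using relpow_Suc_I[OF y(1)] by blast
qed

lemma le_stabilization_time_gr:
  assumes "0 < lam" "(view P x, z) \<in> astep lam ^^ k"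
  shows "enat k \<le> stabilization_time P lam gr x"
proof -
  obtain y where y: "(x, y) \<in> switch_step P lam gr ^^ k" using view_run[OF assms(2)] by blast
  show ?thesis
  proof (rule le_stabilization_time[OF pair_graph_gr assms(1) _ y])
    fix v assume "v \<in> pverts gr"
    then obtain u where "u \<in> V" "v = to_nat u" by (auto simp: gr_def)
    then show "neighborhood gr v \<noteq> {}" using Nb_nonempty by (simp add: neighborhood_gr)
  qed
qed

lemma bernoulli_half: "bernoulli_pmf (1 / 2) = pmf_of_set (UNIV :: bool set)"
  by (rule pmf_eqI) (auto simp: pmf_of_set split: bool.split)

text \<open>Renaming by \<open>to_nat\<close> preserves the product measure, and recoloring one side
  is an involution on the colorings of \<open>V\<close>, hence preserves the uniform
  distribution.\<close>

lemma map_view_random_coloring: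
  "map_pmf (view P) (random_coloring gr) = Pi_pmf V False (\<lambda>_. bernoulli_pmf (1 / 2))"
proof -
  define B where "B = Pi_pmf V False (\<lambda>_. bernoulli_pmf (1 / 2))"
  define flip where "flip = (\<lambda>z v. v \<in> V \<and> (if P = Minority \<and> side v then \<not> z v else z v))"
  have "B = map_pmf (\<lambda>x. x \<circ> to_nat) (random_coloring gr)"
    unfolding B_def random_coloring_def
    by (rule Pi_pmf_bij_betw) (auto simp: finV gr_def inj_on_def bij_betw_def)
  then have "map_pmf flip B = map_pmf (\<lambda>x. flip (x \<circ> to_nat)) (random_coloring gr)"
    by (simp add: map_pmf_comp)
  also have "(\<lambda>x. flip (x \<circ> to_nat)) = view P"
    by (auto simp: fun_eq_iff flip_def view_def)
  finally have "map_pmf (view P) (random_coloring gr) = map_pmf flip B" by simp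
  also have "B = pmf_of_set (PiE_dflt V False (\<lambda>_. UNIV))"
    unfolding B_def bernoulli_half by (rule Pi_pmf_of_set) (use finV in auto)
  also have "map_pmf flip \<dots> = pmf_of_set (flip ` PiE_dflt V False (\<lambda>_. UNIV))"
  proof (rule map_pmf_of_set_inj)
    show "inj_on flip (PiE_dflt V False (\<lambda>_. UNIV))"
    proof (rule inj_onI)
      fix z z' assume z: "z \<in> PiE_dflt V False (\<lambda>_. UNIV)" "z' \<in> PiE_dflt V False (\<lambda>_. UNIV)"
        "flip z = flip z'"
      show "z = z'"
      proof
        fix v show "z v = z' v"
          using z(1,2) fun_cong[OF z(3), of v]
          by (cases "v \<in> V") (auto simp: flip_def PiE_dflt_def split: if_splits)
      qed
    qed
  qed (use finV in auto)
  also have "flip ` PiE_dflt V False (\<lambda>_. UNIV) = PiE_dflt V False (\<lambda>_. UNIV)"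
  proof -
    have "flip (flip z) = z" if "z \<in> PiE_dflt V False (\<lambda>_. UNIV)" for z
      using that by (auto simp: flip_def PiE_dflt_def fun_eq_iff)
    moreover have "flip z \<in> PiE_dflt V False (\<lambda>_. UNIV)" for z
      by (auto simp: flip_def PiE_dflt_def)
    ultimately show ?thesis by (metis (no_types, lifting) image_eqI image_subsetI subsetI subset_antisym)
  qed
  also have "pmf_of_set \<dots> = B"
    unfolding B_def bernoulli_half by (rule Pi_pmf_of_set[symmetric]) (use finV in auto)
  finally show ?thesis by (simp add: B_def)
qed

end

section \<open>Concentration for random colorings\<close>

definition depends_on :: "'a set \<Rightarrow> ('a coloring \<Rightarrow> bool) \<Rightarrow> bool" where
  "depends_on B f \<longleftrightarrow> (\<forall>z z'. (\<forall>v\<in>B. z v = z' v) \<longrightarrow> f z = f z')"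

locale coloring_space =
  fixes V :: "'a set" and M :: "'a coloring pmf"
  assumes fin: "finite V" and M_def: "M = Pi_pmf V False (\<lambda>_. bernoulli_pmf (1 / 2))"
begin

abbreviation "prob \<equiv> measure_pmf.prob M"
abbreviation "expectation \<equiv> measure_pmf.expectation M"

text \<open>The colors of the nodes are independent, hence so are their restrictions to disjoint
  blocks and all functions of these.\<close>

lemma indep_blocks:
  assumes "disjoint_family_on B J" "\<And>j. j \<in> J \<Longrightarrow> B j \<subseteq> V" "\<And>j. j \<in> J \<Longrightarrow> depends_on (B j) (f j)"
  shows "prob_space.indep_vars M (\<lambda>_. borel) (\<lambda>j z. of_bool (f j z) :: real) J"
proof -
  have "prob_space.indep_vars M (\<lambda>_. count_space UNIV) (\<lambda>v z. z v) V"
    unfolding M_def by (rule indep_vars_Pi_pmf[OF fin])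
  from prob_space.indep_vars_restrict[OF measure_pmf.prob_space_axioms this assms(2,1)]
  have "prob_space.indep_vars M (\<lambda>j. PiM (B j) (\<lambda>_. count_space UNIV)) (\<lambda>j z. restrict z (B j)) J" by simp
  then have "prob_space.indep_vars M (\<lambda>_. borel) (\<lambda>j z. of_bool (f j (restrict z (B j))) :: real) J"
  proof (rule prob_space.indep_vars_compose2[OF measure_pmf.prob_space_axioms])
    fix j assume "j \<in> J"
    then have "finite (B j)" using assms(2) by (intro finite_subset[OF _ fin])
    then have "sets (PiM (B j) (\<lambda>_. count_space (UNIV :: bool set))) = Pow (PiE (B j) (\<lambda>_. UNIV))"
      by (subst count_space_PiM_finite) auto
    then show "(\<lambda>x. of_bool (f j x)) \<in> borel_measurable (PiM (B j) (\<lambda>_. count_space UNIV))"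
      by (auto simp: measurable_def space_PiM)
  qed
  moreover have "f j (restrict z (B j)) = f j z" if "j \<in> J" for j z
    using assms(3)[OF that] by (auto simp: depends_on_def)
  ultimately show ?thesis
    by (subst prob_space.indep_vars_cong[OF measure_pmf.prob_space_axioms refl _ refl, where Y = "\<lambda>j z. of_bool (f j (restrict z (B j)))"]) auto
qed

lemma expectation_of_bool: "expectation (\<lambda>z. of_bool (f z)) = prob {z. f z}"
proof -
  have "(\<lambda>z. of_bool (f z) :: real) = indicator {z. f z}" by (auto simp: indicator_def)
  then show ?thesis by simp
qed

lemma concentration:
  assumes "finite J" "disjoint_family_on B J" "\<And>j. j \<in> J \<Longrightarrow> B j \<subseteq> V"
    "\<And>j. j \<in> J \<Longrightarrow> depends_on (B j) (f j)" "\<And>j. j \<in> J \<Longrightarrow> q \<le> prob {z. f j z}"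
    "0 \<le> \<delta>" "J \<noteq> {}"
  shows "prob {z. real (card {j \<in> J. f j z}) < (q - \<delta>) * real (card J)} \<le> exp (- 2 * \<delta>\<^sup>2 * real (card J))"
proof -
  define n where "n = real (card J)"
  have n: "0 < n" using assms(1,7) by (simp add: n_def card_gt_0_iff)
  interpret H: Hoeffding_ineq "measure_pmf M" J "\<lambda>j z. of_bool (f j z) :: real" "\<lambda>_. 0" "\<lambda>_. 1"
      "\<Sum>j\<in>J. expectation (\<lambda>z. of_bool (f j z))"
  proof (unfold_locales, goal_cases)
    case 2
    show ?case using assms(2-4) by (rule indep_blocks)
  qed (use assms(1) in auto)
  have sum: "(\<Sum>j\<in>J. of_bool (f j z)) = real (card {j \<in> J. f j z})" for z
    using assms(1) by (simp add: sum.If_cases of_bool_def Int_def)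
  have "n * q \<le> (\<Sum>j\<in>J. expectation (\<lambda>z. of_bool (f j z)))"
    using sum_mono[of J "\<lambda>_. q" "\<lambda>j. prob {z. f j z}"] assms(5) by (simp add: expectation_of_bool n_def)
  then have "{z. real (card {j \<in> J. f j z}) < (q - \<delta>) * n} \<subseteq>
      {z \<in> space M. (\<Sum>j\<in>J. of_bool (f j z)) \<le> (\<Sum>j\<in>J. expectation (\<lambda>z. of_bool (f j z))) - \<delta> * n}"
    by (auto simp: sum algebra_simps)
  then have "prob {z. real (card {j \<in> J. f j z}) < (q - \<delta>) * n} \<le>
      prob {z \<in> space M. (\<Sum>j\<in>J. of_bool (f j z)) \<le> (\<Sum>j\<in>J. expectation (\<lambda>z. of_bool (f j z))) - \<delta> * n}"
    by (intro measure_pmf.finite_measure_mono) auto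
  also have "\<dots> \<le> exp (- 2 * (\<delta> * n)\<^sup>2 / (\<Sum>j\<in>J. (1 - 0)\<^sup>2))"
    by (rule H.Hoeffding_ineq_le) (use n assms in \<open>auto simp: n_def\<close>)
  also have "- 2 * (\<delta> * n)\<^sup>2 / (\<Sum>j\<in>J. (1 - 0)\<^sup>2) = - 2 * \<delta>\<^sup>2 * n"
    using n by (simp add: n_def[symmetric] power2_eq_square field_simps)
  finally show ?thesis by (simp add: n_def)
qed

lemma prob_conj:
  assumes "B \<inter> C = {}" "B \<subseteq> V" "C \<subseteq> V" "depends_on B f" "depends_on C g"
  shows "prob {z. f z \<and> g z} = prob {z. f z} * prob {z. g z}"
proof -
  have ind: "prob_space.indep_vars M (\<lambda>_. borel) (\<lambda>j z. of_bool ((if j then f else g) z) :: real) UNIV"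
    using assms by (intro indep_blocks[of "\<lambda>j. if j then B else C"]) (auto simp: disjoint_family_on_def)
  have "expectation (\<lambda>z. \<Prod>j\<in>UNIV. of_bool ((if j then f else g) z) :: real) =
      (\<Prod>j\<in>UNIV. expectation (\<lambda>z. of_bool ((if j then f else g) z)))"
    by (intro prob_space.indep_vars_lebesgue_integral[OF measure_pmf.prob_space_axioms _ ind]
      measure_pmf.integrable_const_bound[where B = 1]) auto
  then have "expectation (\<lambda>z. of_bool (f z) * of_bool (g z)) = prob {z. f z} * prob {z. g z}"
    unfolding UNIV_bool by (simp add: mult.commute) (simp add: expectation_of_bool)
  moreover have "(\<lambda>z. of_bool (f z) * of_bool (g z) :: real) = (\<lambda>z. of_bool (f z \<and> g z))" by auto
  ultimately show ?thesis by (simp add: expectation_of_bool)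
qed

lemma prob_not: "prob {z. \<not> f z} = 1 - prob {z. f z}"
  using measure_pmf.prob_compl[of "{z. f z}" M] by (simp add: Collect_neg_eq Compl_eq_Diff_UNIV)

lemma prob_disj:
  assumes "B \<inter> C = {}" "B \<subseteq> V" "C \<subseteq> V" "depends_on B f" "depends_on C g"
  shows "prob {z. f z \<or> g z} = 1 - (1 - prob {z. f z}) * (1 - prob {z. g z})"
proof -
  have "prob {z. \<not> f z \<and> \<not> g z} = prob {z. \<not> f z} * prob {z. \<not> g z}"
    using assms by (intro prob_conj) (auto simp: depends_on_def)
  then show ?thesis using prob_not[of "\<lambda>z. \<not> f z \<and> \<not> g z"] by (simp add: prob_not)
qed

lemma prob_color:
  assumes "v \<in> V"
  shows "prob {z. z v = c} = 1 / 2"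
proof -
  have "prob {z. z v = c} = measure_pmf.prob (map_pmf (\<lambda>z. z v) M) {c}"
    by (simp add: vimage_def)
  also have "map_pmf (\<lambda>z. z v) M = bernoulli_pmf (1 / 2)"
    unfolding M_def using fin assms by (subst Pi_pmf_component) auto
  finally show ?thesis by (cases c) (simp_all add: measure_pmf_single)
qed

text \<open>The children of \<open>i\<close> are \<open>2 * i\<close> and \<open>2 * i + 1\<close>.
  A child of the root has color \<open>c\<close> or two children of color \<open>c\<close> with
  probability \<open>1 - 1/2 * 3/4 = 5/8\<close>; for the root this gives
  \<open>1 - 1/2 * (1 - 25/64) = 89/128\<close>.\<close>

lemma prob_heap_forceable:
  assumes v: "inj_on v {1..7::nat}" "v ` {1..7} \<subseteq> V"
  shows "prob {z. z (v 1) = c \<or>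
      (z (v 2) = c \<or> (z (v 4) = c \<and> z (v 5) = c)) \<and> (z (v 3) = c \<or> (z (v 6) = c \<and> z (v 7) = c))} = 89 / 128"
proof -
  have inV: "v i \<in> V" if "1 \<le> i" "i \<le> 7" for i using v(2) that by auto
  have ne: "v i \<noteq> v j" if "i \<noteq> j" "1 \<le> i" "i \<le> 7" "1 \<le> j" "j \<le> 7" for i j
    using inj_onD[OF v(1), of i j] that by auto
  have and2: "prob {z. z (v i) = c \<and> z (v j) = c} = 1 / 4" if "i \<noteq> j" "1 \<le> i" "i \<le> 7" "1 \<le> j" "j \<le> 7" for i j
    using prob_conj[of "{v i}" "{v j}" "\<lambda>z. z (v i) = c" "\<lambda>z. z (v j) = c"] that inV ne
    by (simp add: prob_color depends_on_def)
  have or3: "prob {z. z (v i) = c \<or> z (v j) = c \<and> z (v k) = c} = 5 / 8"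
    if "i \<noteq> j" "i \<noteq> k" "j \<noteq> k" "1 \<le> i" "i \<le> 7" "1 \<le> j" "j \<le> 7" "1 \<le> k" "k \<le> 7" for i j k
    using prob_disj[of "{v i}" "{v j, v k}" "\<lambda>z. z (v i) = c" "\<lambda>z. z (v j) = c \<and> z (v k) = c"] that inV ne and2[of j k]
    by (simp add: prob_color depends_on_def)
  have "prob {z. (z (v 2) = c \<or> (z (v 4) = c \<and> z (v 5) = c)) \<and> (z (v 3) = c \<or> (z (v 6) = c \<and> z (v 7) = c))} =
      (5 / 8) * (5 / 8)"
    by (subst prob_conj[of "{v 2, v 4, v 5}" "{v 3, v 6, v 7}"])
      (use inV in \<open>auto simp: ne or3 depends_on_def\<close>)
  then show ?thesis
    by (subst prob_disj[of "{v 1}" "{v 2, v 4, v 5, v 3, v 6, v 7}"])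
      (use inV in \<open>auto simp: ne prob_color depends_on_def\<close>)
qed

end

section \<open>The graph\<close>

text \<open>A circulant bipartite graph between two layers of \<open>m\<close> positions. For
  \<open>0 < s\<close> and \<open>s * n \<le> m\<close> the listed positions are distinct, and the
  degrees in both directions are \<open>n\<close>; \<open>ocirc\<close> is the reverse
  relation.\<close>

definition circ :: "nat \<Rightarrow> nat \<Rightarrow> nat \<Rightarrow> nat \<Rightarrow> nat set" where
  "circ m n s p = (\<lambda>i. (p + s * i) mod m) ` {..<n}"

definition ocirc :: "nat \<Rightarrow> nat \<Rightarrow> nat \<Rightarrow> nat \<Rightarrow> nat set" where
  "ocirc m n s q = {p. p < m \<and> q \<in> circ m n s p}"

lemma circ_subset: "0 < m \<Longrightarrow> circ m n s p \<subseteq> {..<m}"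
  by (auto simp: circ_def)

lemma inj_on_circ:
  fixes m n s p :: nat
  assumes "0 < s" "s * n \<le> m"
  shows "inj_on (\<lambda>i. (p + s * i) mod m) {..<n}"
proof -
  have "inj_on ((\<lambda>z. z mod m) \<circ> (\<lambda>i. p + s * i)) {..<n}"
  proof (rule comp_inj_on)
    show "inj_on (\<lambda>i. p + s * i) {..<n}" using assms(1) by (auto simp: inj_on_def)
    have "p + s * i < p + m" if "i < n" for i
    proof -
      have "s * i < s * n" using that assms(1) by simp
      then have "s * i < m" using assms(2) by (rule order.strict_trans2)
      then show ?thesis by simp
    qed
    then show "inj_on (\<lambda>z. z mod m) ((\<lambda>i. p + s * i) ` {..<n})"
      by (intro inj_on_subset[OF inj_on_mod_interval[of "p + m" p m]]) auto
  qed
  then show ?thesis by (simp add: comp_def)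
qed

lemma card_circ: "0 < s \<Longrightarrow> s * n \<le> m \<Longrightarrow> card (circ m n s p) = n"
  by (simp add: circ_def card_image inj_on_circ)

lemma card_ocirc:
  assumes "q < m" "0 < s" "s * n \<le> m"
  shows "card (ocirc m n s q) = n"
proof -
  have le: "s * i < m" if "i < n" for i
  proof -
    have "s * i < s * n" using that assms(2) by simp
    then show ?thesis using assms(3) by (rule order.strict_trans2)
  qed
  have "ocirc m n s q = (\<lambda>i. (q + m - s * i) mod m) ` {..<n}"
  proof (intro subset_antisym subsetI)
    fix p assume "p \<in> ocirc m n s q"
    then obtain i where i: "p < m" "i < n" "q = (p + s * i) mod m" by (auto simp: ocirc_def circ_def)
    have "(q + (m - s * i)) mod m = (p + s * i + (m - s * i)) mod m"
      unfolding i(3) by (rule mod_add_left_eq)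
    also have "\<dots> = p" using i(1) le[OF i(2)] by simp
    finally show "p \<in> (\<lambda>i. (q + m - s * i) mod m) ` {..<n}" using i(2) le[OF i(2)] by force
  next
    fix p assume "p \<in> (\<lambda>i. (q + m - s * i) mod m) ` {..<n}"
    then obtain i where i: "i < n" "p = (q + m - s * i) mod m" by auto
    have "(p + s * i) mod m = (q + m - s * i + s * i) mod m"
      unfolding i(2) by (rule mod_add_left_eq)
    also have "\<dots> = q" using assms(1) le[OF i(1)] by simp
    finally have "q \<in> circ m n s p" using i(1) unfolding circ_def by (intro image_eqI[of _ _ i]) auto
    then show "p \<in> ocirc m n s q" using i(2) assms(1) by (simp add: ocirc_def)
  qed
  moreover have "inj_on ((\<lambda>z. z mod m) \<circ> (\<lambda>i. q + m - s * i)) {..<n}"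
  proof (rule comp_inj_on)
    show "inj_on (\<lambda>i. q + m - s * i) {..<n}"
    proof (rule inj_onI)
      fix i j assume "i \<in> {..<n}" "j \<in> {..<n}" "q + m - s * i = q + m - s * j"
      then have "s * i = s * j" using le[of i] le[of j] unfolding lessThan_iff by linarith
      then show "i = j" using assms(2) by simp
    qed
    show "inj_on (\<lambda>z. z mod m) ((\<lambda>i. q + m - s * i) ` {..<n})"
      using le by (intro inj_on_subset[OF inj_on_mod_interval[of "Suc q + m" "Suc q" m]]) fastforce+
  qed
  ultimately show ?thesis by (simp add: card_image comp_def)
qed

lemma card_residues:
  assumes "0 < N" "S \<subseteq> {..<N}"
  shows "card {i. i < N * x \<and> (a + i) mod N \<in> S} = x * card S"
proof (induction x)
  case 0
  then show ?case by simp
next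
  case (Suc x)
  define J where "J = {N * x..<N * x + N}"
  have inj: "inj_on (\<lambda>i. (a + i) mod N) J"
  proof -
    have "inj_on ((\<lambda>z. z mod N) \<circ> (\<lambda>i. a + i)) J"
      by (rule comp_inj_on) (auto simp: J_def inj_on_mod_interval)
    then show ?thesis by (simp add: comp_def)
  qed
  have "card ((\<lambda>i. (a + i) mod N) ` J) = N"
    unfolding card_image[OF inj] by (simp add: J_def)
  then have img: "(\<lambda>i. (a + i) mod N) ` J = {..<N}"
    using assms(1) by (intro card_seteq) auto
  have "(\<lambda>i. (a + i) mod N) ` {i \<in> J. (a + i) mod N \<in> S} = S"
  proof (intro subset_antisym subsetI)
    fix e assume e: "e \<in> S"
    then have "e \<in> (\<lambda>i. (a + i) mod N) ` J" using assms(2) img by blast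
    then obtain i where "i \<in> J" "e = (a + i) mod N" by (rule imageE)
    then show "e \<in> (\<lambda>i. (a + i) mod N) ` {i \<in> J. (a + i) mod N \<in> S}"
      using e by (intro image_eqI[of _ _ i]) simp_all
  qed (auto simp only: mem_Collect_eq)
  moreover have "inj_on (\<lambda>i. (a + i) mod N) {i \<in> J. (a + i) mod N \<in> S}"
    using inj by (rule inj_on_subset) auto
  ultimately have "card {i \<in> J. (a + i) mod N \<in> S} = card S" using card_image by fastforce
  moreover have "{i. i < N * Suc x \<and> (a + i) mod N \<in> S} =
      {i. i < N * x \<and> (a + i) mod N \<in> S} \<union> {i \<in> J. (a + i) mod N \<in> S}"
    by (auto simp: J_def)
  moreover have "{i. i < N * x \<and> (a + i) mod N \<in> S} \<inter> {i \<in> J. (a + i) mod N \<in> S} = {}"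
    by (auto simp: J_def)
  ultimately show ?case using Suc by (simp add: card_Un_disjoint J_def)
qed

text \<open>Each stride of \<open>N ^ d\<close> advances digit \<open>d\<close> by one, cyclically,
  so \<open>N * x\<close> strides meet every digit value \<open>x\<close> times. Reduction modulo
  \<open>m\<close> respects digit \<open>d\<close> because \<open>N ^ Suc d\<close> divides
  \<open>m\<close>.\<close>

lemma card_circ_digits:
  assumes "0 < N" "S \<subseteq> {..<N}" "N ^ Suc d dvd m" "N ^ d * (N * x) \<le> m" "0 < m"
  shows "card {q \<in> circ m (N * x) (N ^ d) p. (q div N ^ d) mod N \<in> S} = x * card S"
proof -
  have digit: "((p + N ^ d * i) mod m div N ^ d) mod N = (p div N ^ d + i) mod N" for i
  proof -
    have *: "(z mod N ^ Suc d) div N ^ d = (z div N ^ d) mod N" for z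
      by (simp only: power_Suc2 mod_mult2_eq) (use assms(1) in simp)
    have "((p + N ^ d * i) mod m) mod N ^ Suc d = (p + N ^ d * i) mod N ^ Suc d"
      by (rule mod_mod_cancel[OF assms(3)])
    then have "((p + N ^ d * i) mod m div N ^ d) mod N = ((p + N ^ d * i) div N ^ d) mod N"
      using * by metis
    then show ?thesis using assms(1) by (simp add: add.commute)
  qed
  have "{q \<in> circ m (N * x) (N ^ d) p. (q div N ^ d) mod N \<in> S} =
      (\<lambda>i. (p + N ^ d * i) mod m) ` {i. i < N * x \<and> (p div N ^ d + i) mod N \<in> S}"
    by (auto simp: circ_def digit)
  moreover have "inj_on (\<lambda>i. (p + N ^ d * i) mod m) {i. i < N * x \<and> (p div N ^ d + i) mod N \<in> S}"
    using assms(1,4) by (intro inj_on_subset[OF inj_on_circ]) auto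
  ultimately show ?thesis using card_residues[OF assms(1,2)] by (simp add: card_image)
qed

lemma circ_mod:
  assumes "s dvd m" "q \<in> circ m n s p"
  shows "q mod s = p mod s"
  using assms by (auto simp: circ_def mod_mod_cancel)

text \<open>The out-degrees in the gadgets divided by \<open>N\<close>. Rounding takes place before
  the multiplication by \<open>N\<close>, so that every child class receives equally many
  edges.\<close>

primrec shrink :: "real \<Rightarrow> nat \<Rightarrow> nat \<Rightarrow> nat" where
  "shrink g k 0 = 2 ^ k"
| "shrink g k (Suc i) = nat \<lfloor>g * real (shrink g k i)\<rfloor>"

text \<open>\<open>Main t p\<close>: the alternating layers \<open>t \<le> Q\<close> followed by the gadgets; \<open>Amp j i p\<close>: the \<open>i\<close>-th layer of
  helpers for layer \<open>j\<close>; \<open>Tree j p r b\<close>: node \<open>b\<close> (heap numbering) of the \<open>r\<close>-th tree at \<open>Amp j 0 p\<close>.\<close>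

datatype vx = Main nat nat | Amp nat nat nat | Tree nat nat nat nat

instance vx :: countable
  by countable_datatype

text \<open>By the last condition in \<open>MN\<close>, a node with in-degree \<open>d\<close> and
  out-degree at most \<open>g * d\<close> is switchable as soon as it conflicts with a share
  \<open>(N + M) / (2 * N)\<close> of its in-neighbors. The condition \<open>K\<close> does the same
  for the forced layers. \<open>I\<close> is the number of gadgets, and the degrees of the first
  helpers are multiples of \<open>2 ^ i0\<close>.\<close>

locale construction =
  fixes lam g :: real and K N M l I k i0 :: nat
  assumes lam: "0 < lam" "lam < 1 / 3"
    and g: "0 < g" "g < 1"
    and MN: "0 < M" "M < N" "even (N - M)" "(1 + lam) * (1 + g) \<le> 1 + real M / real N"
    and K: "2 * (1 + lam) \<le> real K * (1 - 3 * lam)"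
    and i0: "i0 \<le> k"
    and I: "0 < I" "\<And>i. i < I * Suc l \<Longrightarrow> 0 < shrink g k i"
begin

abbreviation "xs \<equiv> shrink g k"

text \<open>Every layer has \<open>m\<close> positions. \<open>E t\<close> is the number of edges from a node of \<open>Main t\<close> to the next
  layer, \<open>a j i\<close> the one from \<open>Amp j i\<close>, and \<open>tau j\<close> the number of trees at a node of \<open>Amp j 0\<close>. The stride
  \<open>st t\<close> makes the neighbors of a node run through the child classes of its class.\<close>

definition Q :: nat where "Q = 2 * Suc l"
definition T :: nat where "T = Q + I * Suc l"
definition m :: nat where "m = (K + 1) * (2 * K) ^ Q * N ^ Suc l * 2 ^ k"
definition E :: "nat \<Rightarrow> nat" where
  "E t = (if t \<le> Q then (2 * K) ^ (Q - t) * N * 2 ^ k else N * xs (t - Q))"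
definition st :: "nat \<Rightarrow> nat" where "st t = N ^ ((T - t) mod Suc l)"
definition kk :: nat where "kk = k - i0"
definition a :: "nat \<Rightarrow> nat \<Rightarrow> nat" where "a j i = (K + 1) * (2 * K) ^ (Q - j) * N * 2 ^ (i0 + i)"
definition tau :: "nat \<Rightarrow> nat" where "tau j = 40 * a j 0"

definition inn :: "nat \<Rightarrow> nat \<Rightarrow> nat set" where "inn t p = circ m (E (t - 1)) (st t) p"

text \<open>The summands belong to the preceding layer, the helpers (\<open>a t kk\<close>, see
  \<open>a_kk\<close>) and the next layer.\<close>

definition deg :: "nat \<Rightarrow> nat" where
  "deg t = (if 0 < t then E (t - 1) else 0) + (if t \<le> Q then (K + 1) * E t else 0) +
     (if t < T then E t else 0)"

definition th :: "nat \<Rightarrow> real" where "th t = (1 + lam) / 2 * real (deg t)"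

lemma N_pos: "0 < N" using MN by simp

lemma K_pos: "0 < K"
proof (rule ccontr)
  assume "\<not> 0 < K" then show False using K lam by simp
qed

lemma m_pos: "0 < m" using K_pos N_pos by (simp add: m_def)

lemma E_Suc: "t < Q \<Longrightarrow> E t = 2 * K * E (Suc t)"
  by (simp add: E_def Suc_diff_Suc[symmetric])

lemma E_high: "Q \<le> t \<Longrightarrow> E t = N * xs (t - Q)"
  by (auto simp: E_def)

lemma E_high_Suc:
  assumes "Q \<le> t"
  shows "real (E (Suc t)) \<le> g * real (E t)"
proof -
  have "real (xs (Suc i)) \<le> g * real (xs i)" for i
    using g by simp
  then show ?thesis
    using N_pos assms by (simp add: E_high Suc_diff_le mult.left_commute del: shrink.simps)
qed

lemma xs_le: "xs i \<le> 2 ^ k"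
proof (induction i)
  case (Suc i)
  have "real (xs (Suc i)) \<le> g * real (xs i)" using g by simp
  also have "\<dots> \<le> real (xs i)" using g by (intro mult_left_le_one_le) auto
  finally show ?case using Suc by (simp del: shrink.simps)
qed simp

lemma E_le: "E t \<le> (2 * K) ^ Q * N * 2 ^ k"
proof (cases "t \<le> Q")
  case True
  then have "(2 * K) ^ (Q - t) \<le> (2 * K) ^ Q" using K_pos by (intro power_increasing) auto
  then show ?thesis using True by (simp add: E_def)
next
  case False
  have "N * xs (t - Q) \<le> 1 * (N * 2 ^ k)" using xs_le by simp
  also have "\<dots> \<le> (2 * K) ^ Q * (N * 2 ^ k)" using K_pos by (intro mult_right_mono) auto
  finally show ?thesis using False by (simp add: E_def mult.assoc)
qed

lemma st_pos: "0 < st t" using N_pos by (simp add: st_def)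

lemma st_E_le: "st t * E t' \<le> m"
proof -
  have "st t \<le> N ^ l" unfolding st_def using N_pos by (intro power_increasing) auto
  then have "st t * E t' \<le> N ^ l * ((2 * K) ^ Q * N * 2 ^ k)" using E_le by (rule mult_le_mono)
  also have "\<dots> \<le> m" by (simp add: m_def)
  finally show ?thesis .
qed

lemma card_inn: "card (inn t p) = E (t - 1)"
  unfolding inn_def by (rule card_circ[OF st_pos st_E_le])

text \<open>In the layers \<open>1\<close> to \<open>Q\<close> the degree is
  \<open>(3 * K + 2) * E t\<close> and the in-degree from the preceding layer is
  \<open>2 * K * E t\<close>; the latter must reach the threshold.\<close>

lemma K_ineq: "(1 + lam) / 2 * (3 * real K + 2) \<le> 2 * real K"
  using K by (simp add: field_simps)

lemma tower_construction: "tower m T inn th l N M Q"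
proof
  show "inn t p \<subseteq> {..<m}" for t p
    unfolding inn_def by (rule circ_subset[OF m_pos])
next
  fix t p assume t: "0 < t" "t \<le> T"
  then obtain t' where t': "t = Suc t'" by (cases t) auto
  show "th t \<le> real (card (inn t p))"
  proof (cases "t \<le> Q")
    case True
    have E': "real (E t') = 2 * real K * real (E t)" using E_Suc[of t'] True t' by simp
    have "th t \<le> (1 + lam) / 2 * ((3 * real K + 2) * real (E t))"
      unfolding th_def using lam True t E' by (intro mult_left_mono) (auto simp: deg_def t' algebra_simps)
    also have "\<dots> \<le> 2 * real K * real (E t)"
      using mult_right_mono[OF K_ineq, of "real (E t)"] by (simp add: mult.assoc)
    finally show ?thesis by (simp add: card_inn t' E')
  next
    case False
    then have E': "real (E t) \<le> g * real (E t')" using E_high_Suc[of t'] t' by simp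
    have "th t \<le> (1 + lam) / 2 * ((1 + g) * real (E t'))"
      unfolding th_def using lam False E' g by (intro mult_left_mono) (auto simp: deg_def t' algebra_simps)
    also have "\<dots> = (1 + lam) * (1 + g) * (real (E t') / 2)" by simp
    also have "\<dots> \<le> 2 * (real (E t') / 2)"
    proof (rule mult_right_mono)
      have "real M / real N \<le> 1" using MN by simp
      then show "(1 + lam) * (1 + g) \<le> 2" using MN(4) by simp
    qed simp
    finally show ?thesis by (simp add: card_inn t')
  qed
next
  show "0 < M" "M < N" "even (N - M)" using MN by auto
next
  fix t p q d assume "q \<in> inn t p" "(T - t) mod Suc l = d" "d < l"
  moreover have "N ^ d dvd m" if "d < l"
    unfolding m_def using that by (intro dvd_mult2 dvd_mult le_imp_power_dvd) simp
  ultimately show "q mod N ^ d = p mod N ^ d"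
    using circ_mod[of "N ^ d" m q] by (simp add: inn_def st_def)
next
  fix t p d and S :: "nat set"
  assume t: "Q < t" "t \<le> T" and d: "(T - t) mod Suc l = d" "d < l"
    and S: "S \<subseteq> {..<N}" "N + M \<le> 2 * card S"
  obtain t' where t': "t = Suc t'" using t by (cases t) auto
  define x where "x = xs (t' - Q)"
  have Et: "E t' = N * x" using t t' by (simp add: E_high x_def)
  have "N ^ Suc d dvd m"
    unfolding m_def using d by (intro dvd_mult2 dvd_mult le_imp_power_dvd) simp
  moreover have "N ^ d * (N * x) \<le> m" using st_E_le[of t t'] d by (simp add: st_def Et)
  ultimately have card: "card {q \<in> inn t p. (q div N ^ d) mod N \<in> S} = x * card S"
    unfolding inn_def st_def d(1) by (subst t') (simp add: Et card_circ_digits[OF N_pos S(1) _ _ m_pos])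
  have "real (E t) \<le> g * real (E t')" using E_high_Suc[of t'] t t' by simp
  then have "th t \<le> (1 + lam) / 2 * ((1 + g) * real (E t'))"
    unfolding th_def using lam t g by (intro mult_left_mono) (auto simp: deg_def t' algebra_simps)
  also have "\<dots> = (1 + lam) * (1 + g) * (real N * real x / 2)" by (simp add: Et)
  also have "\<dots> \<le> (1 + real M / real N) * (real N * real x / 2)"
    by (rule mult_right_mono[OF MN(4)]) simp
  also have "\<dots> = real (N + M) / 2 * real x" using N_pos by (simp add: field_simps)
  also have "\<dots> \<le> real (card S) * real x"
    using S(2) by (intro mult_right_mono) (auto simp: of_nat_add[symmetric] simp del: of_nat_add)
  finally show "th t \<le> real (card {q \<in> inn t p. (q div N ^ d) mod N \<in> S})"
    by (simp add: card mult.commute)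
qed

sublocale tower m T inn th l N M Q
  by (rule tower_construction)

end

context bipartite
begin

text \<open>No neighbor of a node in \<open>S\<close> lies in \<open>S\<close>, so switching the
  nodes of \<open>S\<close> one by one leaves all supporting sets \<open>A\<close> intact.\<close>

lemma force:
  assumes "S \<subseteq> V" "\<And>v. v \<in> S \<Longrightarrow> Nb v \<inter> S = {}"
    and A: "\<And>v. v \<in> S \<Longrightarrow> z v \<noteq> c v \<Longrightarrow>
      \<exists>A\<subseteq>Nb v. (\<forall>w\<in>A. z w = c v) \<and> (1 + lam) / 2 * real (card (Nb v)) \<le> real (card A)"
  shows "(z, \<lambda>v. if v \<in> S then c v else z v) \<in> (astep lam)\<^sup>*"
proof -
  have "(z, \<lambda>v. if v \<in> S' then c v else z v) \<in> (astep lam)\<^sup>*" if "finite S'" "S' \<subseteq> S" for S'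
    using that
  proof (induction S' rule: finite_induct)
    case empty
    then show ?case by simp
  next
    case (insert v S')
    let ?y = "\<lambda>v. if v \<in> S' then c v else z v"
    have y: "(z, ?y) \<in> (astep lam)\<^sup>*" using insert by simp
    have v: "v \<in> S" using insert by simp
    show ?case
    proof (cases "z v = c v")
      case True
      then have "(\<lambda>w. if w \<in> insert v S' then c w else z w) = ?y" by auto
      then show ?thesis using y by simp
    next
      case False
      then have eq: "(\<lambda>w. if w \<in> insert v S' then c w else z w) = ?y(v := \<not> ?y v)"
        using insert.hyps by (auto simp: fun_eq_iff)
      obtain A where A: "A \<subseteq> Nb v" "\<forall>w\<in>A. z w = c v"
        "(1 + lam) / 2 * real (card (Nb v)) \<le> real (card A)" using A[OF v False] by blast
      have "A \<subseteq> {w \<in> Nb v. ?y w \<noteq> ?y v}"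
        using A(1,2) False insert assms(2)[OF v] by auto
      moreover have "finite (Nb v)" using Nb_sub[of v] v assms(1) finV finite_subset by blast
      ultimately have "card A \<le> card {w \<in> Nb v. ?y w \<noteq> ?y v}" by (intro card_mono) auto
      then have "(?y, ?y(v := \<not> ?y v)) \<in> astep lam"
        unfolding astep_def using A(3) v assms(1)
        by (intro CollectI exI[of _ ?y] exI[of _ v]) (auto simp del: if_split)
      then show ?thesis unfolding eq using y by (meson rtrancl.rtrancl_into_rtrancl)
    qed
  qed
  from this[of S] show ?thesis using assms(1) finV finite_subset by blast
qed

end

section \<open>Neighborhoods and degrees in the constructed graph\<close>

context construction
begin

text \<open>Edges are directed along the flow of influence: from the leaves of a tree to its root,
  to the first helpers, through the helper layers to \<open>Main j\<close>, and from each main layer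
  to the next.\<close>

fun inb :: "vx \<Rightarrow> vx set" where
  "inb (Main t p) = (if 0 < t then Main (t - 1) ` inn t p else {}) \<union>
     (if t \<le> Q then Amp t kk ` circ m (a t kk) 1 p else {})"
| "inb (Amp j i p) = (if i = 0 then (\<lambda>r. Tree j p r 1) ` {..<tau j}
     else Amp j (i - 1) ` circ m (a j (i - 1)) 1 p)"
| "inb (Tree j p r b) = (if b \<le> 3 then {Tree j p r (2 * b), Tree j p r (2 * b + 1)} else {})"

fun outb :: "vx \<Rightarrow> vx set" where
  "outb (Main t p) = (if t < T then Main (Suc t) ` ocirc m (E t) (st (Suc t)) p else {})"
| "outb (Amp j i p) = (if i < kk then Amp j (Suc i) ` ocirc m (a j i) 1 p
     else Main j ` ocirc m (a j i) 1 p)"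
| "outb (Tree j p r b) = {if b = 1 then Amp j 0 p else Tree j p r (b div 2)}"

definition Nb :: "vx \<Rightarrow> vx set" where "Nb v = inb v \<union> outb v"

definition V :: "vx set" where
  "V = (\<lambda>(t, p). Main t p) ` ({..T} \<times> {..<m}) \<union>
     (\<lambda>(j, i, p). Amp j i p) ` ({..Q} \<times> {..kk} \<times> {..<m}) \<union>
     (\<lambda>(j, p, r, b). Tree j p r b) ` (SIGMA j:{..Q}. {..<m} \<times> {..<tau j} \<times> {1..7})"

text \<open>\<open>Amp j kk\<close> is opposite to \<open>Main j\<close>, every step back along the
  helpers changes the side, and the nodes 2 and 3 of a tree are opposite to its root and its
  leaves.\<close>

fun side :: "vx \<Rightarrow> bool" where
  "side (Main t p) = odd t"
| "side (Amp j i p) = odd (Suc (j + kk + i))"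
| "side (Tree j p r b) = (odd (j + kk) \<noteq> (b = 2 \<or> b = 3))"

lemma V_simps [simp]:
  "Main t p \<in> V \<longleftrightarrow> t \<le> T \<and> p < m"
  "Amp j i p \<in> V \<longleftrightarrow> j \<le> Q \<and> i \<le> kk \<and> p < m"
  "Tree j p r b \<in> V \<longleftrightarrow> j \<le> Q \<and> p < m \<and> r < tau j \<and> 1 \<le> b \<and> b \<le> 7"
  by (auto simp: V_def image_iff)

lemma finite_V: "finite V"
  by (auto simp: V_def)

lemma QT: "Q < T"
  using I by (simp add: T_def)

lemma a_pos: "0 < a j i"
  using K_pos N_pos by (simp add: a_def)

lemma a_Suc: "a j (Suc i) = 2 * a j i"
  by (simp add: a_def)

lemma a_kk: "j \<le> Q \<Longrightarrow> a j kk = (K + 1) * E j"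
  using i0 by (simp add: a_def E_def kk_def algebra_simps)

lemma a_le: "i \<le> kk \<Longrightarrow> a j i \<le> m"
proof -
  assume "i \<le> kk"
  then have "(2::nat) ^ (i0 + i) \<le> 2 ^ k" using i0 by (intro power_increasing) (auto simp: kk_def)
  moreover have "(2 * K) ^ (Q - j) \<le> (2 * K) ^ Q" using K_pos by (intro power_increasing) auto
  moreover have "N \<le> N ^ Suc l" using N_pos by simp
  ultimately show "a j i \<le> m" unfolding a_def m_def by (intro mult_le_mono order_refl)
qed

lemma circ_sub: "q \<in> circ m n s p \<Longrightarrow> q < m"
  using circ_subset[OF m_pos] by blast

lemma ocirc_iff: "p \<in> ocirc m n s q \<longleftrightarrow> p < m \<and> q \<in> circ m n s p"
  by (auto simp: ocirc_def)

lemma inb_sub: "v \<in> V \<Longrightarrow> inb v \<subseteq> V"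
  using QT by (cases v) (auto simp: inn_def dest: circ_sub)

lemma outb_sub: "v \<in> V \<Longrightarrow> outb v \<subseteq> V"
  using QT by (cases v) (auto simp: ocirc_iff)

lemma inb_outb:
  assumes "v \<in> V" "w \<in> V"
  shows "w \<in> inb v \<longleftrightarrow> v \<in> outb w"
proof (cases v)
  case v: (Main t p)
  show ?thesis
    using assms v by (cases w) (auto simp: ocirc_iff inn_def image_iff)
next
  case v: (Amp j i p)
  show ?thesis
    using assms v by (cases w) (auto simp: ocirc_iff image_iff)
next
  case v: (Tree j p r b)
  show ?thesis
  proof (cases w)
    case (Tree j' p' r' b')
    have "(b \<le> 3 \<and> (b' = 2 * b \<or> b' = 2 * b + 1)) \<longleftrightarrow> (b' \<noteq> 1 \<and> b = b' div 2)"
      using assms v Tree by auto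
    then show ?thesis using v Tree by auto
  qed (use v in \<open>auto simp: image_iff\<close>)
qed

lemma in_outb_disj: "v \<in> V \<Longrightarrow> inb v \<inter> outb v = {}"
  by (cases v) auto

lemma finite_inb: "finite (inb v)"
  by (cases v) (auto simp: inn_def circ_def)

lemma finite_outb: "finite (outb v)"
  by (cases v) (auto simp: ocirc_def)

lemma card_Nb: "v \<in> V \<Longrightarrow> card (Nb v) = card (inb v) + card (outb v)"
  unfolding Nb_def by (rule card_Un_disjoint[OF finite_inb finite_outb in_outb_disj])

lemma card_Nb_Main:
  assumes "t \<le> T" "p < m"
  shows "card (Nb (Main t p)) = deg t"
proof -
  have "card (Main (t - 1) ` inn t p) = E (t - 1)"
    by (simp add: card_image inj_on_def card_inn)
  moreover have "card (Amp t kk ` circ m (a t kk) 1 p) = a t kk"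
    using a_le[of kk t] by (simp add: card_image inj_on_def card_circ)
  moreover have "card (Main (t - 1) ` inn t p \<union> Amp t kk ` circ m (a t kk) 1 p) =
      card (Main (t - 1) ` inn t p) + card (Amp t kk ` circ m (a t kk) 1 p)"
    by (intro card_Un_disjoint) (auto simp: inn_def circ_def)
  ultimately have "card (inb (Main t p)) = (if 0 < t then E (t - 1) else 0) + (if t \<le> Q then a t kk else 0)"
    by (cases "t = 0") simp_all
  moreover have "card (outb (Main t p)) = (if t < T then E t else 0)"
    using assms by (simp add: card_image inj_on_def card_ocirc st_pos st_E_le)
  ultimately show ?thesis using assms by (simp add: card_Nb deg_def a_kk)
qed

lemma card_outb_Amp: "i \<le> kk \<Longrightarrow> p < m \<Longrightarrow> card (outb (Amp j i p)) = a j i"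
  using a_le[of i j] a_le[of kk j] by (auto simp: card_image inj_on_def card_ocirc)

lemma card_Nb_Amp_0: "j \<le> Q \<Longrightarrow> p < m \<Longrightarrow> card (Nb (Amp j 0 p)) = 41 * a j 0"
  by (subst card_Nb) (simp_all add: card_outb_Amp card_image inj_on_def tau_def del: outb.simps)

lemma card_Nb_Amp_Suc: "j \<le> Q \<Longrightarrow> Suc i \<le> kk \<Longrightarrow> p < m \<Longrightarrow> card (Nb (Amp j (Suc i) p)) = 3 * a j i"
  using a_le[of i j]
  by (subst card_Nb) (simp_all add: card_outb_Amp card_image inj_on_def card_circ a_Suc del: outb.simps)

lemma card_Nb_Tree: "Tree j p r b \<in> V \<Longrightarrow> b \<le> 3 \<Longrightarrow> card (Nb (Tree j p r b)) = 3"
  by (subst card_Nb) simp_all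

lemma E_pos: "t < T \<Longrightarrow> 0 < E t"
  using K_pos N_pos I(2)[of "t - Q"] by (simp add: E_def T_def)

lemma inb_side: "w \<in> inb v \<Longrightarrow> v \<in> V \<Longrightarrow> side w \<noteq> side v"
  by (cases v) (auto split: if_splits)

sublocale bipartite V Nb side
proof
  show "finite V" by (rule finite_V)
next
  fix v assume v: "v \<in> V"
  show "Nb v \<subseteq> V" using inb_sub[OF v] outb_sub[OF v] by (simp add: Nb_def)
  show "v \<in> Nb w" if "w \<in> Nb v" for w
    using that v inb_outb[of v w] inb_outb[of w v] inb_sub[OF v] outb_sub[OF v] by (auto simp: Nb_def)
  show "side w \<noteq> side v" if "w \<in> Nb v" for w
    using that v inb_outb[of w v] inb_side[of w v] inb_side[of v w] outb_sub[OF v] by (auto simp: Nb_def)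
  show "Nb v \<noteq> {}"
  proof (cases v)
    case (Main t p)
    have "t - 1 < T" using QT v Main by auto
    then have "deg t \<noteq> 0"
      using E_pos[of 0] E_pos[of "t - 1"] QT by (cases "t = 0") (simp_all add: deg_def)
    then show ?thesis using card_Nb_Main[of t p] v Main by auto
  next
    case (Amp j i p)
    then have "card (outb v) \<noteq> 0" using v a_pos[of j i] card_outb_Amp[of i p j] by simp
    then show ?thesis by (auto simp: Nb_def)
  next
    case (Tree j p r b)
    then show ?thesis by (simp add: Nb_def)
  qed
qed

end

context construction
begin

section \<open>Forcing the initial state\<close>

text \<open>\<open>th t\<close> is the threshold for the full degree, so conflicts with the
  preceding layer alone permit the switch in the graph.\<close>

lemma main_run:
  assumes "(x, y) \<in> cstep 0 T ^^ n" "\<And>t p. z (Main t p) = x (t, p)"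
  shows "\<exists>z'. (z, z') \<in> astep lam ^^ n \<and> (\<forall>t p. z' (Main t p) = y (t, p))"
  using assms(1)
proof (induction n arbitrary: y)
  case 0
  then show ?case using assms(2) by (intro exI[of _ z]) simp
next
  case (Suc n)
  then obtain y1 where y1: "(x, y1) \<in> cstep 0 T ^^ n" "(y1, y) \<in> cstep 0 T" by auto
  with Suc.IH obtain z1 where z1: "(z, z1) \<in> astep lam ^^ n" "\<And>t p. z1 (Main t p) = y1 (t, p)"
    by blast
  from y1(2) obtain t p where tp: "0 < t" "t \<le> T" "p < m" "y = y1((t, p) := \<not> y1 (t, p))"
    "th t \<le> real (card {q \<in> inn t p. y1 (t - 1, q) \<noteq> y1 (t, p)})"
    unfolding cstep_def by blast
  let ?v = "Main t p"
  have "Main (t - 1) ` {q \<in> inn t p. y1 (t - 1, q) \<noteq> y1 (t, p)} \<subseteq> {w \<in> Nb ?v. z1 w \<noteq> z1 ?v}"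
    using tp(1) z1(2) by (auto simp: Nb_def)
  moreover have "finite (Nb ?v)" by (simp add: Nb_def finite_inb finite_outb del: inb.simps outb.simps)
  ultimately have "card (Main (t - 1) ` {q \<in> inn t p. y1 (t - 1, q) \<noteq> y1 (t, p)}) \<le>
      card {w \<in> Nb ?v. z1 w \<noteq> z1 ?v}" by (intro card_mono) auto
  then have "(1 + lam) / 2 * real (card (Nb ?v)) \<le> real (card {w \<in> Nb ?v. z1 w \<noteq> z1 ?v})"
    using tp by (simp add: card_image inj_on_def card_Nb_Main th_def)
  moreover have "?v \<in> V" using tp by simp
  ultimately have "(z1, z1(?v := \<not> z1 ?v)) \<in> astep lam" unfolding astep_def by blast
  with z1(1) have "(z, z1(?v := \<not> z1 ?v)) \<in> astep lam ^^ Suc n" by (rule relpow_Suc_I)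
  moreover have "(z1(?v := \<not> z1 ?v)) (Main t' p') = y (t', p')" for t' p'
    using z1(2) tp(4) by simp
  ultimately show ?case by blast
qed

fun cc :: "vx \<Rightarrow> bool" where
  "cc (Main j p) = odd j"
| "cc (Amp j i p) = odd j"
| "cc (Tree j p r b) = odd j"

definition forceable :: "nat \<Rightarrow> nat \<Rightarrow> nat \<Rightarrow> vx coloring \<Rightarrow> bool" where
  "forceable j p r z \<longleftrightarrow> z (Tree j p r 1) = odd j \<or>
     (z (Tree j p r 2) = odd j \<or> (z (Tree j p r 4) = odd j \<and> z (Tree j p r 5) = odd j)) \<and>
     (z (Tree j p r 3) = odd j \<or> (z (Tree j p r 6) = odd j \<and> z (Tree j p r 7) = odd j))"

text \<open>The typical behavior of a random coloring. The deficits below one half are what the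
  thresholds in \<open>force_amps\<close> and \<open>force_mains\<close> leave room for.\<close>

definition good :: "vx coloring \<Rightarrow> bool" where
  "good z \<longleftrightarrow>
     (\<forall>j\<le>Q. \<forall>p<m. 11 / 16 * real (tau j) \<le> real (card {r \<in> {..<tau j}. forceable j p r z})) \<and>
     (\<forall>j\<le>Q. \<forall>i<kk. \<forall>p<m. (1 / 2 - (1 - 3 * lam) / 4) * real (a j (Suc i)) \<le>
        real (card {w \<in> outb (Amp j (Suc i) p). z w = odd j})) \<and>
     (\<forall>t<Q. \<forall>p<m. (1 / 2 - 1 / (2 * real K)) * real (E t) \<le>
        real (card {q \<in> inn (Suc t) p. z (Main t q) = odd (Suc t)}))"

definition upd :: "vx set \<Rightarrow> vx coloring \<Rightarrow> vx coloring" where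
  "upd S z v = (if v \<in> S then cc v else z v)"

lemma force_upd:
  assumes "S \<subseteq> V" "\<And>v. v \<in> S \<Longrightarrow> Nb v \<inter> S = {}"
    and "\<And>v. v \<in> S \<Longrightarrow>
      \<exists>A\<subseteq>Nb v. (\<forall>w\<in>A. z w = cc v) \<and> (1 + lam) / 2 * real (card (Nb v)) \<le> real (card A)"
  shows "(z, upd S z) \<in> (astep lam)\<^sup>*"
  using force[of S z cc lam] assms unfolding upd_def by blast

text \<open>First the middle nodes (\<open>S1\<close>), then the roots (\<open>S2\<close>). Each of
  these has degree 3, and two children of the wanted color suffice because
  \<open>3 * (1 + lam) / 2 \<le> 2\<close>.\<close>

lemma force_trees:
  "\<exists>y. (z, y) \<in> (astep lam)\<^sup>* \<and> (\<forall>t p. y (Main t p) = z (Main t p)) \<and>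
     (\<forall>j i p. y (Amp j i p) = z (Amp j i p)) \<and>
     (\<forall>j p r. Tree j p r 1 \<in> V \<longrightarrow> forceable j p r z \<longrightarrow> y (Tree j p r 1) = odd j)"
proof -
  define S1 where "S1 = {Tree j p r b | j p r b. Tree j p r b \<in> V \<and> (b = 2 \<or> b = 3) \<and>
    z (Tree j p r (2 * b)) = odd j \<and> z (Tree j p r (2 * b + 1)) = odd j}"
  define S2 where "S2 = {Tree j p r 1 | j p r. Tree j p r 1 \<in> V \<and>
    upd S1 z (Tree j p r 2) = odd j \<and> upd S1 z (Tree j p r 3) = odd j}"
  have lam3: "(1 + lam) / 2 * 3 \<le> 2" using lam by simp
  have step1: "(z, upd S1 z) \<in> (astep lam)\<^sup>*"
  proof (rule force_upd)
    show "S1 \<subseteq> V" by (auto simp: S1_def simp del: V_simps)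
    fix v assume "v \<in> S1"
    then obtain j p r b where v: "v = Tree j p r b" "Tree j p r b \<in> V" "b = 2 \<or> b = 3"
      "z (Tree j p r (2 * b)) = odd j" "z (Tree j p r (2 * b + 1)) = odd j"
      unfolding S1_def by blast
    show "Nb v \<inter> S1 = {}" using v(1,3) by (auto simp: Nb_def S1_def)
    have "card (Nb v) = 3" using v card_Nb_Tree by auto
    moreover have "card {Tree j p r (2 * b), Tree j p r (2 * b + 1)} = 2" by simp
    ultimately show "\<exists>A\<subseteq>Nb v. (\<forall>w\<in>A. z w = cc v) \<and> (1 + lam) / 2 * real (card (Nb v)) \<le> real (card A)"
      using v lam3 by (intro exI[of _ "{Tree j p r (2 * b), Tree j p r (2 * b + 1)}"]) (auto simp: Nb_def)
  qed
  have step2: "(upd S1 z, upd S2 (upd S1 z)) \<in> (astep lam)\<^sup>*"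
  proof (rule force_upd)
    show "S2 \<subseteq> V" by (auto simp: S2_def simp del: V_simps)
    fix v assume "v \<in> S2"
    then obtain j p r where v: "v = Tree j p r 1" "Tree j p r 1 \<in> V"
      "upd S1 z (Tree j p r 2) = odd j" "upd S1 z (Tree j p r 3) = odd j"
      unfolding S2_def by blast
    show "Nb v \<inter> S2 = {}" using v(1) by (auto simp: Nb_def S2_def)
    have "card (Nb v) = 3" using v card_Nb_Tree by auto
    moreover have "card {Tree j p r 2, Tree j p r 3} = 2" by simp
    ultimately show "\<exists>A\<subseteq>Nb v. (\<forall>w\<in>A. upd S1 z w = cc v) \<and>
        (1 + lam) / 2 * real (card (Nb v)) \<le> real (card A)"
      using v lam3 by (intro exI[of _ "{Tree j p r 2, Tree j p r 3}"]) (auto simp: Nb_def)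
  qed
  have "upd S2 (upd S1 z) (Tree j p r 1) = odd j"
    if V: "Tree j p r 1 \<in> V" and f: "forceable j p r z" for j p r
  proof -
    have V23: "Tree j p r 2 \<in> V" "Tree j p r 3 \<in> V" using V by auto
    have root: "upd S1 z (Tree j p r 1) = z (Tree j p r 1)"
      by (auto simp: upd_def S1_def)
    have "upd S1 z (Tree j p r 2) = odd j \<and> upd S1 z (Tree j p r 3) = odd j" if "z (Tree j p r 1) \<noteq> odd j"
    proof -
      have f: "z (Tree j p r 2) = odd j \<or> (z (Tree j p r 4) = odd j \<and> z (Tree j p r 5) = odd j)"
        "z (Tree j p r 3) = odd j \<or> (z (Tree j p r 6) = odd j \<and> z (Tree j p r 7) = odd j)"
        using f that by (auto simp: forceable_def)
      have "Tree j p r 2 \<in> S1" if "z (Tree j p r 4) = odd j" "z (Tree j p r 5) = odd j"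
        unfolding S1_def using that V23
        by (intro CollectI exI[of _ j] exI[of _ p] exI[of _ r] exI[of _ 2] conjI) simp_all
      moreover have "Tree j p r 3 \<in> S1" if "z (Tree j p r 6) = odd j" "z (Tree j p r 7) = odd j"
        unfolding S1_def using that V23
        by (intro CollectI exI[of _ j] exI[of _ p] exI[of _ r] exI[of _ 3] conjI) simp_all
      ultimately show ?thesis using f unfolding upd_def by auto
    qed
    then have "Tree j p r 1 \<in> S2" if "z (Tree j p r 1) \<noteq> odd j"
      using that V unfolding S2_def by blast
    then show ?thesis using root unfolding upd_def[of S2] by auto
  qed
  moreover have "upd S2 (upd S1 z) (Main t p) = z (Main t p)" "upd S2 (upd S1 z) (Amp j i p) = z (Amp j i p)" for t j i p
    by (auto simp: upd_def S1_def S2_def)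
  ultimately show ?thesis using rtrancl_trans[OF step1 step2] by blast
qed

lemma force_amps:
  assumes "good z" "i \<le> kk"
  shows "\<exists>y. (z, y) \<in> (astep lam)\<^sup>* \<and> (\<forall>t p. y (Main t p) = z (Main t p)) \<and>
     (\<forall>j p. j \<le> Q \<longrightarrow> p < m \<longrightarrow> y (Amp j i p) = odd j) \<and>
     (\<forall>j i' p. i < i' \<longrightarrow> y (Amp j i' p) = z (Amp j i' p))"
  using assms(2)
proof (induction i)
  case 0
  obtain y where y: "(z, y) \<in> (astep lam)\<^sup>*" "\<And>t p. y (Main t p) = z (Main t p)"
    "\<And>j i p. y (Amp j i p) = z (Amp j i p)"
    "\<And>j p r. Tree j p r 1 \<in> V \<Longrightarrow> forceable j p r z \<Longrightarrow> y (Tree j p r 1) = odd j"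
    using force_trees[of z] by blast
  define S where "S = {Amp j 0 p | j p. j \<le> Q \<and> p < m}"
  have "(y, upd S y) \<in> (astep lam)\<^sup>*"
  proof (rule force_upd)
    show "S \<subseteq> V" by (auto simp: S_def)
    fix v assume "v \<in> S"
    then obtain j p where v: "v = Amp j 0 p" "j \<le> Q" "p < m" by (auto simp: S_def)
    show "Nb v \<inter> S = {}" using v(1) by (auto simp: Nb_def S_def)
    let ?A = "(\<lambda>r. Tree j p r 1) ` {r \<in> {..<tau j}. forceable j p r z}"
    have "(1 + lam) / 2 * real (card (Nb v)) \<le> 2 / 3 * (41 * real (a j 0))"
      using v lam mult_right_mono[of "(1 + lam) / 2" "2 / 3" "41 * real (a j 0)"]
      by (simp add: card_Nb_Amp_0)
    \<comment> \<open>With \<open>40 * a j 0\<close> trees among \<open>41 * a j 0\<close> neighbors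
      this reads \<open>82 / 3 \<le> 27.5\<close>.\<close>
    also have "\<dots> \<le> 11 / 16 * real (tau j)" by (simp add: tau_def)
    also have "\<dots> \<le> real (card {r \<in> {..<tau j}. forceable j p r z})"
      using assms(1) v(2,3) by (simp add: good_def)
    also have "\<dots> = real (card ?A)" by (simp add: card_image inj_on_def)
    finally have "(1 + lam) / 2 * real (card (Nb v)) \<le> real (card ?A)" .
    moreover have "?A \<subseteq> Nb v" "\<forall>w\<in>?A. y w = cc v" using v y(4) by (auto simp: Nb_def)
    ultimately show "\<exists>A\<subseteq>Nb v. (\<forall>w\<in>A. y w = cc v) \<and> (1 + lam) / 2 * real (card (Nb v)) \<le> real (card A)"
      by blast
  qed
  with y(1) have "(z, upd S y) \<in> (astep lam)\<^sup>*" by (rule rtrancl_trans)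
  moreover have "upd S y (Main t p) = z (Main t p)" for t p
    using y(2) by (simp add: upd_def S_def)
  moreover have "upd S y (Amp j 0 p) = odd j" if "j \<le> Q" "p < m" for j p
    using that by (auto simp: upd_def S_def)
  moreover have "upd S y (Amp j i' p) = z (Amp j i' p)" if "0 < i'" for j i' p
    using that y(3) by (auto simp: upd_def S_def)
  ultimately show ?case by blast
next
  case (Suc i)
  then obtain y where y: "(z, y) \<in> (astep lam)\<^sup>*" "\<And>t p. y (Main t p) = z (Main t p)"
    "\<And>j p. j \<le> Q \<Longrightarrow> p < m \<Longrightarrow> y (Amp j i p) = odd j"
    "\<And>j i' p. i < i' \<Longrightarrow> y (Amp j i' p) = z (Amp j i' p)" by force
  define S where "S = {Amp j (Suc i) p | j p. j \<le> Q \<and> p < m}"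
  have "(y, upd S y) \<in> (astep lam)\<^sup>*"
  proof (rule force_upd)
    show "S \<subseteq> V" using Suc.prems by (auto simp: S_def)
    fix v assume "v \<in> S"
    then obtain j p where v: "v = Amp j (Suc i) p" "j \<le> Q" "p < m" by (auto simp: S_def)
    show "Nb v \<inter> S = {}" using v(1) by (auto simp: Nb_def S_def)
    let ?B = "{w \<in> outb v. z w = odd j}"
    have "(1 + lam) / 2 * real (card (Nb v)) = (1 + lam) / 2 * 3 * real (a j i)"
      using v Suc.prems by (simp add: card_Nb_Amp_Suc)
    \<comment> \<open>The predecessors, a third of the neighborhood, all have the wanted color
      already; the successors are still random and contribute nearly half of their number. The
      deficit \<open>(1 - 3 * lam) / 4\<close> makes this an equality, and it is positive for
      \<open>lam < 1/3\<close>.\<close>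
    also have "\<dots> = real (a j i) + (1 / 2 - (1 - 3 * lam) / 4) * real (a j (Suc i))"
      by (simp add: a_Suc field_simps)
    also have "\<dots> \<le> real (card (inb v)) + real (card ?B)"
      using assms(1) v Suc.prems a_le[of i j]
      by (auto simp: good_def card_image inj_on_def card_circ simp del: outb.simps)
    also have "\<dots> = real (card (inb v \<union> ?B))"
      using in_outb_disj[of v] v Suc.prems finite_inb finite_outb
      by (subst card_Un_disjoint) (auto simp del: inb.simps outb.simps)
    finally have "(1 + lam) / 2 * real (card (Nb v)) \<le> real (card (inb v \<union> ?B))" .
    moreover have "inb v \<union> ?B \<subseteq> Nb v" by (auto simp: Nb_def)
    moreover have "y w = odd j" if "w \<in> inb v" for w
      using that v y(3) by (auto dest: circ_sub)
    moreover have "y w = odd j" if "w \<in> ?B" for w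
      using that v y(2,4) by (auto split: if_splits)
    ultimately show "\<exists>A\<subseteq>Nb v. (\<forall>w\<in>A. y w = cc v) \<and> (1 + lam) / 2 * real (card (Nb v)) \<le> real (card A)"
      using v(1) by (intro exI[of _ "inb v \<union> ?B"]) (auto simp del: inb.simps outb.simps)
  qed
  with y(1) have "(z, upd S y) \<in> (astep lam)\<^sup>*" by (rule rtrancl_trans)
  moreover have "upd S y (Main t p) = z (Main t p)" for t p
    using y(2) by (simp add: upd_def S_def)
  moreover have "upd S y (Amp j (Suc i) p) = odd j" if "j \<le> Q" "p < m" for j p
    using that by (auto simp: upd_def S_def)
  moreover have "upd S y (Amp j i' p) = z (Amp j i' p)" if "Suc i < i'" for j i' p
    using that y(4) by (auto simp: upd_def S_def)
  ultimately show ?case by blast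
qed

text \<open>The layers are treated in descending order, since the preceding layer of the one being treated
  must still be random: if it had the opposite color already, the helpers would not suffice.\<close>

lemma force_mains:
  assumes "good z" "n \<le> Suc Q"
  shows "\<exists>y. (z, y) \<in> (astep lam)\<^sup>* \<and>
     (\<forall>j p. j \<le> Q \<longrightarrow> p < m \<longrightarrow> y (Amp j kk p) = odd j) \<and>
     (\<forall>t p. p < m \<longrightarrow> t \<le> Q \<longrightarrow> y (Main t p) = (if Q < t + n then odd t else z (Main t p)))"
  using assms(2)
proof (induction n)
  case 0
  then show ?case using force_amps[OF assms(1) order_refl] by auto
next
  case (Suc n)
  then obtain y where y: "(z, y) \<in> (astep lam)\<^sup>*"
    "\<And>j p. j \<le> Q \<Longrightarrow> p < m \<Longrightarrow> y (Amp j kk p) = odd j"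
    "\<And>t p. p < m \<Longrightarrow> t \<le> Q \<Longrightarrow> y (Main t p) = (if Q < t + n then odd t else z (Main t p))" by auto
  define t where "t = Q - n"
  have t: "t \<le> Q" "t + n = Q" "t \<le> T" using Suc.prems QT by (auto simp: t_def)
  define S where "S = {Main t p | p. p < m}"
  have "(y, upd S y) \<in> (astep lam)\<^sup>*"
  proof (rule force_upd)
    show "S \<subseteq> V" using t by (auto simp: S_def)
    fix v assume "v \<in> S"
    then obtain p where v: "v = Main t p" "p < m" by (auto simp: S_def)
    show "Nb v \<inter> S = {}" using v(1) by (auto simp: Nb_def S_def)
    let ?A = "Amp t kk ` circ m (a t kk) 1 p"
    let ?B = "if 0 < t then Main (t - 1) ` {q \<in> inn t p. z (Main (t - 1) q) = odd t} else {}"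
    have cA: "card ?A = (K + 1) * E t"
      using a_le[of kk t] t by (simp add: card_image inj_on_def card_circ a_kk)
    have K1: "1 \<le> real K" using K_pos by simp
    have "(1 + lam) / 2 * real (card (Nb v)) \<le> real (card ?A) + real (card ?B)"
    proof (cases t)
      case 0
      \<comment> \<open>Layer \<open>0\<close> has no predecessor: its helpers are
        \<open>K + 1\<close> of \<open>K + 2\<close> parts of the degree, at least two
        thirds.\<close>
      have "(1 + lam) / 2 * (real K + 2) \<le> 2 / 3 * (real K + 2)"
        using lam by (intro mult_right_mono) auto
      also have "\<dots> \<le> real K + 1" using K1 by simp
      finally have "(1 + lam) / 2 * (real K + 2) * real (E t) \<le> (real K + 1) * real (E t)"
        by (rule mult_right_mono) simp
      moreover have "real (card (Nb v)) = (real K + 2) * real (E t)"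
        using v t QT by (simp add: card_Nb_Main deg_def 0 algebra_simps)
      moreover have "real (card ?A) = (real K + 1) * real (E t)" by (simp only: cA) (simp add: algebra_simps)
      ultimately show ?thesis by (simp add: mult.assoc)
    next
      case (Suc t')
      have E': "real (E t') = 2 * real K * real (E t)" using E_Suc[of t'] t Suc by simp
      have "(1 + lam) / 2 * real (card (Nb v)) \<le> (1 + lam) / 2 * ((3 * real K + 2) * real (E t))"
        using v t lam E' by (subst v(1), subst card_Nb_Main)
          (auto intro!: mult_left_mono simp: deg_def Suc algebra_simps)
      also have "\<dots> \<le> 2 * real K * real (E t)"
        using mult_right_mono[OF K_ineq, of "real (E t)"] by (simp add: mult.assoc)
      \<comment> \<open>In units of \<open>E t\<close>, the helpers contribute \<open>K + 1\<close>
        and the random preceding layer at least \<open>K - 1\<close>.\<close>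
      also have "\<dots> = (real K + 1) * real (E t) + (1 / 2 - 1 / (2 * real K)) * real (E t')"
        unfolding E' using K1 by (simp add: field_simps)
      also have "\<dots> \<le> real (card ?A) + real (card {q \<in> inn (Suc t') p. z (Main t' q) = odd (Suc t')})"
        using assms(1) v t Suc unfolding cA good_def by (intro add_mono) (auto simp: algebra_simps)
      also have "\<dots> = real (card ?A) + real (card ?B)"
        by (simp add: Suc card_image inj_on_def)
      finally show ?thesis .
    qed
    also have "\<dots> = real (card (?A \<union> ?B))"
      by (subst card_Un_disjoint) (auto simp: circ_def inn_def)
    finally have "(1 + lam) / 2 * real (card (Nb v)) \<le> real (card (?A \<union> ?B))" .
    moreover have "?A \<union> ?B \<subseteq> Nb v" using v t by (auto simp: Nb_def)
    moreover have "y w = odd t" if "w \<in> ?A" for w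
      using that y(2) t by (auto dest: circ_sub)
    moreover have "y w = odd t" if "w \<in> ?B" for w
      using that y(3) t by (auto simp: inn_def dest: circ_sub split: if_splits)
    ultimately show "\<exists>A\<subseteq>Nb v. (\<forall>w\<in>A. y w = cc v) \<and> (1 + lam) / 2 * real (card (Nb v)) \<le> real (card A)"
      unfolding v(1) cc.simps by (intro exI[of _ "?A \<union> ?B"]) blast
  qed
  with y(1) have "(z, upd S y) \<in> (astep lam)\<^sup>*" by (rule rtrancl_trans)
  moreover have "upd S y (Amp j kk p) = odd j" if "j \<le> Q" "p < m" for j p
    using that y(2) by (auto simp: upd_def S_def)
  moreover have "upd S y (Main t' p) = (if Q < t' + Suc n then odd t' else z (Main t' p))"
    if "p < m" "t' \<le> Q" for t' p
  proof (cases "t' = t")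
    case True
    then show ?thesis using that t by (auto simp: upd_def S_def)
  next
    case False
    then have "(Q < t' + Suc n) = (Q < t' + n)" using t by auto
    then show ?thesis using False that y(3) by (auto simp: upd_def S_def)
  qed
  ultimately show ?case by blast
qed

lemma good_run:
  assumes "good z"
  shows "\<exists>n z'. m * gain ^ I \<le> n \<and> (z, z') \<in> astep lam ^^ n"
proof -
  obtain y where y: "(z, y) \<in> (astep lam)\<^sup>*"
    "\<And>t p. p < m \<Longrightarrow> t \<le> Q \<Longrightarrow> y (Main t p) = odd t"
    using force_mains[OF assms order_refl] by auto
  then obtain n0 where n0: "(z, y) \<in> astep lam ^^ n0" using rtrancl_imp_relpow by metis
  define x :: state where "x = (\<lambda>(t, p). y (Main t p))"
  have "\<exists>n x'. m * gain ^ I \<le> n \<and> (x, x') \<in> cstep 0 T ^^ n"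
    by (rule alternating_run) (use y(2) in \<open>auto simp: x_def Q_def T_def\<close>)
  then obtain n x' where n: "m * gain ^ I \<le> n" "(x, x') \<in> cstep 0 T ^^ n" by blast
  obtain z' where "(y, z') \<in> astep lam ^^ n"
    using main_run[OF n(2), of y] by (auto simp: x_def)
  then have "(z, z') \<in> astep lam ^^ (n0 + n)" using n0 by (auto simp: relpow_add)
  then show ?thesis using n(1) by (meson trans_le_add2)
qed

end

section \<open>Probability of a good coloring and size of the graph\<close>

context construction
begin

definition coins :: "vx coloring pmf" where
  "coins = Pi_pmf V False (\<lambda>_. bernoulli_pmf (1 / 2))"

interpretation coloring_space V coins
  by unfold_locales (simp_all add: finite_V coins_def)

context
  fixes \<delta> :: real
  assumes \<delta>: "0 < \<delta>" "\<delta> \<le> 1 / 128" "\<delta> \<le> (1 - 3 * lam) / 4" "\<delta> \<le> 1 / (2 * real K)"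
begin

text \<open>A common failure bound for all events in \<open>good\<close>: each concerns at least
  \<open>2 ^ i0\<close> independent samples and tolerates a deviation of at least
  \<open>\<delta>\<close>.\<close>

lemma sampling:
  assumes "finite J" "disjoint_family_on B J" "\<And>j. j \<in> J \<Longrightarrow> B j \<subseteq> V"
    "\<And>j. j \<in> J \<Longrightarrow> depends_on (B j) (f j)" "\<And>j. j \<in> J \<Longrightarrow> q \<le> prob {z. f j z}"
    "\<delta> \<le> \<epsilon>" "2 ^ i0 \<le> card J"
  shows "prob {z. \<not> (q - \<epsilon>) * real (card J) \<le> real (card {j \<in> J. f j z})} \<le> exp (- 2 * \<delta>\<^sup>2 * 2 ^ i0)"
proof -
  have ne: "J \<noteq> {}" using assms(7) by auto
  have "prob {z. real (card {j \<in> J. f j z}) < (q - \<epsilon>) * real (card J)} \<le> exp (- 2 * \<epsilon>\<^sup>2 * real (card J))"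
    using assms(1-6) \<delta>(1) ne by (intro concentration[where B = B]) auto
  also have "\<dots> \<le> exp (- 2 * \<delta>\<^sup>2 * 2 ^ i0)"
  proof -
    have "(2::real) ^ i0 \<le> real (card J)"
      using assms(7) by (metis of_nat_le_iff of_nat_numeral of_nat_power)
    moreover have "\<delta>\<^sup>2 \<le> \<epsilon>\<^sup>2" using assms(6) \<delta>(1) by (intro power_mono) auto
    ultimately have "\<delta>\<^sup>2 * 2 ^ i0 \<le> \<epsilon>\<^sup>2 * real (card J)" by (intro mult_mono) auto
    then show ?thesis by simp
  qed
  finally show ?thesis by (simp add: not_le)
qed

lemma a_ge: "2 ^ i0 \<le> a j i"
proof -
  have "1 \<le> (K + 1) * (2 * K) ^ (Q - j) * N"
    using K_pos N_pos by (simp only: One_nat_def Suc_le_eq) simp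
  then have "1 * 2 ^ i0 \<le> ((K + 1) * (2 * K) ^ (Q - j) * N) * 2 ^ (i0 + i)"
    by (intro mult_le_mono power_increasing) auto
  then show ?thesis by (simp add: a_def)
qed

lemma prob_trees:
  assumes "j \<le> Q" "p < m"
  shows "prob {z. \<not> 11 / 16 * real (tau j) \<le> real (card {r \<in> {..<tau j}. forceable j p r z})} \<le>
    exp (- 2 * \<delta>\<^sup>2 * 2 ^ i0)"
proof -
  \<comment> \<open>The tolerance \<open>1 / 128\<close> leaves the share
    \<open>88 / 128 = 11 / 16\<close>.\<close>
  have "prob {z. \<not> (89 / 128 - 1 / 128) * real (card {..<tau j}) \<le>
      real (card {r \<in> {..<tau j}. forceable j p r z})} \<le> exp (- 2 * \<delta>\<^sup>2 * 2 ^ i0)"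
  proof (rule sampling[where B = "\<lambda>r. Tree j p r ` {1..7}"])
    fix r assume r: "r \<in> {..<tau j}"
    show "Tree j p r ` {1..7} \<subseteq> V" using assms r by auto
    show "depends_on (Tree j p r ` {1..7}) (forceable j p r)"
      by (simp add: depends_on_def forceable_def)
    show "89 / 128 \<le> prob {z. forceable j p r z}"
      unfolding forceable_def using assms r
      by (subst prob_heap_forceable[of "Tree j p r"]) (auto simp: inj_on_def)
  qed (use \<delta> a_ge[of j 0] in \<open>auto simp: disjoint_family_on_def tau_def\<close>)
  then show ?thesis by simp
qed

lemma prob_amps:
  assumes "j \<le> Q" "i < kk" "p < m"
  shows "prob {z. \<not> (1 / 2 - (1 - 3 * lam) / 4) * real (a j (Suc i)) \<le>
        real (card {w \<in> outb (Amp j (Suc i) p). z w = odd j})} \<le> exp (- 2 * \<delta>\<^sup>2 * 2 ^ i0)"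
proof -
  have sub: "outb (Amp j (Suc i) p) \<subseteq> V" using assms by (intro outb_sub) simp
  have "card (outb (Amp j (Suc i) p)) = a j (Suc i)" using assms by (intro card_outb_Amp) auto
  then show ?thesis
    using sampling[of "outb (Amp j (Suc i) p)" "\<lambda>w. {w}" "\<lambda>w z. z w = odd j" "1 / 2" "(1 - 3 * lam) / 4"]
      sub \<delta> a_ge[of j "Suc i"] finite_outb[of "Amp j (Suc i) p"]
    by (auto simp: disjoint_family_on_def depends_on_def prob_color subset_iff simp del: outb.simps)
qed

lemma prob_mains:
  assumes "t < Q" "p < m"
  shows "prob {z. \<not> (1 / 2 - 1 / (2 * real K)) * real (E t) \<le>
        real (card {q \<in> inn (Suc t) p. z (Main t q) = odd (Suc t)})} \<le> exp (- 2 * \<delta>\<^sup>2 * 2 ^ i0)"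
proof -
  have sub: "Main t q \<in> V" if "q \<in> inn (Suc t) p" for q
    using that assms QT by (auto simp: inn_def dest: circ_sub)
  have card: "card (inn (Suc t) p) = E t" by (simp add: card_inn)
  have "1 * 2 ^ i0 \<le> ((2 * K) ^ (Q - t) * N) * 2 ^ k"
    using K_pos N_pos i0 by (intro mult_le_mono power_increasing) auto
  then have "2 ^ i0 \<le> E t" using assms by (simp add: E_def)
  moreover have "finite (inn (Suc t) p)" by (simp add: inn_def circ_def)
  ultimately show ?thesis
    using sampling[of "inn (Suc t) p" "\<lambda>q. {Main t q}" "\<lambda>q z. z (Main t q) = odd (Suc t)" "1 / 2" "1 / (2 * real K)"]
      sub \<delta> by (auto simp: disjoint_family_on_def depends_on_def prob_color card simp del: even_Suc)
qed

lemma card_V_ge: "Suc Q * m \<le> card V" "Suc Q * (kk * m) \<le> card V"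
proof -
  have "card ((\<lambda>(t, p). Main t p) ` ({..Q} \<times> {..<m})) \<le> card V"
    using QT by (intro card_mono finite_V) auto
  then show "Suc Q * m \<le> card V" by (simp add: card_image inj_on_def)
  have "card ((\<lambda>(j, i, p). Amp j i p) ` ({..Q} \<times> {..<kk} \<times> {..<m})) \<le> card V"
    by (intro card_mono finite_V) auto
  then show "Suc Q * (kk * m) \<le> card V" by (simp add: card_image inj_on_def)
qed

text \<open>Union bound; each of the three families in \<open>good\<close> has at most
  \<open>card V\<close> events.\<close>

lemma prob_good: "1 - 3 * real (card V) * exp (- 2 * \<delta>\<^sup>2 * 2 ^ i0) \<le> prob {z. good z}"
proof -
  let ?b = "exp (- 2 * \<delta>\<^sup>2 * 2 ^ i0)"
  let ?B1 = "\<lambda>(j, p). {z. \<not> 11 / 16 * real (tau j) \<le> real (card {r \<in> {..<tau j}. forceable j p r z})}"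
  let ?B2 = "\<lambda>(j, i, p). {z. \<not> (1 / 2 - (1 - 3 * lam) / 4) * real (a j (Suc i)) \<le>
        real (card {w \<in> outb (Amp j (Suc i) p). z w = odd j})}"
  let ?B3 = "\<lambda>(t, p). {z. \<not> (1 / 2 - 1 / (2 * real K)) * real (E t) \<le>
        real (card {q \<in> inn (Suc t) p. z (Main t q) = odd (Suc t)})}"
  let ?J1 = "{..Q} \<times> {..<m}" and ?J2 = "{..Q} \<times> {..<kk} \<times> {..<m}" and ?J3 = "{..<Q} \<times> {..<m}"
  have union: "prob (\<Union>x\<in>J. B x) \<le> real (card V) * ?b"
    if "finite J" "\<And>x. x \<in> J \<Longrightarrow> prob (B x) \<le> ?b" "card J \<le> card V" for J :: "'x set" and B
  proof -
    have "prob (\<Union>x\<in>J. B x) \<le> (\<Sum>x\<in>J. prob (B x))"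
      using that(1) by (intro measure_pmf.finite_measure_subadditive_finite) auto
    also have "\<dots> \<le> (\<Sum>x\<in>J. ?b)" using that(2) by (intro sum_mono) auto
    also have "\<dots> \<le> real (card V) * ?b" using that(3) by simp
    finally show ?thesis .
  qed
  have b1: "prob (\<Union>x\<in>?J1. ?B1 x) \<le> real (card V) * ?b"
    using prob_trees card_V_ge(1) by (intro union) auto
  have b2: "prob (\<Union>x\<in>?J2. ?B2 x) \<le> real (card V) * ?b"
    using prob_amps card_V_ge(2) by (intro union) (auto simp del: outb.simps)
  have b3: "prob (\<Union>x\<in>?J3. ?B3 x) \<le> real (card V) * ?b"
    using prob_mains card_V_ge(1) by (intro union) (auto simp del: even_Suc)
  have "{z. \<not> good z} \<subseteq> (\<Union>x\<in>?J1. ?B1 x) \<union> ((\<Union>x\<in>?J2. ?B2 x) \<union> (\<Union>x\<in>?J3. ?B3 x))"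
    unfolding good_def by (auto simp del: outb.simps even_Suc)
  then have "prob {z. \<not> good z} \<le> prob ((\<Union>x\<in>?J1. ?B1 x) \<union> ((\<Union>x\<in>?J2. ?B2 x) \<union> (\<Union>x\<in>?J3. ?B3 x)))"
    by (intro measure_pmf.finite_measure_mono) auto
  also have "\<dots> \<le> prob (\<Union>x\<in>?J1. ?B1 x) + (prob (\<Union>x\<in>?J2. ?B2 x) + prob (\<Union>x\<in>?J3. ?B3 x))"
    by (rule order_trans[OF measure_Un_le add_left_mono[OF measure_Un_le]]) auto
  also have "\<dots> \<le> 3 * real (card V) * ?b" using b1 b2 b3 by linarith
  finally show ?thesis by (simp add: prob_not)
qed

text \<open>The distribution of \<open>view P x\<close> is the same for both processes, so the bound
  for good colorings serves either.\<close>

lemma prob_long_run: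
  "1 - 3 * real (card V) * exp (- 2 * \<delta>\<^sup>2 * 2 ^ i0) \<le>
     measure_pmf.prob (random_coloring gr) {x. enat (m * gain ^ I) \<le> stabilization_time P lam gr x}"
proof -
  have "prob {z. good z} = measure_pmf.prob (random_coloring gr) {x. good (view P x)}"
    using map_view_random_coloring[of P] by (simp add: coins_def measure_map_pmf vimage_def flip: map_view_random_coloring[of P])
  also have "\<dots> \<le> measure_pmf.prob (random_coloring gr) {x. enat (m * gain ^ I) \<le> stabilization_time P lam gr x}"
  proof (intro measure_pmf.finite_measure_mono subsetI CollectI)
    fix x assume "x \<in> {x. good (view P x)}"
    then obtain n z' where n: "m * gain ^ I \<le> n" "(view P x, z') \<in> astep lam ^^ n"
      using good_run by blast
    have "enat (m * gain ^ I) \<le> enat n" using n(1) by simp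
    also have "\<dots> \<le> stabilization_time P lam gr x" by (rule le_stabilization_time_gr[OF lam(1) n(2)])
    finally show "enat (m * gain ^ I) \<le> stabilization_time P lam gr x" .
  qed simp
  finally show ?thesis using prob_good by linarith
qed

end

text \<open>The dominant term comes from the trees: seven nodes each, and at most
  \<open>40 * ((K + 1) * (2 * K) ^ Q * N) * 2 ^ i0\<close> of them at each of the first
  helpers.\<close>

lemma card_V_le: "card V \<le> m * (Suc T + Suc Q * Suc k + Suc Q * (280 * ((K + 1) * (2 * K) ^ Q * N)) * 2 ^ i0)"
proof -
  define c where "c = (K + 1) * (2 * K) ^ Q * N"
  have tau: "tau j \<le> 40 * (c * 2 ^ i0)" for j
  proof -
    have "(2 * K) ^ (Q - j) \<le> (2 * K) ^ Q" using K_pos by (intro power_increasing) auto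
    then show ?thesis unfolding tau_def a_def c_def add_0_right by (intro mult_le_mono order_refl)
  qed
  let ?A = "(\<lambda>(t, p). Main t p) ` ({..T} \<times> {..<m})"
  let ?B = "(\<lambda>(j, i, p). Amp j i p) ` ({..Q} \<times> {..kk} \<times> {..<m})"
  let ?C = "(\<lambda>(j, p, r, b). Tree j p r b) ` (SIGMA j:{..Q}. {..<m} \<times> {..<tau j} \<times> {1..7})"
  have A: "card ?A \<le> Suc T * m"
    by (rule order_trans[OF card_image_le]) auto
  have "card ?B \<le> Suc Q * (Suc kk * m)"
    by (rule order_trans[OF card_image_le]) auto
  also have "\<dots> \<le> Suc Q * (Suc k * m)"
    by (intro mult_le_mono order_refl) (simp add: kk_def)
  finally have B: "card ?B \<le> Suc Q * (Suc k * m)" .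
  have "card ?C \<le> (\<Sum>j\<le>Q. m * (tau j * 7))"
    by (rule order_trans[OF card_image_le]) auto
  also have "\<dots> \<le> (\<Sum>j\<le>Q. m * (40 * (c * 2 ^ i0) * 7))"
    using tau by (intro sum_mono mult_le_mono order_refl)
  also have "\<dots> = Suc Q * (m * (40 * (c * 2 ^ i0) * 7))" by simp
  finally have C: "card ?C \<le> Suc Q * (m * (40 * (c * 2 ^ i0) * 7))" .
  have "card V \<le> card ?A + card ?B + card ?C"
    unfolding V_def by (rule order_trans[OF card_Un_le add_right_mono[OF card_Un_le]])
  also have "\<dots> \<le> Suc T * m + Suc Q * (Suc k * m) + Suc Q * (m * (40 * (c * 2 ^ i0) * 7))"
    by (intro add_mono A B C)
  also have "\<dots> = m * (Suc T + Suc Q * Suc k + Suc Q * (280 * c) * 2 ^ i0)"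
    by (simp add: algebra_simps)
  finally show ?thesis by (simp only: c_def)
qed

end

context construction
begin

text \<open>Summary without the constants of the locale, so that the parameters can be chosen
  outside of it.\<close>

lemma construction_graph:
  fixes n0 b c :: nat
  defines "c \<equiv> (K + 1) * (2 * K) ^ (2 * Suc l)"
  shows "\<exists>G :: nat pair_pre_digraph. pair_graph G \<and> c * N ^ Suc l * 2 ^ k \<le> card (pverts G) \<and>
    card (pverts G) \<le> c * N ^ Suc l * 2 ^ k * (Suc (2 * Suc l + I * Suc l) + Suc (2 * Suc l) * Suc k +
      Suc (2 * Suc l) * (280 * (c * N)) * 2 ^ i0) \<and>
    (\<forall>P \<delta>. 0 < \<delta> \<longrightarrow> \<delta> \<le> 1 / 128 \<longrightarrow> \<delta> \<le> (1 - 3 * lam) / 4 \<longrightarrow> \<delta> \<le> 1 / (2 * real K) \<longrightarrow>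
      1 - 3 * real (card (pverts G)) * exp (- 2 * \<delta>\<^sup>2 * 2 ^ i0) \<le>
        measure_pmf.prob (random_coloring G) {x. enat (c * N ^ Suc l * 2 ^ k * (cap N M l div (2 * Suc l)) ^ I)
          \<le> stabilization_time P lam G x})"
proof (intro exI[of _ gr] conjI allI impI)
  have m: "m = c * N ^ Suc l * 2 ^ k" unfolding m_def Q_def c_def ..
  show "pair_graph gr" by (rule pair_graph_gr)
  have "(\<lambda>p. Main 0 p) ` {..<m} \<subseteq> V" by auto
  then have "card ((\<lambda>p. Main 0 p) ` {..<m}) \<le> card V" by (intro card_mono finite_V)
  then show "c * N ^ Suc l * 2 ^ k \<le> card (pverts gr)"
    by (simp only: card_pverts_gr flip: m) (simp add: card_image inj_on_def)
  show "card (pverts gr) \<le> c * N ^ Suc l * 2 ^ k * (Suc (2 * Suc l + I * Suc l) + Suc (2 * Suc l) * Suc k +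
      Suc (2 * Suc l) * (280 * (c * N)) * 2 ^ i0)"
    using card_V_le unfolding card_pverts_gr m T_def Q_def c_def .
  fix P \<delta> assume "0 < \<delta>" "\<delta> \<le> 1 / 128" "\<delta> \<le> (1 - 3 * lam) / 4" "\<delta> \<le> 1 / (2 * real K)"
  from prob_long_run[OF this, of P]
  show "1 - 3 * real (card (pverts gr)) * exp (- 2 * \<delta>\<^sup>2 * 2 ^ i0) \<le>
        measure_pmf.prob (random_coloring gr) {x. enat (c * N ^ Suc l * 2 ^ k * (cap N M l div (2 * Suc l)) ^ I)
          \<le> stabilization_time P lam gr x}"
    unfolding card_pverts_gr gain_def m .
qed

end

section \<open>Choice of the parameters\<close>

lemma power_2_between: "1 \<le> y \<Longrightarrow> \<exists>k. y \<le> 2 ^ k \<and> 2 ^ k \<le> 2 * (y :: real)"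
proof -
  assume y: "1 \<le> y"
  define k where "k = (LEAST k. y \<le> 2 ^ k)"
  have "\<exists>k. y \<le> 2 ^ k" using real_arch_pow[of 2 y] by (auto intro: less_imp_le)
  then have k: "y \<le> 2 ^ k" unfolding k_def by (rule LeastI_ex)
  moreover have "2 ^ k \<le> 2 * y"
  proof (cases k)
    case (Suc j)
    then have "\<not> y \<le> 2 ^ j" using not_less_Least[of j "\<lambda>k. y \<le> 2 ^ k"] by (simp add: k_def[symmetric])
    then show ?thesis using Suc by simp
  qed (use y in simp)
  ultimately show ?thesis by blast
qed

text \<open>Each rounding loses at most one and later factors \<open>g\<close> damp the loss, so the
  total is bounded by the geometric series with sum \<open>1 / (1 - g)\<close>.\<close>

lemma shrink_ge:
  assumes "0 < g" "g < 1"
  shows "g ^ i * 2 ^ k - 1 / (1 - g) \<le> real (shrink g k i)"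
proof (induction i)
  case 0
  then show ?case using assms by simp
next
  case (Suc i)
  define w where "w = 1 / (1 - g)"
  have "w = g * w + 1" using assms by (simp add: w_def field_simps)
  then have "g ^ Suc i * 2 ^ k - w = g * (g ^ i * 2 ^ k - w) - 1"
    by (simp add: algebra_simps)
  also have "\<dots> \<le> g * real (shrink g k i) - 1" using Suc assms by (simp add: w_def)
  also have "\<dots> \<le> real (shrink g k (Suc i))" by simp linarith
  finally show ?case by (simp only: w_def)
qed

text \<open>The inequality \<open>u \<le> exp u\<close> at \<open>u = c * y / j\<close>, raised to
  the power \<open>j\<close>.\<close>

lemma power_le_exp:
  assumes "0 < c" "0 \<le> y" "0 < j"
  shows "y ^ j * exp (- (c * y)) \<le> (real j / c) ^ j"
proof -
  have "c * y / real j \<le> exp (c * y / real j)"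
    using exp_ge_add_one_self[of "c * y / real j"] by linarith
  then have "(c * y / real j) ^ j \<le> exp (c * y / real j) ^ j"
    using assms by (intro power_mono) auto
  also have "\<dots> = exp (c * y)" using assms by (simp flip: exp_of_nat_mult)
  finally have "y ^ j * (c / real j) ^ j \<le> exp (c * y)" by (simp add: power_mult_distrib power_divide mult.commute)
  then have "y ^ j * (c / real j) ^ j * (real j / c) ^ j \<le> exp (c * y) * (real j / c) ^ j"
    using assms by (intro mult_right_mono) auto
  moreover have "(c / real j) ^ j * (real j / c) ^ j = 1"
    using assms by (simp add: power_divide)
  ultimately show ?thesis using assms by (simp add: exp_minus field_simps)
qed

text \<open>For a maximizer \<open>\<phi>\<close> of \<open>f_ratio\<close> and
  \<open>g = \<phi> / (1 - \<phi>)\<close>, the base \<open>1 / g\<close> raised to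
  \<open>f_exponent\<close> is \<open>r0\<close>. As \<open>lam < \<mu>\<close>, the ratio
  \<open>N / M\<close> can be made strictly larger than \<open>r0\<close>; for large
  \<open>l\<close> this surplus pays for the constants and the loss \<open>2 * Suc l\<close> per
  gadget.\<close>

lemma exists_exponents:
  assumes lam: "0 < lam" "lam < 1 / 3" and e: "0 < e"
  shows "\<exists>g M N l q. 0 < g \<and> g < 1 \<and> 0 < M \<and> M < N \<and> even (N - M) \<and>
    (1 + lam) * (1 + g) \<le> 1 + real M / real N \<and> 0 < q \<and>
    q = (1 / g) powr (f_exponent (2 * lam / (1 - lam)) - e) \<and>
    q ^ Suc l \<le> real (cap N M l div (2 * Suc l))"
proof -
  define \<mu> where "\<mu> = 2 * lam / (1 - lam)"
  have "lam * (1 - lam) < lam * 2" using lam by (intro mult_strict_left_mono) auto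
  then have \<mu>: "0 < \<mu>" "\<mu> < 1" "lam < \<mu>" using lam by (simp_all add: \<mu>_def field_simps)
  obtain \<phi> where \<phi>: "0 < \<phi>" "\<phi> \<le> (1 - \<mu>) / 2" "f_exponent \<mu> = f_ratio \<mu> \<phi>"
    using f_exponent_is_max(1)[OF \<mu>(1,2)] by auto
  have \<phi>1: "\<phi> < 1 / 2" using \<phi> \<mu> by simp
  define g where "g = \<phi> / (1 - \<phi>)"
  have g: "0 < g" "g < 1" "1 / g = (1 - \<phi>) / \<phi>" using \<phi> \<phi>1 by (auto simp: g_def)
  define r0 where "r0 = (1 - \<phi>) / (\<mu> + \<phi>)"
  have r0: "1 \<le> r0" using \<phi> \<mu> by (simp add: r0_def)
  define D where "D = 1 / g"
  have D: "1 < D" using g(1,2) by (simp add: D_def)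
  have f: "f_exponent \<mu> = ln r0 / ln D" unfolding D_def g(3) \<phi>(3) f_ratio_def r0_def ..
  \<comment> \<open>The ratio \<open>x = M / N\<close> has to be rational, above the left value to
    meet the threshold condition, and below the right value \<open>1 / r0\<close> to ensure the
    growth.\<close>
  have "(lam + \<phi>) / (1 - \<phi>) < (\<mu> + \<phi>) / (1 - \<phi>)"
    using \<mu> \<phi>1 by (intro divide_strict_right_mono) auto
  then obtain x where x: "x \<in> \<rat>" "(lam + \<phi>) / (1 - \<phi>) < x" "x < (\<mu> + \<phi>) / (1 - \<phi>)"
    using Rats_dense_in_real by blast
  have "0 < (lam + \<phi>) / (1 - \<phi>)" using lam \<phi>(1) \<phi>1 by simp
  with x(2) have x0: "0 < x" by linarith
  obtain a b where ab: "b \<noteq> 0" "\<bar>x\<bar> = real a / real b" using Rats_abs_nat_div_natE[OF x(1)] by metis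
  \<comment> \<open>Doubling makes \<open>M\<close> and \<open>N\<close> even, hence also their
    difference.\<close>
  define M N where "M = 2 * a" and "N = 2 * b"
  have MN: "real M / real N = x" using ab x0 by (simp add: M_def N_def)
  have "(\<mu> + \<phi>) / (1 - \<phi>) \<le> 1" using \<phi> \<phi>1 by (simp add: field_simps)
  then have "real M / real N < 1" using MN x(3) by simp
  moreover have "a \<noteq> 0" using ab(2) x0 by (cases "a = 0") simp_all
  ultimately have M: "0 < M" "M < N" "even (N - M)"
    using ab(1) by (simp_all add: M_def N_def field_simps)
  have "1 + g = 1 / (1 - \<phi>)" using \<phi>1 by (simp add: g_def field_simps)
  then have "(1 + lam) * (1 + g) = (1 + lam) * (1 / (1 - \<phi>))" by (rule arg_cong)
  also have "\<dots> = 1 + (lam + \<phi>) / (1 - \<phi>)" using \<phi>1 by (simp add: field_simps)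
  finally have "(1 + lam) * (1 + g) = 1 + (lam + \<phi>) / (1 - \<phi>)" .
  then have 1: "(1 + lam) * (1 + g) \<le> 1 + real M / real N" using x(2) MN by simp
  define r where "r = real N / real M"
  have "r = 1 / x" using MN M by (simp add: r_def flip: MN)
  moreover have "1 / ((\<mu> + \<phi>) / (1 - \<phi>)) < 1 / x"
    by (intro divide_strict_left_mono mult_pos_pos) (use x0 x(3) in linarith)+
  ultimately have r: "r0 < r" by (simp add: r0_def)
  define q where "q = D powr (f_exponent \<mu> - e)"
  have "D powr f_exponent \<mu> = r0" using D r0 by (simp add: f powr_def)
  moreover have "q \<le> D powr f_exponent \<mu>"
    unfolding q_def using D e by (intro powr_mono) auto
  ultimately have q: "0 < q" "q \<le> r0" using D by (auto simp: q_def)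
  define u where "u = r / r0"
  have u: "1 < u" using r r0 by (simp add: u_def)
  obtain c h0 where c: "0 < c" "\<And>h. h0 \<le> h \<Longrightarrow> c * r ^ h \<le> real (cap N M h)"
    using cap_growth[OF M(1,2)] unfolding r_def by blast
  have "\<forall>\<^sub>F l in sequentially. 2 * (1 + q) * (real l + 1) \<le> c * u ^ l"
    using u c(1) q(1) by real_asymp
  then have "\<forall>\<^sub>F l in sequentially. h0 \<le> l \<and> 2 * (1 + q) * (real l + 1) \<le> c * u ^ l"
    by (rule eventually_conj[OF eventually_ge_at_top])
  then obtain l where l: "h0 \<le> l" "2 * (1 + q) * (real l + 1) \<le> c * u ^ l"
    using eventually_happens'[OF sequentially_bot] by blast
  have "q ^ Suc l \<le> q * r0 ^ l" using q r0 by (simp add: power_mono mult_left_mono)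
  moreover have "1 \<le> r0 ^ l" using r0 by simp
  ultimately have "q ^ Suc l + 1 \<le> (1 + q) * r0 ^ l" by (simp add: algebra_simps)
  then have "2 * (real l + 1) * (q ^ Suc l + 1) \<le> 2 * (real l + 1) * ((1 + q) * r0 ^ l)"
    by (intro mult_left_mono) auto
  also have "\<dots> = 2 * (1 + q) * (real l + 1) * r0 ^ l" by (simp add: algebra_simps)
  also have "\<dots> \<le> c * u ^ l * r0 ^ l" using l(2) r0 by (intro mult_right_mono) auto
  also have "\<dots> = c * r ^ l" using r0 by (simp add: u_def power_divide)
  also have "\<dots> \<le> real (cap N M l)" by (rule c(2)[OF l(1)])
  finally have "q ^ Suc l + 1 \<le> real (cap N M l) / real (2 * Suc l)" by (simp add: field_simps)
  also have "\<dots> \<le> real (cap N M l div (2 * Suc l)) + 1"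
    using real_of_int_div3[of "int (cap N M l)" "int (2 * Suc l)"]
    by (simp only: zdiv_int[symmetric] of_int_of_nat_eq)
  finally have "q ^ Suc l \<le> real (cap N M l div (2 * Suc l))" by simp
  then show ?thesis using g M 1 q(1) unfolding q_def \<mu>_def D_def by blast
qed

text \<open>The degrees start at the order of \<open>2 ^ k\<close> and the number of gadgets is as
  large as their decay permits, up to a constant factor in the degrees. The helpers start at degree
  of order \<open>2 ^ (k div w)\<close>: this costs the same factor in the size, and makes the
  failure probability exponentially small in it.\<close>

lemma theorem5_parameters:
  fixes lam e :: real
  assumes lam: "0 < lam" "lam < 1 / 3" and e: "0 < e"
    and e_le: "e \<le> f_exponent (2 * lam / (1 - lam))"
  defines "f \<equiv> f_exponent (2 * lam / (1 - lam))"
  shows "\<exists>C0 C1 C2 w \<delta>. 0 < C0 \<and> 0 < C1 \<and> 0 < C2 \<and> (0::nat) < w \<and> 4 / e \<le> real w \<and> 0 < \<delta> \<and>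
    (\<forall>j>0. \<exists>k (G :: nat pair_pre_digraph). j \<le> k \<and> pair_graph G \<and> j \<le> card (pverts G) \<and>
      real (card (pverts G)) \<le> C0 * 2 ^ k * 2 ^ (k div w) \<and>
      (\<forall>P. 1 - C1 * real (card (pverts G)) * exp (- (\<delta> * 2 ^ (k div w))) \<le>
        measure_pmf.prob (random_coloring G) {x. \<exists>s. C2 * (2 ^ k) powr (1 + (f - e / 2)) \<le> real s \<and>
          enat s \<le> stabilization_time P lam G x}))"
proof -
  obtain g M N l q where par: "0 < g" "g < 1" "0 < M" "M < N" "even (N - M)"
    "(1 + lam) * (1 + g) \<le> 1 + real M / real N" "0 < q" "q = (1 / g) powr (f - e / 2)"
    "q ^ Suc l \<le> real (cap N M l div (2 * Suc l))"
    using exists_exponents[OF lam, of "e / 2"] e unfolding f_def by auto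
  define D where "D = 1 / g"
  have D: "1 < D" "g = 1 / D" using par by (auto simp: D_def)
  define \<beta> where "\<beta> = f - e / 2"
  have \<beta>: "0 < \<beta>" using e e_le by (simp add: \<beta>_def f_def)
  obtain K :: nat where "2 * (1 + lam) / (1 - 3 * lam) \<le> real K" using real_arch_simple by blast
  then have K: "2 * (1 + lam) \<le> real K * (1 - 3 * lam)" using lam by (simp add: field_simps)
  have K0: "0 < K"
  proof (rule ccontr)
    assume "\<not> 0 < K" then show False using K lam by simp
  qed
  \<comment> \<open>By \<open>shrink_ge\<close>, degrees stay at least one as long as
    \<open>g ^ i * 2 ^ k\<close> is at least \<open>X\<close>.\<close>
  define X where "X = 1 + 1 / (1 - g)"
  have X: "1 \<le> X" using par by (simp add: X_def)
  obtain w0 :: nat where "4 / e \<le> real w0" using real_arch_simple by blast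
  define w where "w = Suc w0"
  have w: "0 < w" "4 / e \<le> real w" using \<open>4 / e \<le> real w0\<close> by (auto simp: w_def)
  define \<delta> where "\<delta> = Min {1 / 128, (1 - 3 * lam) / 4, 1 / (2 * real K)}"
  have \<delta>0: "0 < \<delta>" using lam K0 by (simp add: \<delta>_def)
  have \<delta>_le: "\<delta> \<le> x" if "x \<in> {1 / 128, (1 - 3 * lam) / 4, 1 / (2 * real K)}" for x
    unfolding \<delta>_def using that by (intro Min_le) auto
  have \<delta>: "0 < \<delta>" "\<delta> \<le> 1 / 128" "\<delta> \<le> (1 - 3 * lam) / 4" "\<delta> \<le> 1 / (2 * real K)"
    by (rule \<delta>0, (rule \<delta>_le, simp)+)
  define c where "c = (K + 1) * (2 * K) ^ (2 * Suc l)"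
  define B where "B = c * N ^ Suc l"
  have B: "1 \<le> B" using K0 par by (simp add: B_def c_def Suc_le_eq)
  define A where "A = (1 + 2 * real (Suc l) + ln 2 / ln D + real (Suc (2 * Suc l))) * real w +
      real (Suc (2 * Suc l) * (280 * (c * N)))"
  have lnD: "0 < ln D" using D by simp
  have A: "0 < A" using lnD w unfolding A_def by (intro add_pos_nonneg mult_pos_pos) auto
  have main: "\<exists>k (G :: nat pair_pre_digraph). j \<le> k \<and> pair_graph G \<and> j \<le> card (pverts G) \<and>
      real (card (pverts G)) \<le> (real B * A) * 2 ^ k * 2 ^ (k div w) \<and>
      (\<forall>P. 1 - 3 * real (card (pverts G)) * exp (- ((2 * \<delta>\<^sup>2) * 2 ^ (k div w))) \<le>
        measure_pmf.prob (random_coloring G) {x. \<exists>s. (1 / (2 * X)) powr \<beta> * (2 ^ k) powr (1 + \<beta>) \<le> real s \<and>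
          enat s \<le> stabilization_time P lam G x})" if j: "0 < j" for j
  proof -
    obtain I where I: "2 ^ j < D ^ I" using real_arch_pow[OF D(1)] by blast
    have "1 \<le> X * D ^ (I * Suc l)"
      using mult_mono[of 1 X 1 "D ^ (I * Suc l)"] X D one_le_power[of D "I * Suc l"] by simp
    \<comment> \<open>Large enough to keep all degrees positive, but at most twice that, so that
      \<open>D ^ (I * Suc l)\<close> is of order \<open>2 ^ k\<close>.\<close>
    then obtain k where k: "X * D ^ (I * Suc l) \<le> 2 ^ k" "2 ^ k \<le> 2 * (X * D ^ (I * Suc l))"
      using power_2_between by blast
    have "D ^ I \<le> D ^ (I * Suc l)" using D by (intro power_increasing) auto
    also have "\<dots> \<le> X * D ^ (I * Suc l)" using X D by simp
    finally have "(2::real) ^ j < 2 ^ k" using I k(1) by linarith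
    then have "j \<le> k" by simp
    moreover have "0 < I"
    proof (rule ccontr)
      assume "\<not> 0 < I"
      then have "(2::real) ^ j < 1" using I by simp
      then show False using one_le_power[of "2::real" j] by linarith
    qed
    ultimately have Ik: "j \<le> k" "0 < I" "X * D ^ (I * Suc l) \<le> 2 ^ k" "2 ^ k \<le> 2 * (X * D ^ (I * Suc l))"
      using k by auto
    have shrink: "0 < shrink g k i" if "i < I * Suc l" for i
    proof -
      have "D ^ i \<le> D ^ (I * Suc l)" using that D by (intro power_increasing) auto
      then have "X * D ^ i \<le> X * D ^ (I * Suc l)" using X by (intro mult_left_mono) auto
      then have "X * D ^ i \<le> 2 ^ k" using Ik(3) by linarith
      then have "X \<le> g ^ i * 2 ^ k" using D by (simp add: D(2) power_divide field_simps)
      then have "1 \<le> real (shrink g k i)" using shrink_ge[OF par(1,2), of i k] by (simp add: X_def)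
      then show ?thesis by simp
    qed
    interpret construction lam g K N M l I k "k div w"
      using lam par K Ik(2) shrink by unfold_locales auto
    obtain G :: "nat pair_pre_digraph" where G: "pair_graph G" "B * 2 ^ k \<le> card (pverts G)"
      "card (pverts G) \<le> B * 2 ^ k * (Suc (2 * Suc l + I * Suc l) + Suc (2 * Suc l) * Suc k +
        Suc (2 * Suc l) * (280 * (c * N)) * 2 ^ (k div w))"
      "\<And>P. 1 - 3 * real (card (pverts G)) * exp (- 2 * \<delta>\<^sup>2 * 2 ^ (k div w)) \<le>
        measure_pmf.prob (random_coloring G) {x. enat (B * 2 ^ k * (cap N M l div (2 * Suc l)) ^ I)
          \<le> stabilization_time P lam G x}"
      using construction_graph \<delta> unfolding B_def c_def by blast
    have "j < 2 ^ j" by (rule less_exp)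
    also have "(2::nat) ^ j \<le> 2 ^ k" using Ik(1) by (intro power_increasing) auto
    also have "\<dots> \<le> B * 2 ^ k" using B by simp
    also have "\<dots> \<le> card (pverts G)" by (rule G(2))
    finally have jG: "j \<le> card (pverts G)" by simp
    define Y where "Y = (2::real) ^ (k div w)"
    \<comment> \<open>Factors linear in \<open>k\<close>, which come from the numbers of layers, are
      absorbed by \<open>2 ^ (k div w)\<close>.\<close>
    have kY: "real (Suc k) \<le> real w * Y"
    proof -
      have "k < w * (k div w) + w" using w(1) by (metis add_less_cancel_left mod_less_divisor mult_div_mod_eq)
      then have "Suc k \<le> w * Suc (k div w)" by simp
      also have "\<dots> \<le> w * 2 ^ (k div w)" by (rule mult_le_mono2[OF Suc_leI[OF less_exp]])
      finally have "real (Suc k) \<le> real (w * 2 ^ (k div w))" by (rule of_nat_mono)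
      then show ?thesis by (simp add: Y_def)
    qed
    have Il: "real (I * Suc l) \<le> ln 2 / ln D * real (Suc k)"
    proof -
      have "1 * D ^ (I * Suc l) \<le> X * D ^ (I * Suc l)" using X D by (intro mult_right_mono) auto
      also have "\<dots> \<le> 2 ^ k" by (rule Ik(3))
      finally have "ln (D ^ (I * Suc l)) \<le> ln (2 ^ k)" using D by simp
      then have "real (I * Suc l) * ln D \<le> real k * ln 2" using D by (simp add: ln_realpow)
      also have "\<dots> \<le> real (Suc k) * ln 2" by simp
      finally show ?thesis using lnD by (simp add: field_simps)
    qed
    have "real (Suc (2 * Suc l + I * Suc l) + Suc (2 * Suc l) * Suc k + Suc (2 * Suc l) * (280 * (c * N)) * 2 ^ (k div w))
        = (1 + 2 * real (Suc l)) + real (I * Suc l) + real (Suc (2 * Suc l)) * real (Suc k) +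
          real (Suc (2 * Suc l) * (280 * (c * N))) * Y"
      unfolding Y_def by (simp add: algebra_simps)
    also have "\<dots> \<le> (1 + 2 * real (Suc l)) * real (Suc k) + ln 2 / ln D * real (Suc k) +
          real (Suc (2 * Suc l)) * real (Suc k) + real (Suc (2 * Suc l) * (280 * (c * N))) * Y"
      using Il by (intro add_mono) auto
    also have "\<dots> = (1 + 2 * real (Suc l) + ln 2 / ln D + real (Suc (2 * Suc l))) * real (Suc k) +
          real (Suc (2 * Suc l) * (280 * (c * N))) * Y" by (simp only: distrib_right)
    also have "\<dots> \<le> (1 + 2 * real (Suc l) + ln 2 / ln D + real (Suc (2 * Suc l))) * (real w * Y) +
          real (Suc (2 * Suc l) * (280 * (c * N))) * Y"
      using lnD by (intro add_mono mult_left_mono kY) auto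
    also have "\<dots> = A * Y" unfolding A_def by (simp only: distrib_right mult.assoc)
    finally have "real (B * 2 ^ k) * real (Suc (2 * Suc l + I * Suc l) + Suc (2 * Suc l) * Suc k +
        Suc (2 * Suc l) * (280 * (c * N)) * 2 ^ (k div w)) \<le> real (B * 2 ^ k) * (A * Y)"
      by (rule mult_left_mono) simp
    moreover have "real (card (pverts G)) \<le> real (B * 2 ^ k) * real (Suc (2 * Suc l + I * Suc l) + Suc (2 * Suc l) * Suc k +
        Suc (2 * Suc l) * (280 * (c * N)) * 2 ^ (k div w))"
      using of_nat_mono[OF G(3)] by (simp only: of_nat_mult)
    ultimately have cardG: "real (card (pverts G)) \<le> (real B * A) * 2 ^ k * 2 ^ (k div w)"
      by (simp add: Y_def mult_ac)
    define s where "s = B * 2 ^ k * (cap N M l div (2 * Suc l)) ^ I"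
    have s: "(1 / (2 * X)) powr \<beta> * (2 ^ k) powr (1 + \<beta>) \<le> real s"
    proof -
      have "(1 / (2 * X)) powr \<beta> * (2 ^ k) powr \<beta> = ((1 / (2 * X)) * 2 ^ k) powr \<beta>"
        by (subst powr_mult) (use X in auto)
      also have "\<dots> \<le> (D ^ (I * Suc l)) powr \<beta>"
        using Ik(4) X \<beta> by (intro powr_mono2) (auto simp: field_simps)
      also have "\<dots> = (D powr \<beta>) ^ (Suc l * I)"
        using D by (simp add: powr_powr mult.commute flip: powr_realpow)
      also have "\<dots> = (q ^ Suc l) ^ I" unfolding par(8) power_mult \<beta>_def D_def ..
      also have "\<dots> \<le> real (cap N M l div (2 * Suc l)) ^ I"
        using par(7,9) by (intro power_mono) auto
      finally have "2 ^ k * ((1 / (2 * X)) powr \<beta> * (2 ^ k) powr \<beta>) \<le> (real B * 2 ^ k) * real (cap N M l div (2 * Suc l)) ^ I"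
        using B by (intro mult_mono) auto
      then show ?thesis by (simp add: s_def powr_add mult_ac)
    qed
    have "1 - 3 * real (card (pverts G)) * exp (- ((2 * \<delta>\<^sup>2) * 2 ^ (k div w))) \<le>
        measure_pmf.prob (random_coloring G) {x. \<exists>s. (1 / (2 * X)) powr \<beta> * (2 ^ k) powr (1 + \<beta>) \<le> real s \<and>
          enat s \<le> stabilization_time P lam G x}" for P
    proof -
      have "1 - 3 * real (card (pverts G)) * exp (- ((2 * \<delta>\<^sup>2) * 2 ^ (k div w))) \<le>
          measure_pmf.prob (random_coloring G) {x. enat s \<le> stabilization_time P lam G x}"
        using G(4)[of P] unfolding s_def by simp
      also have "\<dots> \<le> measure_pmf.prob (random_coloring G)
          {x. \<exists>s. (1 / (2 * X)) powr \<beta> * (2 ^ k) powr (1 + \<beta>) \<le> real s \<and> enat s \<le> stabilization_time P lam G x}"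
        using s by (intro measure_pmf.finite_measure_mono) auto
      finally show ?thesis .
    qed
    then show ?thesis using Ik(1) G(1) jG cardG by blast
  qed
  have pos: "0 < real B * A" "(0::real) < 3" "0 < (1 / (2 * X)) powr \<beta>" "0 < 2 * \<delta>\<^sup>2"
    using B A X \<delta>(1) by auto
  show ?thesis
    unfolding \<beta>_def[symmetric]
    by (rule exI[of _ "real B * A"], rule exI[of _ "3::real"], rule exI[of _ "(1 / (2 * X)) powr \<beta>"],
      rule exI[of _ w], rule exI[of _ "2 * \<delta>\<^sup>2"], intro conjI, (rule pos w)+, intro allI impI, erule main)
qed

theorem theorem5:
  fixes P :: process and lam \<epsilon> :: real
  assumes "0 < lam" and "lam < 1 / 3" and "0 < \<epsilon>"
  shows "\<exists>\<G> :: nat pair_pre_digraph set.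
    (\<forall>G\<in>\<G>. pair_graph G) \<and>
    (\<forall>N. \<exists>G\<in>\<G>. card (pverts G) \<ge> N) \<and>
    (\<exists>C>0. with_high_probability \<G> (\<lambda>G x.
       ereal (C * real (card (pverts G)) powr (1 + f_exponent (2 * lam / (1 - lam)) - \<epsilon>))
         \<le> ereal_of_enat (stabilization_time P lam G x)))"
proof -
  define f where "f = f_exponent (2 * lam / (1 - lam))"
  have "0 < 2 * lam / (1 - lam)" "2 * lam / (1 - lam) < 1"
    using assms(1,2) by (auto simp: field_simps)
  then have f: "0 < f" "f < 1" using f_exponent_is_max(2,3) by (auto simp: f_def)
  \<comment> \<open>A smaller loss gives a stronger bound; capping it at \<open>f\<close> keeps the
    exponents \<open>f - e\<close> and \<open>f - e / 2\<close> nonnegative.\<close>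
  define e where "e = min \<epsilon> f"
  have e: "0 < e" "e \<le> f" "e \<le> \<epsilon>" using f assms(3) by (auto simp: e_def)
  obtain C0 C1 C2 w \<delta> where C: "0 < C0" "0 < C1" "0 < C2" "0 < (w::nat)" "4 / e \<le> real w" "0 < \<delta>" and
    graphs: "\<And>j. 0 < j \<Longrightarrow> \<exists>k (G :: nat pair_pre_digraph). j \<le> k \<and> pair_graph G \<and> j \<le> card (pverts G) \<and>
      real (card (pverts G)) \<le> C0 * 2 ^ k * 2 ^ (k div w) \<and>
      (\<forall>P. 1 - C1 * real (card (pverts G)) * exp (- (\<delta> * 2 ^ (k div w))) \<le>
        measure_pmf.prob (random_coloring G) {x. \<exists>s. C2 * (2 ^ k) powr (1 + (f - e / 2)) \<le> real s \<and>
          enat s \<le> stabilization_time P lam G x})"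
    using theorem5_parameters[OF assms(1,2) e(1) e(2)[unfolded f_def]] unfolding f_def by blast
  define C where "C = C2 / C0 powr (1 + f - e)"
  have C': "0 < C" using C by (simp add: C_def)
  \<comment> \<open>With \<open>y = 2 ^ (k div w)\<close>, \<open>2 ^ k\<close> is of order at most
    \<open>y ^ w\<close> and \<open>n\<close> of order at most the square of \<open>2 ^ k\<close>.
    So \<open>n * n\<close> is of order at most \<open>y ^ J\<close> and is beaten by the
    exponential, which gives failure probability \<open>D / n\<close>.\<close>
  define J where "J = 4 * w"
  define D where "D = C1 * C0\<^sup>2 * 2 ^ J * (real J / \<delta>) ^ J"
  \<comment> \<open>The class collects all graphs satisfying the bound with these fixed constants.
    High probability then holds by definition, with exponent \<open>1\<close>; the content is that
    the class has arbitrarily large members.\<close>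
  define \<G> where "\<G> = {G :: nat pair_pre_digraph. pair_graph G \<and> 0 < card (pverts G) \<and>
    1 - D * real (card (pverts G)) powr (- 1) \<le> measure_pmf.prob (random_coloring G)
      {x. ereal (C * real (card (pverts G)) powr (1 + f - \<epsilon>)) \<le> ereal_of_enat (stabilization_time P lam G x)}}"
  have large: "\<exists>G\<in>\<G>. j \<le> card (pverts G)" if j: "0 < j" for j
  proof -
    obtain k and G :: "nat pair_pre_digraph" where G: "pair_graph G" "j \<le> card (pverts G)"
      "real (card (pverts G)) \<le> C0 * 2 ^ k * 2 ^ (k div w)"
      "1 - C1 * real (card (pverts G)) * exp (- (\<delta> * 2 ^ (k div w))) \<le>
        measure_pmf.prob (random_coloring G) {x. \<exists>s. C2 * (2 ^ k) powr (1 + (f - e / 2)) \<le> real s \<and>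
          enat s \<le> stabilization_time P lam G x}"
      using graphs[OF j] by blast
    define n where "n = real (card (pverts G))"
    define y where "y = (2::real) ^ (k div w)"
    have n: "1 \<le> n" using G(2) j by (simp add: n_def)
    have y: "1 \<le> y" by (simp add: y_def)
    have ny: "n \<le> C0 * 2 ^ k * y" using G(3) by (simp add: n_def y_def)
    have ky: "(2::real) ^ k \<le> 2 ^ w * y ^ w"
    proof -
      have "k = w * (k div w) + k mod w" by simp
      also have "\<dots> \<le> w * (k div w) + w" using C(4) by (intro add_left_mono) (simp add: less_imp_le)
      finally have "(2::real) ^ k \<le> 2 ^ (w * (k div w) + w)" by (intro power_increasing) auto
      then show ?thesis by (simp add: y_def power_add power_mult[symmetric] mult.commute)
    qed
    have yk: "y powr real w \<le> 2 ^ k"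
    proof -
      have "y powr real w = 2 ^ (k div w * w)" using y by (simp add: powr_realpow y_def power_mult)
      also have "\<dots> \<le> 2 ^ k" by (intro power_increasing) auto
      finally show ?thesis .
    qed
    have "n * n \<le> C0\<^sup>2 * 2 ^ J * y ^ J"
    proof -
      have "y \<le> 2 ^ k"
      proof -
        have "k div w \<le> k" by simp
        then show ?thesis unfolding y_def by (intro power_increasing) auto
      qed
      then have "C0 * 2 ^ k * y \<le> C0 * 2 ^ k * 2 ^ k" using C(1) by (intro mult_left_mono) auto
      with ny have "n \<le> C0 * (2 ^ k)\<^sup>2" by (simp add: power2_eq_square)
      then have "n * n \<le> (C0 * (2 ^ k)\<^sup>2) * (C0 * (2 ^ k)\<^sup>2)" using n by (intro mult_mono) auto
      also have "\<dots> = C0\<^sup>2 * (2 ^ k) ^ 4" by (simp add: power2_eq_square power4_eq_xxxx)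
      also have "\<dots> \<le> C0\<^sup>2 * (2 ^ w * y ^ w) ^ 4" using ky by (intro mult_left_mono power_mono) auto
      also have "\<dots> = C0\<^sup>2 * 2 ^ J * y ^ J"
        by (simp add: J_def power_mult_distrib power_mult[symmetric] mult.commute)
      finally show ?thesis .
    qed
    then have "C1 * (n * n) * exp (- (\<delta> * y)) \<le> C1 * (C0\<^sup>2 * 2 ^ J * y ^ J) * exp (- (\<delta> * y))"
      using C(2) by (intro mult_right_mono mult_left_mono) auto
    also have "\<dots> = C1 * C0\<^sup>2 * 2 ^ J * (y ^ J * exp (- (\<delta> * y)))" by simp
    also have "\<dots> \<le> D"
      unfolding D_def using C y by (intro mult_left_mono power_le_exp) (auto simp: J_def)
    finally have "C1 * n * exp (- (\<delta> * y)) \<le> D * n powr (- 1)"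
      using n by (simp add: powr_minus field_simps)
    then have 1: "1 - D * n powr (- 1) \<le> 1 - C1 * n * exp (- (\<delta> * y))" by simp
    have "n powr (1 + f - \<epsilon>) \<le> n powr (1 + f - e)" using n e by (intro powr_mono) auto
    also have "\<dots> \<le> (C0 * 2 ^ k * y) powr (1 + f - e)"
      using ny n e f by (intro powr_mono2) auto
    also have "\<dots> = C0 powr (1 + f - e) * ((2 ^ k) powr (1 + f - e) * y powr (1 + f - e))"
      using C y by (simp add: powr_mult)
    also have "\<dots> \<le> C0 powr (1 + f - e) * ((2 ^ k) powr (1 + f - e) * (2 ^ k) powr (e / 2))"
    proof (intro mult_left_mono)
      \<comment> \<open>The left side is below \<open>2\<close> because \<open>f < 1\<close>; the
        right side is at least \<open>2\<close> because \<open>4 / e \<le> w\<close>. So the size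
        overhead costs at most \<open>e / 2\<close> in the exponent.\<close>
      have "1 + f - e \<le> real w * (e / 2)" using C(5) e f by (simp add: field_simps)
      then have "y powr (1 + f - e) \<le> y powr (real w * (e / 2))" using y by (intro powr_mono) auto
      also have "\<dots> = (y powr real w) powr (e / 2)" by (simp add: powr_powr)
      also have "\<dots> \<le> (2 ^ k) powr (e / 2)" using yk e by (intro powr_mono2) auto
      finally show "y powr (1 + f - e) \<le> (2 ^ k) powr (e / 2)" .
    qed auto
    also have "\<dots> = C0 powr (1 + f - e) * (2 ^ k) powr (1 + (f - e / 2))"
      by (simp add: powr_add[symmetric] algebra_simps)
    finally have "C * n powr (1 + f - \<epsilon>) \<le> C * (C0 powr (1 + f - e) * (2 ^ k) powr (1 + (f - e / 2)))"
      using C' by (intro mult_left_mono) auto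
    also have "\<dots> = C2 * (2 ^ k) powr (1 + (f - e / 2))" using C(1) by (simp add: C_def)
    finally have 2: "C * n powr (1 + f - \<epsilon>) \<le> C2 * (2 ^ k) powr (1 + (f - e / 2))" .
    have "measure_pmf.prob (random_coloring G) {x. \<exists>s. C2 * (2 ^ k) powr (1 + (f - e / 2)) \<le> real s \<and>
          enat s \<le> stabilization_time P lam G x} \<le>
        measure_pmf.prob (random_coloring G)
          {x. ereal (C * n powr (1 + f - \<epsilon>)) \<le> ereal_of_enat (stabilization_time P lam G x)}"
    proof (intro measure_pmf.finite_measure_mono subsetI CollectI)
      fix x assume "x \<in> {x. \<exists>s. C2 * (2 ^ k) powr (1 + (f - e / 2)) \<le> real s \<and>
          enat s \<le> stabilization_time P lam G x}"
      then obtain s where s: "C2 * (2 ^ k) powr (1 + (f - e / 2)) \<le> real s" "enat s \<le> stabilization_time P lam G x"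
        by blast
      have "ereal (C * n powr (1 + f - \<epsilon>)) \<le> ereal (real s)" using 2 s(1) by simp
      also have "\<dots> = ereal_of_enat (enat s)" by simp
      also have "\<dots> \<le> ereal_of_enat (stabilization_time P lam G x)"
        using s(2) by (simp only: ereal_of_enat_le_iff)
      finally show "ereal (C * n powr (1 + f - \<epsilon>)) \<le> ereal_of_enat (stabilization_time P lam G x)" .
    qed simp
    then have "G \<in> \<G>"
      using G(1,2,4) j 1 unfolding \<G>_def n_def y_def by auto
    then show ?thesis using G(2) by blast
  qed
  have "\<exists>G\<in>\<G>. N \<le> card (pverts G)" for N
    using large[OF zero_less_Suc[of N]] Suc_leD by blast
  moreover have "with_high_probability \<G> (\<lambda>G x.
       ereal (C * real (card (pverts G)) powr (1 + f - \<epsilon>)) \<le> ereal_of_enat (stabilization_time P lam G x))"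
    unfolding with_high_probability_def
    by (intro exI[of _ 1] conjI exI[of _ D] always_eventually) (auto simp: \<G>_def)
  moreover have "\<forall>G\<in>\<G>. pair_graph G" by (simp add: \<G>_def)
  ultimately show ?thesis using C' unfolding f_def by blast
qed

end
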